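(* Let $\alpha \colon G \to \mathrm{Aut}(A)$ be an action of a compact group $G$ on a finite dimensional C*-algebra $A$. Then $(G, A, \alpha)$ is equivariantly semiprojective.
   Context: For a topological group $G$, a unital $G$-algebra $(G, A, \alpha)$ is a unital C*-algebra $A$ with a continuous action $\alpha \colon G \to \mathrm{Aut}(A)$ (i.e. $g \mapsto \alpha_g(a)$ is norm continuous for every $a \in A$). Ideals are closed and two-sided, homomorphisms are $*$-homomorphisms, and quotients by $G$-invariant ideals carry the induced actions. Equivariantly semiprojective: a unital $G$-algebra $(G, A, \alpha)$ is equivariantly semiprojective if whenever $(G, C, \gamma)$ is a unital $G$-algebra, $J_0 \subset J_1 \subset \cdots$ are $G$-invariant ideals in $C$, $J = \overline{\bigcup_{n=0}^{\infty} J_n}$, $\pi_n \colon C/J_n \to C/J$ are the quotient maps, and $\varphi \colon A \to C/J$ is a unital equivariant homomorphism, then there exist $n$ and a unital equivariant homomorphism $\psi \colon A \to C/J_n$ such that $\pi_n \circ \psi = \varphi$. *)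

theory Defs
  imports "HOL-Analysis.Analysis" "HOL-Algebra.Algebra"
begin

section \<open>Unital C*-algebras\<close>

definition complex_field :: "complex ring" where
  "complex_field = \<lparr>carrier = UNIV, mult = (*), one = 1, ring.zero = 0, add = (+)\<rparr>"

record 'a cstar_algebra = "(complex, 'a) module" +
  adj :: "'a \<Rightarrow> 'a"
  nrm :: "'a \<Rightarrow> real"

text \<open>
  The library locale \<^locale>\<open>Metric_space\<close> requires a distance function that is symmetric and
  nonnegative on the whole type, so the norm distance is set to 0 outside the carrier.
\<close>

definition norm_dist :: "('a, 'm) cstar_algebra_scheme \<Rightarrow> 'a \<Rightarrow> 'a \<Rightarrow> real" where
  "norm_dist A x y =
     (if x \<in> carrier A \<and> y \<in> carrier A then nrm A (x \<ominus>\<^bsub>A\<^esub> y) else 0)"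

definition norm_topology :: "('a, 'm) cstar_algebra_scheme \<Rightarrow> 'a topology" where
  "norm_topology A = Metric_space.mtopology (carrier A) (norm_dist A)"

text \<open>The zero algebra (\<open>\<one> = \<zero>\<close>) is admitted; it arises as the quotient by the whole algebra.\<close>

locale unital_cstar_algebra = ring A + scalars: module complex_field A
  for A :: "('a, 'm) cstar_algebra_scheme" (structure) +
  assumes smult_mult_left:
      "\<lbrakk>x \<in> carrier A; y \<in> carrier A\<rbrakk> \<Longrightarrow> (c \<odot> x) \<otimes> y = c \<odot> (x \<otimes> y)"
    and smult_mult_right:
      "\<lbrakk>x \<in> carrier A; y \<in> carrier A\<rbrakk> \<Longrightarrow> x \<otimes> (c \<odot> y) = c \<odot> (x \<otimes> y)"
    and adj_closed: "x \<in> carrier A \<Longrightarrow> adj A x \<in> carrier A"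
    and adj_adj: "x \<in> carrier A \<Longrightarrow> adj A (adj A x) = x"
    and adj_add:
      "\<lbrakk>x \<in> carrier A; y \<in> carrier A\<rbrakk> \<Longrightarrow> adj A (x \<oplus> y) = adj A x \<oplus> adj A y"
    and adj_smult: "x \<in> carrier A \<Longrightarrow> adj A (c \<odot> x) = cnj c \<odot> adj A x"
    and adj_mult:
      "\<lbrakk>x \<in> carrier A; y \<in> carrier A\<rbrakk> \<Longrightarrow> adj A (x \<otimes> y) = adj A y \<otimes> adj A x"
    and nrm_nonneg: "x \<in> carrier A \<Longrightarrow> 0 \<le> nrm A x"
    and nrm_eq_0_iff: "x \<in> carrier A \<Longrightarrow> nrm A x = 0 \<longleftrightarrow> x = \<zero>"
    and nrm_triangle:
      "\<lbrakk>x \<in> carrier A; y \<in> carrier A\<rbrakk> \<Longrightarrow> nrm A (x \<oplus> y) \<le> nrm A x + nrm A y"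
    and nrm_smult: "x \<in> carrier A \<Longrightarrow> nrm A (c \<odot> x) = cmod c * nrm A x"
    and nrm_mult:
      "\<lbrakk>x \<in> carrier A; y \<in> carrier A\<rbrakk> \<Longrightarrow> nrm A (x \<otimes> y) \<le> nrm A x * nrm A y"
    and cstar_identity: "x \<in> carrier A \<Longrightarrow> nrm A (adj A x \<otimes> x) = (nrm A x)\<^sup>2"
    and complete: "Metric_space.mcomplete (carrier A) (norm_dist A)"

definition finite_dimensional :: "('a, 'm) cstar_algebra_scheme \<Rightarrow> bool" where
  "finite_dimensional A \<longleftrightarrow>
     (\<exists>B. finite B \<and> B \<subseteq> carrier A \<and>
        (\<forall>x\<in>carrier A. \<exists>c :: 'a \<Rightarrow> complex. x = (\<Oplus>\<^bsub>A\<^esub>b\<in>B. c b \<odot>\<^bsub>A\<^esub> b)))"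

definition unital_star_hom ::
  "('a, 'm) cstar_algebra_scheme \<Rightarrow> ('b, 'n) cstar_algebra_scheme \<Rightarrow> ('a \<Rightarrow> 'b) \<Rightarrow> bool" where
  "unital_star_hom A B f \<longleftrightarrow>
     f \<in> ring_hom A B \<and>
     (\<forall>c. \<forall>x\<in>carrier A. f (c \<odot>\<^bsub>A\<^esub> x) = c \<odot>\<^bsub>B\<^esub> f x) \<and>
     (\<forall>x\<in>carrier A. f (adj A x) = adj B (f x))"

definition star_automorphism :: "('a, 'm) cstar_algebra_scheme \<Rightarrow> ('a \<Rightarrow> 'a) \<Rightarrow> bool" where
  "star_automorphism A f \<longleftrightarrow> unital_star_hom A A f \<and> bij_betw f (carrier A) (carrier A)"

text \<open>
  A two-sided ring ideal of a unital algebra is automatically a complex subspace, and a closed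
  one is automatically self-adjoint, so neither is required here.
\<close>

definition closed_ideal :: "('a, 'm) cstar_algebra_scheme \<Rightarrow> 'a set \<Rightarrow> bool" where
  "closed_ideal A I \<longleftrightarrow> ideal I A \<and> closedin (norm_topology A) I"

text \<open>
  The quotient extends the library's quotient ring, whose elements are the cosets
  \<open>I +> x\<close>. A map \<open>f\<close> is passed to cosets as in \<^const>\<open>rcoset_mult\<close>: the union
  collapses to the single coset \<open>I +> f x\<close> whenever \<open>f\<close> is compatible with the cosets.
\<close>

definition coset_map :: "('a, 'm) cstar_algebra_scheme \<Rightarrow> 'a set \<Rightarrow> ('a \<Rightarrow> 'a) \<Rightarrow> 'a set \<Rightarrow> 'a set" where
  "coset_map A I f S = (\<Union>x\<in>S. I +>\<^bsub>A\<^esub> f x)"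

definition cstar_quotient ::
  "('a, 'm) cstar_algebra_scheme \<Rightarrow> 'a set \<Rightarrow> 'a set cstar_algebra" where
  "cstar_quotient A I =
     \<lparr>carrier = carrier (A Quot I), mult = mult (A Quot I), one = one (A Quot I),
      ring.zero = ring.zero (A Quot I), add = ring.add (A Quot I),
      smult = (\<lambda>c. coset_map A I (\<lambda>x. c \<odot>\<^bsub>A\<^esub> x)),
      adj = coset_map A I (adj A),
      nrm = (\<lambda>S. INF x\<in>S. nrm A x)\<rparr>"


section \<open>Group actions\<close>

text \<open>No separation axiom is imposed on topological groups.\<close>

definition topological_group :: "('g, 'k) monoid_scheme \<Rightarrow> 'g topology \<Rightarrow> bool" where
  "topological_group G T \<longleftrightarrow>
     group G \<and> topspace T = carrier G \<and>
     continuous_map (prod_topology T T) T (\<lambda>(g, h). g \<otimes>\<^bsub>G\<^esub> h) \<and>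
     continuous_map T T (\<lambda>g. inv\<^bsub>G\<^esub> g)"

definition compact_group :: "('g, 'k) monoid_scheme \<Rightarrow> 'g topology \<Rightarrow> bool" where
  "compact_group G T \<longleftrightarrow> topological_group G T \<and> compact_space T"

definition unital_G_algebra ::
  "('g, 'k) monoid_scheme \<Rightarrow> 'g topology \<Rightarrow> ('a, 'm) cstar_algebra_scheme \<Rightarrow> ('g \<Rightarrow> 'a \<Rightarrow> 'a) \<Rightarrow> bool"
  where
  "unital_G_algebra G T A \<alpha> \<longleftrightarrow>
     topological_group G T \<and> unital_cstar_algebra A \<and>
     (\<forall>g\<in>carrier G. star_automorphism A (\<alpha> g)) \<and>
     (\<forall>g\<in>carrier G. \<forall>h\<in>carrier G. \<forall>a\<in>carrier A. \<alpha> (g \<otimes>\<^bsub>G\<^esub> h) a = \<alpha> g (\<alpha> h a)) \<and>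
     (\<forall>a\<in>carrier A. continuous_map T (norm_topology A) (\<lambda>g. \<alpha> g a))"

definition invariant_ideal ::
  "('g, 'k) monoid_scheme \<Rightarrow> ('a, 'm) cstar_algebra_scheme \<Rightarrow> ('g \<Rightarrow> 'a \<Rightarrow> 'a) \<Rightarrow> 'a set \<Rightarrow> bool"
  where
  "invariant_ideal G A \<alpha> I \<longleftrightarrow> closed_ideal A I \<and> (\<forall>g\<in>carrier G. \<alpha> g ` I \<subseteq> I)"

definition quotient_action ::
  "('a, 'm) cstar_algebra_scheme \<Rightarrow> 'a set \<Rightarrow> ('g \<Rightarrow> 'a \<Rightarrow> 'a) \<Rightarrow> 'g \<Rightarrow> 'a set \<Rightarrow> 'a set" where
  "quotient_action A I \<alpha> g = coset_map A I (\<alpha> g)"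

definition unital_equivariant_hom ::
  "('g, 'k) monoid_scheme \<Rightarrow>
   ('a, 'm) cstar_algebra_scheme \<Rightarrow> ('g \<Rightarrow> 'a \<Rightarrow> 'a) \<Rightarrow>
   ('b, 'n) cstar_algebra_scheme \<Rightarrow> ('g \<Rightarrow> 'b \<Rightarrow> 'b) \<Rightarrow> ('a \<Rightarrow> 'b) \<Rightarrow> bool" where
  "unital_equivariant_hom G A \<alpha> B \<beta> f \<longleftrightarrow>
     unital_star_hom A B f \<and>
     (\<forall>g\<in>carrier G. \<forall>a\<in>carrier A. f (\<alpha> g a) = \<beta> g (f a))"


section \<open>Equivariant semiprojectivity\<close>

text \<open>
  HOL cannot quantify over types inside a formula, so the type \<open>'c\<close> containing the carriers of the
  test algebras \<open>C\<close> is a parameter. The map \<open>coset_map C J (\<lambda>x. x)\<close> is the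
  canonical map \<open>C/J\<^sub>n \<rightarrow> C/J\<close>, sending \<open>J\<^sub>n +> x\<close> to \<open>J +> x\<close>.
\<close>

definition equivariantly_semiprojective ::
  "'c itself \<Rightarrow> ('g, 'k) monoid_scheme \<Rightarrow> 'g topology \<Rightarrow>
   ('a, 'm) cstar_algebra_scheme \<Rightarrow> ('g \<Rightarrow> 'a \<Rightarrow> 'a) \<Rightarrow> bool" where
  "equivariantly_semiprojective TYPE('c) G T A \<alpha> \<longleftrightarrow>
     (\<forall>(C :: 'c cstar_algebra) \<gamma> (I :: nat \<Rightarrow> 'c set) J \<phi>.
        unital_G_algebra G T C \<gamma> \<and>
        (\<forall>n. invariant_ideal G C \<gamma> (I n)) \<and>
        (\<forall>n. I n \<subseteq> I (Suc n)) \<and>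
        J = norm_topology C closure_of (\<Union>n. I n) \<and>
        unital_equivariant_hom G A \<alpha> (cstar_quotient C J) (quotient_action C J \<gamma>) \<phi>
        \<longrightarrow>
        (\<exists>n \<psi>.
           unital_equivariant_hom G A \<alpha> (cstar_quotient C (I n)) (quotient_action C (I n) \<gamma>) \<psi> \<and>
           (\<forall>a\<in>carrier A. coset_map C J (\<lambda>x. x) (\<psi> a) = \<phi> a)))"

end

theory Submission
  imports Defs
begin

text \<open>
  Averaging over the compact group gives an equivariant, linear, star-preserving lift \<open>f: A \<rightarrow> C\<close> of \<open>\<phi>\<close>.
  Its multiplicative defect takes values in \<open>J\<close>, so modulo \<open>I n\<close> it is small when \<open>n\<close> is large. A Newton iteration
  in \<open>C/I n\<close>, built from the canonical diagonal \<open>\<Sum>\<^sub>b b \<otimes> dual b\<close> of \<open>A\<close> (dual bases for the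
  trace of the left regular representation), removes the defect quadratically. The diagonal is invariant under all
  automorphisms of \<open>A\<close> and the iteration is natural in the target, so the limit is equivariant and still lifts \<open>\<phi>\<close>.

  Neither Haar measure nor the structure theory of C*-algebras is needed: the average is found by a
  Kakutani type fixed point argument, and contractivity of star homomorphisms and self-adjointness of closed
  ideals follow from the square root of \<open>1 - h\<^sup>2\<close>, which is the limit of an elementary contraction.
\<close>

section \<open>Normed star algebras\<close>

text \<open>Tolerances have to be fixed before \<open>n\<close> is chosen, so every constant of the
  iteration depends only on \<open>A\<close>, its basis and the lift \<open>f\<close>:
  \<open>diag_bound\<close> measures the diagonal, \<open>linear_bound\<close> turns estimates on a
  basis into estimates on \<open>A\<close>, and a bound \<open>M\<close> of \<open>f\<close> passes
  to all quotients. The quotients \<open>C/I n\<close> enter as Banach algebras with an isometric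
  involution; the C*-identity acts in \<open>A\<close>, where it makes the trace form nondegenerate,
  and in \<open>C\<close>. A correction of a lift is a solution of a coboundary equation, and such
  solutions are far from unique; an arbitrary one would break equivariance and the lifting property,
  so contraction with the diagonal picks one by a formula. The correction is not aimed at
  \<open>f \<one>\<close>: the limit is multiplicative, so it sends \<open>\<one>\<close> to an
  idempotent, and an idempotent within 1/4 of the unit is the unit.\<close>

lemma complex_field_simps [simp]:
  "carrier complex_field = UNIV"
  "x \<otimes>\<^bsub>complex_field\<^esub> y = x * y"
  "x \<oplus>\<^bsub>complex_field\<^esub> y = x + y"
  "\<one>\<^bsub>complex_field\<^esub> = 1"
  "\<zero>\<^bsub>complex_field\<^esub> = 0"
  by (simp_all add: complex_field_def)

text \<open>The part of the structure that a quotient inherits by taking infima over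
  representatives. Isometry of the adjoint is an axiom here because the C*-identity, from which it
  follows in \<open>unital_cstar_algebra\<close>, is not among the assumptions.\<close>

locale star_normed_algebra = ring A + scalars: module complex_field A
  for A :: "('a, 'm) cstar_algebra_scheme" (structure) +
  assumes smult_mult_left:
      "\<lbrakk>x \<in> carrier A; y \<in> carrier A\<rbrakk> \<Longrightarrow> (c \<odot> x) \<otimes> y = c \<odot> (x \<otimes> y)"
    and smult_mult_right:
      "\<lbrakk>x \<in> carrier A; y \<in> carrier A\<rbrakk> \<Longrightarrow> x \<otimes> (c \<odot> y) = c \<odot> (x \<otimes> y)"
    and adj_closed [simp]: "x \<in> carrier A \<Longrightarrow> adj A x \<in> carrier A"
    and adj_adj [simp]: "x \<in> carrier A \<Longrightarrow> adj A (adj A x) = x"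
    and adj_add:
      "\<lbrakk>x \<in> carrier A; y \<in> carrier A\<rbrakk> \<Longrightarrow> adj A (x \<oplus> y) = adj A x \<oplus> adj A y"
    and adj_smult: "x \<in> carrier A \<Longrightarrow> adj A (c \<odot> x) = cnj c \<odot> adj A x"
    and adj_mult:
      "\<lbrakk>x \<in> carrier A; y \<in> carrier A\<rbrakk> \<Longrightarrow> adj A (x \<otimes> y) = adj A y \<otimes> adj A x"
    and nrm_nonneg: "x \<in> carrier A \<Longrightarrow> 0 \<le> nrm A x"
    and nrm_eq_0_iff: "x \<in> carrier A \<Longrightarrow> nrm A x = 0 \<longleftrightarrow> x = \<zero>"
    and nrm_triangle:
      "\<lbrakk>x \<in> carrier A; y \<in> carrier A\<rbrakk> \<Longrightarrow> nrm A (x \<oplus> y) \<le> nrm A x + nrm A y"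
    and nrm_smult: "x \<in> carrier A \<Longrightarrow> nrm A (c \<odot> x) = cmod c * nrm A x"
    and nrm_mult:
      "\<lbrakk>x \<in> carrier A; y \<in> carrier A\<rbrakk> \<Longrightarrow> nrm A (x \<otimes> y) \<le> nrm A x * nrm A y"
    and nrm_adj [simp]: "x \<in> carrier A \<Longrightarrow> nrm A (adj A x) = nrm A x"
begin

lemma smult_in [simp, intro]: "x \<in> carrier A \<Longrightarrow> c \<odot> x \<in> carrier A"
  using scalars.smult_closed by simp

lemma smult_add_left: "x \<in> carrier A \<Longrightarrow> (c + d) \<odot> x = c \<odot> x \<oplus> d \<odot> x"
  using scalars.smult_l_distr[of c d x] by simp

lemma smult_add_right:
  "\<lbrakk>x \<in> carrier A; y \<in> carrier A\<rbrakk> \<Longrightarrow> c \<odot> (x \<oplus> y) = c \<odot> x \<oplus> c \<odot> y"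
  using scalars.smult_r_distr by simp

lemma smult_smult: "x \<in> carrier A \<Longrightarrow> c \<odot> (d \<odot> x) = (c * d) \<odot> x"
  using scalars.smult_assoc1[of c d x] by simp

lemma smult_1 [simp]: "x \<in> carrier A \<Longrightarrow> 1 \<odot> x = x"
  using scalars.smult_one by simp

lemma smult_0 [simp]: "x \<in> carrier A \<Longrightarrow> 0 \<odot> x = \<zero>"
  using scalars.smult_l_null by simp

lemma smult_zero [simp]: "c \<odot> \<zero> = \<zero>"
  using scalars.smult_r_null by simp

lemma smult_neg1: "x \<in> carrier A \<Longrightarrow> (-1) \<odot> x = \<ominus> x"
  using smult_add_left[of x "-1" 1] by (intro minus_equality[symmetric]) auto

lemma smult_minus: "x \<in> carrier A \<Longrightarrow> c \<odot> (\<ominus> x) = \<ominus> (c \<odot> x)"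
  by (simp add: smult_smult flip: smult_neg1)

lemma smult_diff:
  "\<lbrakk>x \<in> carrier A; y \<in> carrier A\<rbrakk> \<Longrightarrow> c \<odot> (x \<ominus> y) = c \<odot> x \<ominus> c \<odot> y"
  by (simp add: a_minus_def smult_add_right smult_minus)

lemma smult_half_add: "x \<in> carrier A \<Longrightarrow> (1/2) \<odot> x \<oplus> (1/2) \<odot> x = x"
  by (simp flip: smult_add_left)

lemma smult_2: "x \<in> carrier A \<Longrightarrow> 2 \<odot> x = x \<oplus> x"
  using smult_add_left[of x 1 1] by simp

lemma smult_cancel:
  "\<lbrakk>c \<noteq> 0; x \<in> carrier A; y \<in> carrier A; c \<odot> x = c \<odot> y\<rbrakk> \<Longrightarrow> x = y"
  by (metis smult_smult left_inverse smult_1)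

lemma minus_self [simp]: "x \<in> carrier A \<Longrightarrow> x \<ominus> x = \<zero>"
  by (simp add: right_minus_eq)

lemma minus_eq_zero_iff:
  "\<lbrakk>x \<in> carrier A; y \<in> carrier A\<rbrakk> \<Longrightarrow> x \<ominus> y = \<zero> \<longleftrightarrow> x = y"
  by (simp add: right_minus_eq)

lemma adj_minus: "x \<in> carrier A \<Longrightarrow> adj A (\<ominus> x) = \<ominus> adj A x"
  by (simp add: adj_smult flip: smult_neg1)

lemma adj_diff: "\<lbrakk>x \<in> carrier A; y \<in> carrier A\<rbrakk> \<Longrightarrow> adj A (x \<ominus> y) = adj A x \<ominus> adj A y"
  by (simp add: a_minus_def adj_add adj_minus)

lemma adj_zero [simp]: "adj A \<zero> = \<zero>"
  using adj_smult[of \<zero> 0] by simp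

lemma adj_one [simp]: "adj A \<one> = \<one>"
  by (metis adj_adj adj_closed adj_mult l_one one_closed)

lemma nrm_zero [simp]: "nrm A \<zero> = 0"
  by (simp add: nrm_eq_0_iff)

lemma nrm_minus [simp]: "x \<in> carrier A \<Longrightarrow> nrm A (\<ominus> x) = nrm A x"
  by (simp add: nrm_smult flip: smult_neg1)

lemma nrm_diff_le: "\<lbrakk>x \<in> carrier A; y \<in> carrier A\<rbrakk> \<Longrightarrow> nrm A (x \<ominus> y) \<le> nrm A x + nrm A y"
  using nrm_triangle[of x "\<ominus> y"] by (simp add: a_minus_def)

lemma nrm_diff_commute:
  assumes "x \<in> carrier A" "y \<in> carrier A"
  shows "nrm A (x \<ominus> y) = nrm A (y \<ominus> x)"
proof -
  have "x \<ominus> y = \<ominus> (y \<ominus> x)" using assms by algebra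
  then show ?thesis using assms by simp
qed

lemma nrm_diff_triangle:
  assumes "x \<in> carrier A" "y \<in> carrier A" "z \<in> carrier A"
  shows "nrm A (x \<ominus> z) \<le> nrm A (x \<ominus> y) + nrm A (y \<ominus> z)"
proof -
  have "x \<ominus> z = (x \<ominus> y) \<oplus> (y \<ominus> z)" using assms by algebra
  then show ?thesis using assms nrm_triangle by simp
qed

lemma nrm_le_add_diff:
  assumes "x \<in> carrier A" "y \<in> carrier A"
  shows "nrm A x \<le> nrm A y + nrm A (x \<ominus> y)"
proof -
  have "x = y \<oplus> (x \<ominus> y)" using assms by algebra
  then show ?thesis using assms nrm_triangle by (metis minus_closed)
qed

section \<open>Norm metric and convergence of sequences\<close>

sublocale metric: Metric_space "carrier A" "norm_dist A"
proof
  fix x y z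
  show "0 \<le> norm_dist A x y" by (simp add: norm_dist_def nrm_nonneg)
  show "norm_dist A x y = norm_dist A y x" by (simp add: norm_dist_def nrm_diff_commute)
  show "norm_dist A x y = 0 \<longleftrightarrow> x = y" if "x \<in> carrier A" "y \<in> carrier A"
    using that by (simp add: norm_dist_def nrm_eq_0_iff minus_eq_zero_iff)
  show "norm_dist A x z \<le> norm_dist A x y + norm_dist A y z"
    if "x \<in> carrier A" "y \<in> carrier A" "z \<in> carrier A"
    using that by (simp add: norm_dist_def nrm_diff_triangle)
qed

lemma topspace_norm_topology [simp]: "topspace (norm_topology A) = carrier A"
  by (simp add: norm_topology_def)

text \<open>Membership of all terms in the carrier is built in, since the operations are controlled
  only there and every limit rule would otherwise carry it as a side condition.\<close>

definition tends :: "(nat \<Rightarrow> 'a) \<Rightarrow> 'a \<Rightarrow> bool" where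
  "tends x l \<longleftrightarrow> l \<in> carrier A \<and> (\<forall>n. x n \<in> carrier A) \<and> (\<lambda>n. nrm A (x n \<ominus> l)) \<longlonglongrightarrow> 0"

lemma tends_bound:
  assumes "l \<in> carrier A" "\<And>n. x n \<in> carrier A" "\<And>n. nrm A (x n \<ominus> l) \<le> e n" "e \<longlonglongrightarrow> 0"
  shows "tends x l"
  unfolding tends_def using assms
  by (auto intro!: tendsto_sandwich[OF _ _ tendsto_const assms(4)] simp: nrm_nonneg)

lemma tends_const: "x \<in> carrier A \<Longrightarrow> tends (\<lambda>n. x) x"
  by (rule tends_bound[where e = "\<lambda>n. 0"]) auto

lemma tends_unique:
  assumes "tends x l" "tends x m"
  shows "l = m"
proof -
  have c: "l \<in> carrier A" "m \<in> carrier A" "\<And>n. x n \<in> carrier A"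
    using assms by (auto simp: tends_def)
  have "(\<lambda>n. nrm A (x n \<ominus> l) + nrm A (x n \<ominus> m)) \<longlonglongrightarrow> 0 + 0"
    using assms by (intro tendsto_add) (auto simp: tends_def)
  moreover have "nrm A (l \<ominus> m) \<le> nrm A (x n \<ominus> l) + nrm A (x n \<ominus> m)" for n
    using nrm_diff_triangle[of l "x n" m] c nrm_diff_commute by simp
  ultimately have "nrm A (l \<ominus> m) \<le> 0"
    by (intro LIMSEQ_le_const) auto
  then show ?thesis using c nrm_nonneg[of "l \<ominus> m"] nrm_eq_0_iff[of "l \<ominus> m"]
    by (simp add: minus_eq_zero_iff)
qed

lemma tends_add:
  assumes "tends x l" "tends y m"
  shows "tends (\<lambda>n. x n \<oplus> y n) (l \<oplus> m)"
proof (rule tends_bound)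
  have c: "l \<in> carrier A" "m \<in> carrier A" "\<And>n. x n \<in> carrier A" "\<And>n. y n \<in> carrier A"
    using assms by (auto simp: tends_def)
  show "l \<oplus> m \<in> carrier A" "x n \<oplus> y n \<in> carrier A" for n using c by auto
  show "(\<lambda>n. nrm A (x n \<ominus> l) + nrm A (y n \<ominus> m)) \<longlonglongrightarrow> 0"
    using assms tendsto_add[of _ 0 _ _ 0] by (fastforce simp: tends_def)
  fix n
  have "x n \<oplus> y n \<ominus> (l \<oplus> m) = (x n \<ominus> l) \<oplus> (y n \<ominus> m)"
    using c(1) c(2) c(3)[of n] c(4)[of n] by algebra
  then show "nrm A (x n \<oplus> y n \<ominus> (l \<oplus> m)) \<le> nrm A (x n \<ominus> l) + nrm A (y n \<ominus> m)"
    using nrm_triangle c by simp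
qed

lemma tends_smult:
  assumes "tends x l"
  shows "tends (\<lambda>n. c \<odot> x n) (c \<odot> l)"
proof (rule tends_bound)
  have c: "l \<in> carrier A" "\<And>n. x n \<in> carrier A"
    using assms by (auto simp: tends_def)
  show "c \<odot> l \<in> carrier A" "c \<odot> x n \<in> carrier A" for n using c by auto
  show "(\<lambda>n. cmod c * nrm A (x n \<ominus> l)) \<longlonglongrightarrow> 0"
    using assms tendsto_mult_right_zero by (auto simp: tends_def)
  show "nrm A (c \<odot> x n \<ominus> c \<odot> l) \<le> cmod c * nrm A (x n \<ominus> l)" for n
    using c by (simp add: nrm_smult flip: smult_diff)
qed

lemma tends_minus: "tends x l \<Longrightarrow> tends (\<lambda>n. \<ominus> x n) (\<ominus> l)"
  using tends_smult[of x l "-1"] by (simp add: smult_neg1 tends_def)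

lemma tends_diff: "\<lbrakk>tends x l; tends y m\<rbrakk> \<Longrightarrow> tends (\<lambda>n. x n \<ominus> y n) (l \<ominus> m)"
  by (simp add: a_minus_def tends_add tends_minus)

lemma tends_mult:
  assumes "tends x l" "tends y m"
  shows "tends (\<lambda>n. x n \<otimes> y n) (l \<otimes> m)"
proof (rule tends_bound)
  have c: "l \<in> carrier A" "m \<in> carrier A" "\<And>n. x n \<in> carrier A" "\<And>n. y n \<in> carrier A"
    using assms by (auto simp: tends_def)
  show "l \<otimes> m \<in> carrier A" "x n \<otimes> y n \<in> carrier A" for n using c by auto
  let ?a = "\<lambda>n. nrm A (x n \<ominus> l)" and ?b = "\<lambda>n. nrm A (y n \<ominus> m)"
  have "(\<lambda>n. ?a n * ?b n + ?a n * nrm A m + nrm A l * ?b n) \<longlonglongrightarrow> 0 * 0 + 0 * nrm A m + nrm A l * 0"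
    using assms by (intro tendsto_intros) (auto simp: tends_def)
  then show "(\<lambda>n. ?a n * ?b n + ?a n * nrm A m + nrm A l * ?b n) \<longlonglongrightarrow> 0" by simp
  fix n
  have "x n \<otimes> y n \<ominus> l \<otimes> m
      = (x n \<ominus> l) \<otimes> (y n \<ominus> m) \<oplus> (x n \<ominus> l) \<otimes> m \<oplus> l \<otimes> (y n \<ominus> m)"
    using c(1) c(2) c(3)[of n] c(4)[of n] by algebra
  then have "nrm A (x n \<otimes> y n \<ominus> l \<otimes> m) \<le> nrm A ((x n \<ominus> l) \<otimes> (y n \<ominus> m)) + nrm A ((x n \<ominus> l) \<otimes> m)
      + nrm A (l \<otimes> (y n \<ominus> m))"
    using c by (simp only:) (intro order.trans[OF nrm_triangle] add_right_mono nrm_triangle, auto)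
  also have "\<dots> \<le> ?a n * ?b n + ?a n * nrm A m + nrm A l * ?b n"
    using c by (intro add_mono nrm_mult) auto
  finally show "nrm A (x n \<otimes> y n \<ominus> l \<otimes> m) \<le> ?a n * ?b n + ?a n * nrm A m + nrm A l * ?b n" .
qed

lemma tends_adj:
  assumes "tends x l"
  shows "tends (\<lambda>n. adj A (x n)) (adj A l)"
  using assms by (simp add: tends_def flip: adj_diff)

lemma tends_Suc: "tends x l \<Longrightarrow> tends (\<lambda>n. x (Suc n)) l"
  unfolding tends_def by (auto intro: LIMSEQ_Suc)

lemma tends_nrm_le:
  assumes "tends x l" "\<And>n. nrm A (x n) \<le> c"
  shows "nrm A l \<le> c"
proof -
  have c: "l \<in> carrier A" "\<And>n. x n \<in> carrier A"
    using assms by (auto simp: tends_def)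
  have "(\<lambda>n. c + nrm A (x n \<ominus> l)) \<longlonglongrightarrow> c + 0"
    using assms by (intro tendsto_intros) (auto simp: tends_def)
  moreover have "nrm A l \<le> c + nrm A (x n \<ominus> l)" for n
    using nrm_le_add_diff[of l "x n"] c assms(2)[of n] nrm_diff_commute[of l "x n"] by simp
  ultimately show ?thesis by (intro LIMSEQ_le_const[where X = "\<lambda>n. c + nrm A (x n \<ominus> l)"]) auto
qed

lemma tends_closedin:
  assumes "tends x l" "closedin (norm_topology A) S" "\<And>n. x n \<in> S"
  shows "l \<in> S"
proof -
  have l: "l \<in> carrier A" "\<And>n. x n \<in> carrier A" "(\<lambda>n. nrm A (x n \<ominus> l)) \<longlonglongrightarrow> 0"
    using assms by (auto simp: tends_def)
  have "limitin metric.mtopology x l sequentially"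
    using l by (simp add: metric.limit_metric_sequentially norm_dist_def)
      (auto simp: LIMSEQ_def nrm_nonneg)
  moreover have "\<forall>\<sigma> l. range \<sigma> \<subseteq> S \<and> limitin metric.mtopology \<sigma> l sequentially \<longrightarrow> l \<in> S"
    using assms(2) by (simp add: norm_topology_def metric.metric_closedin_iff_sequentially_closed)
  ultimately show ?thesis using assms(3) by blast
qed

lemma closure_of_approx:
  assumes "S \<subseteq> carrier A"
  shows "x \<in> norm_topology A closure_of S \<longleftrightarrow>
    x \<in> carrier A \<and> (\<forall>e>0. \<exists>y\<in>S. nrm A (x \<ominus> y) < e)"
  using assms unfolding norm_topology_def metric.metric_closure_of
  by (auto simp: norm_dist_def subset_iff)

text \<open>A Cauchy sequence has a subsequence whose steps are dominated by \<open>2\<^sup>-\<^sup>n\<close>.\<close>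

lemma mcompleteI:
  assumes fast: "\<And>x. \<lbrakk>\<And>n. x n \<in> carrier A; \<And>n. nrm A (x (Suc n) \<ominus> x n) \<le> (1/2) ^ n\<rbrakk>
    \<Longrightarrow> \<exists>l. tends x l"
  shows "metric.mcomplete"
  unfolding metric.mcomplete_def
proof (intro allI impI)
  fix \<sigma> assume \<sigma>: "metric.MCauchy \<sigma>"
  then have c: "\<sigma> n \<in> carrier A" for n by (auto simp: metric.MCauchy_def)
  have "\<exists>N. \<forall>m m'. N \<le> m \<longrightarrow> N \<le> m' \<longrightarrow> nrm A (\<sigma> m \<ominus> \<sigma> m') < (1/2) ^ n" for n
    using \<sigma> c by (simp add: metric.MCauchy_def norm_dist_def)
  then obtain N where N: "\<And>n m m'. \<lbrakk>N n \<le> m; N n \<le> m'\<rbrakk> \<Longrightarrow> nrm A (\<sigma> m \<ominus> \<sigma> m') < (1/2) ^ n"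
    by metis
  \<comment> \<open>The summand \<open>n\<close> makes \<open>r\<close> strictly increasing; the sum
    makes \<open>r n\<close>, and hence also \<open>r (Suc n)\<close>, at least
    \<open>N n\<close>.\<close>
  define r where "r n = n + sum N {..n}" for n
  have mono: "strict_mono r"
    by (simp add: r_def strict_mono_Suc_iff)
  have "N n \<le> r n" for n
    by (auto simp: r_def intro: trans_le_add2 member_le_sum)
  moreover have "r n \<le> r (Suc n)" for n by (simp add: r_def)
  ultimately have r: "strict_mono r" "N n \<le> r n" "N n \<le> r (Suc n)" for n
    using mono by (auto intro: order.trans)
  have "\<exists>l. tends (\<sigma> \<circ> r) l"
    using c N r by (intro fast) (auto intro: less_imp_le)
  then obtain l where l: "tends (\<sigma> \<circ> r) l" ..
  then have "limitin metric.mtopology (\<sigma> \<circ> r) l sequentially"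
    using c by (simp add: tends_def metric.limit_metric_sequentially norm_dist_def)
      (auto simp: LIMSEQ_def nrm_nonneg)
  then show "\<exists>x. limitin metric.mtopology \<sigma> x sequentially"
    using metric.MCauchy_convergent_subsequence[OF \<sigma> r(1)] by blast
qed

end

locale banach_star_algebra = star_normed_algebra A
  for A :: "('a, 'm) cstar_algebra_scheme" (structure) +
  assumes complete: "Metric_space.mcomplete (carrier A) (norm_dist A)"
begin

lemma Cauchy_tends:
  assumes x: "\<And>n. x n \<in> carrier A"
    and C: "\<And>e. e > 0 \<Longrightarrow> \<exists>N. \<forall>m\<ge>N. \<forall>n\<ge>N. nrm A (x m \<ominus> x n) < e"
  shows "\<exists>l. tends x l"
proof -
  have "metric.MCauchy x"
    using x C by (auto simp: metric.MCauchy_def norm_dist_def)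
  then obtain l where l: "limitin metric.mtopology x l sequentially"
    using complete by (auto simp: metric.mcomplete_def)
  then have "l \<in> carrier A" "\<forall>e>0. \<exists>N. \<forall>n\<ge>N. nrm A (x n \<ominus> l) < e"
    using x by (auto simp: metric.limit_metric_sequentially norm_dist_def)
  then have "tends x l"
    using x by (auto simp: tends_def LIMSEQ_def nrm_nonneg)
  then show ?thesis ..
qed

lemma geometric_tends:
  assumes x: "\<And>n. x n \<in> carrier A" and r: "0 \<le> r" "r < 1"
    and step: "\<And>n. nrm A (x (Suc n) \<ominus> x n) \<le> c * r ^ n"
  shows "\<exists>l. tends x l"
proof (rule Cauchy_tends[OF x])
  have c: "0 \<le> c" using step[of 0] nrm_nonneg[of "x 1 \<ominus> x 0"] x by simp
  have tail: "nrm A (x (n + k) \<ominus> x n) \<le> c * r ^ n / (1 - r)" for n k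
  proof -
    have "nrm A (x (n + k) \<ominus> x n) \<le> c * r ^ n * (\<Sum>i<k. r ^ i)"
    proof (induction k)
      case 0
      then show ?case using x by simp
    next
      case (Suc k)
      have "nrm A (x (n + Suc k) \<ominus> x n) \<le> nrm A (x (n + Suc k) \<ominus> x (n + k)) + nrm A (x (n + k) \<ominus> x n)"
        using x by (intro nrm_diff_triangle)
      also have "\<dots> \<le> c * r ^ (n + k) + c * r ^ n * (\<Sum>i<k. r ^ i)"
        using step[of "n + k"] Suc by simp
      finally show ?case by (simp add: algebra_simps power_add)
    qed
    also have "\<dots> \<le> c * r ^ n * (1 / (1 - r))"
    proof (rule mult_left_mono)
      have "(\<Sum>i<k. r ^ i) = (1 - r ^ k) / (1 - r)"
        using r by (subst sum_gp_strict) auto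
      then show "(\<Sum>i<k. r ^ i) \<le> 1 / (1 - r)"
        using r by (simp add: divide_right_mono)
    qed (use c r in auto)
    finally show ?thesis by simp
  qed
  fix e :: real assume e: "e > 0"
  have "(\<lambda>n. c * r ^ n / (1 - r)) \<longlonglongrightarrow> c * 0 / (1 - r)"
    using r by (intro tendsto_intros LIMSEQ_realpow_zero) auto
  then have "(\<lambda>n. c * r ^ n / (1 - r)) \<longlonglongrightarrow> 0" by simp
  then obtain N where N: "\<And>n. n \<ge> N \<Longrightarrow> c * r ^ n / (1 - r) < e"
    using e by (metis (no_types, lifting) order_tendstoD(2) eventually_sequentially)
  have "nrm A (x m \<ominus> x n) < e" if "m \<ge> N" "n \<ge> N" for m n
  proof (cases "n \<le> m")
    case True
    then show ?thesis using tail[of n "m - n"] N[OF that(2)] by simp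
  next
    case False
    then show ?thesis using tail[of m "n - m"] N[OF that(1)] nrm_diff_commute[OF x x, of m n] by simp
  qed
  then show "\<exists>N. \<forall>m\<ge>N. \<forall>n\<ge>N. nrm A (x m \<ominus> x n) < e" by blast
qed

end

section \<open>Closed ideals and homomorphisms of C*-algebras\<close>

context unital_cstar_algebra
begin

text \<open>The C*-identity bounds the square of the norm of \<open>y\<close> by the product of the
  norms of \<open>adj A y\<close> and \<open>y\<close>. Cancelling a factor gives one inequality;
  the other is the same statement for \<open>adj A y\<close>.\<close>

lemma nrm_adj_eq: 
  assumes "x \<in> carrier A"
  shows "nrm A (adj A x) = nrm A x"
proof -
  have le: "nrm A y \<le> nrm A (adj A y)" if "y \<in> carrier A" for y
  proof (cases "nrm A y = 0")
    case False
    have "nrm A y * nrm A y \<le> nrm A (adj A y) * nrm A y"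
      using nrm_mult[of "adj A y" y] cstar_identity[of y] adj_closed[of y] that
      by (simp add: power2_eq_square)
    then show ?thesis using False nrm_nonneg[of y] that by simp
  qed (use that nrm_nonneg adj_closed in auto)
  show ?thesis using le[of x] le[of "adj A x"] assms by (simp add: adj_closed adj_adj)
qed

end

sublocale unital_cstar_algebra \<subseteq> banach_star_algebra A
  by unfold_locales
    (simp_all add: smult_mult_left smult_mult_right adj_closed adj_adj adj_add adj_smult adj_mult
      nrm_nonneg nrm_eq_0_iff nrm_triangle nrm_smult nrm_mult nrm_adj_eq complete)

context unital_cstar_algebra
begin

lemma nrm_one_le: "nrm A \<one> \<le> 1"
proof -
  have "nrm A \<one> = (nrm A \<one>)\<^sup>2" using cstar_identity[of \<one>] by simp
  then have "nrm A \<one> = 0 \<or> nrm A \<one> = 1" by (simp add: power2_eq_square)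
  then show ?thesis by auto
qed

lemma nrm_sq: "x \<in> carrier A \<Longrightarrow> (nrm A x)\<^sup>2 = nrm A (x \<otimes> adj A x)"
  using cstar_identity[of "adj A x"] by simp

lemma sa_nrm_sq: "\<lbrakk>x \<in> carrier A; adj A x = x\<rbrakk> \<Longrightarrow> nrm A (x \<otimes> x) = (nrm A x)\<^sup>2"
  using cstar_identity[of x] by simp

text \<open>\<open>h + \<i> s\<close> is unitary and \<open>h\<close> is its real part.\<close>

lemma nrm_le_1_of_sum_squares:
  assumes c: "h \<in> carrier A" "s \<in> carrier A" and sa: "adj A h = h" "adj A s = s"
    and comm: "h \<otimes> s = s \<otimes> h" and sum: "h \<otimes> h \<oplus> s \<otimes> s = \<one>"
  shows "nrm A h \<le> 1"
proof -
  define u where "u = h \<oplus> \<i> \<odot> s"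
  have u: "u \<in> carrier A" using c by (simp add: u_def)
  have au: "adj A u = h \<ominus> \<i> \<odot> s"
    using c sa by (simp add: u_def adj_add adj_smult a_minus_def flip: smult_neg1)
      (simp add: smult_smult)
  have "adj A u \<otimes> u = h \<otimes> h \<oplus> h \<otimes> (\<i> \<odot> s) \<ominus> (\<i> \<odot> s) \<otimes> h \<ominus> (\<i> \<odot> s) \<otimes> (\<i> \<odot> s)"
    unfolding au unfolding u_def using c smult_in[of s \<i>] by algebra
  also have "\<dots> = h \<otimes> h \<ominus> (-1) \<odot> (s \<otimes> s)"
    using c comm by (simp add: smult_mult_left smult_mult_right smult_smult a_minus_def a_assoc r_neg)
  also have "\<dots> = \<one>"
    using c sum by (simp add: smult_neg1 a_minus_def)
  finally have "(nrm A u)\<^sup>2 \<le> 1"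
    using cstar_identity[OF u] nrm_one_le by simp
  then have u1: "nrm A u \<le> 1"
    using power2_le_imp_le[of "nrm A u" 1] by simp
  have "u \<oplus> adj A u = h \<oplus> h"
    unfolding au unfolding u_def using c smult_in[of s \<i>] by algebra
  then have "h = (1/2) \<odot> (u \<oplus> adj A u)"
    using c by (simp add: smult_add_right smult_half_add)
  then have "nrm A h = 1/2 * nrm A (u \<oplus> adj A u)"
    using u by (simp add: nrm_smult)
  also have "\<dots> \<le> 1/2 * (nrm A u + nrm A u)"
    using u nrm_triangle[of u "adj A u"] by simp
  finally show ?thesis using u1 by simp
qed

text \<open>The double angle formulas: \<open>2 h s\<close> and \<open>s\<^sup>2 - h\<^sup>2\<close> are again a sine and a cosine.\<close>

lemma nrm_mult_le_half_of_sum_squares: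
  assumes c: "h \<in> carrier A" "s \<in> carrier A" and sa: "adj A h = h" "adj A s = s"
    and comm: "h \<otimes> s = s \<otimes> h" and sum: "h \<otimes> h \<oplus> s \<otimes> s = \<one>"
  shows "nrm A (h \<otimes> s) \<le> 1/2"
proof -
  define a b where "a = h \<otimes> s \<oplus> h \<otimes> s" and "b = s \<otimes> s \<ominus> h \<otimes> h"
  have hh: "h \<otimes> h = \<one> \<ominus> s \<otimes> s" using sum c
    by (metis a_minus_def add.inv_solve_right m_closed one_closed)
  have ab: "a \<in> carrier A" "b \<in> carrier A" using c by (auto simp: a_def b_def)
  have "adj A a = a" "adj A b = b"
    using c sa comm by (simp_all add: a_def b_def adj_add adj_mult adj_diff)
  have hs2: "(h \<otimes> s) \<otimes> (s \<otimes> s) = (s \<otimes> s) \<otimes> (h \<otimes> s)"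
    using comm c by (metis m_assoc m_closed)
  have b: "b = s \<otimes> s \<oplus> s \<otimes> s \<ominus> \<one>"
    unfolding b_def hh using c by algebra
  have "a \<otimes> b = b \<otimes> a"
  proof -
    define p q where "p = h \<otimes> s" and "q = s \<otimes> s"
    have pq: "p \<in> carrier A" "q \<in> carrier A" "p \<otimes> q = q \<otimes> p"
      using c hs2 by (auto simp: p_def q_def)
    show ?thesis unfolding b a_def p_def[symmetric] q_def[symmetric]
      using pq by (simp add: a_minus_def l_distr r_distr l_minus r_minus minus_add a_ac)
  qed
  moreover have "a \<otimes> a \<oplus> b \<otimes> b = \<one>"
  proof -
    define q where "q = s \<otimes> s"
    have q: "q \<in> carrier A" using c by (auto simp: q_def)
    have "(h \<otimes> s) \<otimes> (h \<otimes> s) = (h \<otimes> h) \<otimes> q"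
      using c comm by (metis m_assoc m_closed q_def)
    also have "\<dots> = q \<ominus> q \<otimes> q"
      unfolding hh q_def[symmetric] using q by algebra
    finally have p: "(h \<otimes> s) \<otimes> (h \<otimes> s) = q \<ominus> q \<otimes> q" .
    have "a \<otimes> a = (q \<ominus> q \<otimes> q) \<oplus> (q \<ominus> q \<otimes> q) \<oplus> (q \<ominus> q \<otimes> q) \<oplus> (q \<ominus> q \<otimes> q)"
      unfolding a_def using c q by (simp add: l_distr r_distr p a_assoc)
    moreover have "b \<otimes> b = (q \<otimes> q \<oplus> q \<otimes> q \<oplus> q \<otimes> q \<oplus> q \<otimes> q) \<ominus> q \<ominus> q \<ominus> q \<ominus> q \<oplus> \<one>"
      unfolding b q_def[symmetric] using q
      by (simp add: a_minus_def l_distr r_distr l_minus r_minus minus_add a_ac)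
    ultimately show ?thesis using q by simp algebra
  qed
  ultimately have "nrm A a \<le> 1"
    using ab \<open>adj A a = a\<close> \<open>adj A b = b\<close> by (intro nrm_le_1_of_sum_squares)
  moreover have "a = 2 \<odot> (h \<otimes> s)" using c by (simp add: a_def smult_2)
  ultimately show ?thesis using c by (simp add: nrm_smult)
qed

text \<open>Allows \<open>sqrt_one_minus_square\<close> to be applied when no ideal is in play, as
  in the proof that homomorphisms contract.\<close>

lemma closed_ideal_carrier: "closed_ideal A (carrier A)"
  using closedin_topspace[of "norm_topology A"] oneideal by (simp add: closed_ideal_def)

text \<open>
  With \<open>w = 1 - \<surd>(1 - h\<^sup>2)\<close>, the fixed point equation \<open>w = (h\<^sup>2 + w\<^sup>2) / 2\<close> is a contraction
  on a ball of radius less than 1.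
\<close>

lemma sqrt_one_minus_square:
  assumes I: "closed_ideal A I" and h: "h \<in> I" "adj A h = h" "nrm A h < 1"
  obtains w where "w \<in> I" "adj A w = w" "h \<otimes> w = w \<otimes> h"
    "h \<otimes> h \<oplus> (\<one> \<ominus> w) \<otimes> (\<one> \<ominus> w) = \<one>"
proof -
  interpret I: ideal I A using I by (simp add: closed_ideal_def)
  have hc: "h \<in> carrier A" using h by (simp add: I.Icarr)
  define k where "k = h \<otimes> h"
  have k: "k \<in> I" "k \<in> carrier A" "adj A k = k" "h \<otimes> k = k \<otimes> h"
    using h hc by (auto simp: k_def adj_mult I.I_l_closed m_assoc)
  define \<kappa> where "\<kappa> = (nrm A h)\<^sup>2"
  have \<kappa>: "0 \<le> \<kappa>" "\<kappa> < 1" "nrm A k = \<kappa>"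
    using h hc nrm_nonneg[of h] by (auto simp: \<kappa>_def k_def sa_nrm_sq power_less_one_iff)
  \<comment> \<open>The smaller root of the scalar equation \<rho> = (\<kappa> + \<rho>^2) / 2, so
    the ball of radius \<rho> is mapped into itself; \<rho> < 1 because \<kappa> < 1.\<close>
  define \<rho> where "\<rho> = 1 - sqrt (1 - \<kappa>)"
  have \<rho>: "0 \<le> \<rho>" "\<rho> < 1" "(\<kappa> + \<rho>\<^sup>2) / 2 = \<rho>"
    using \<kappa> by (auto simp: \<rho>_def power2_eq_square field_simps)
  define f where "f = (\<lambda>w. (1/2) \<odot> (k \<oplus> w \<otimes> w))"
  define x where "x = (\<lambda>n. (f ^^ n) \<zero>)"
  have x0: "x 0 = \<zero>" and xS: "x (Suc n) = (1/2) \<odot> (k \<oplus> x n \<otimes> x n)" for n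
    by (simp_all add: x_def f_def)
  have half: "c \<odot> y \<in> I" if "y \<in> I" for c y
    using that I.I_l_closed[of y "c \<odot> \<one>"] by (simp add: smult_mult_left I.Icarr)
  \<comment> \<open>The first three properties are closed conditions and pass to the limit; the norm
    bound supplies the contraction constant.\<close>
  have inv: "x n \<in> I \<and> adj A (x n) = x n \<and> h \<otimes> x n = x n \<otimes> h \<and> nrm A (x n) \<le> \<rho>" for n
  proof (induction n)
    case 0
    show ?case using hc \<rho> by (simp add: x0)
  next
    case (Suc n)
    define w where "w = x n"
    have w: "w \<in> I" "w \<in> carrier A" "adj A w = w" "h \<otimes> w = w \<otimes> h" "nrm A w \<le> \<rho>"
      using Suc I.Icarr by (auto simp: w_def)
    have "h \<otimes> (w \<otimes> w) = (w \<otimes> w) \<otimes> h" using w hc by (metis m_assoc)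
    then have 1: "h \<otimes> f w = f w \<otimes> h"
      using w k hc by (simp add: f_def smult_mult_left smult_mult_right l_distr r_distr)
    have 2: "adj A (f w) = f w"
      using w k by (simp add: f_def adj_smult adj_add adj_mult)
    have 3: "f w \<in> I" unfolding f_def using w k by (intro half I.a_closed I.I_l_closed) auto
    have "nrm A (f w) = 1/2 * nrm A (k \<oplus> w \<otimes> w)" using w k by (simp add: f_def nrm_smult)
    also have "\<dots> \<le> 1/2 * (\<kappa> + nrm A w * nrm A w)"
      using nrm_triangle[of k "w \<otimes> w"] nrm_mult[of w w] w k \<kappa> by simp
    also have "\<dots> \<le> 1/2 * (\<kappa> + \<rho> * \<rho>)"
      using w nrm_nonneg[of w] by (intro mult_left_mono add_left_mono mult_mono) auto
    finally have "nrm A (f w) \<le> \<rho>" using \<rho> by (simp add: power2_eq_square)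
    with 1 2 3 show ?case by (simp add: xS f_def w_def)
  qed
  have xc: "x n \<in> carrier A" for n using inv I.Icarr by blast
  have step: "nrm A (x (Suc n) \<ominus> x n) \<le> \<rho> * \<rho> ^ n" for n
  proof (induction n)
    case 0
    show ?case using inv[of 1] xc[of 1] by (simp add: x0 a_minus_def)
  next
    case (Suc n)
    define v w where "v = x (Suc n)" and "w = x n"
    have vw: "v \<in> carrier A" "w \<in> carrier A" "nrm A v \<le> \<rho>" "nrm A w \<le> \<rho>"
      using xc inv by (auto simp: v_def w_def)
    \<comment> \<open>A splitting of v^2 - w^2 valid in any ring; after halving, the Lipschitz
      constant on the ball is \<rho>.\<close>
    have "(k \<oplus> v \<otimes> v) \<ominus> (k \<oplus> w \<otimes> w) = v \<otimes> (v \<ominus> w) \<oplus> (v \<ominus> w) \<otimes> w"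
      using vw k(2) by algebra
    then have "x (Suc (Suc n)) \<ominus> x (Suc n) = (1/2) \<odot> (v \<otimes> (v \<ominus> w) \<oplus> (v \<ominus> w) \<otimes> w)"
      using vw k by (simp add: xS[of "Suc n"] xS[of n, folded w_def] v_def[symmetric] flip: smult_diff)
        (simp add: v_def xS w_def)
    then have "nrm A (x (Suc (Suc n)) \<ominus> x (Suc n))
        = 1/2 * nrm A (v \<otimes> (v \<ominus> w) \<oplus> (v \<ominus> w) \<otimes> w)"
      using vw by (simp add: nrm_smult)
    also have "\<dots> \<le> 1/2 * (nrm A v * nrm A (v \<ominus> w) + nrm A (v \<ominus> w) * nrm A w)"
      using vw by (intro mult_left_mono order.trans[OF nrm_triangle] add_mono nrm_mult) auto
    also have "\<dots> \<le> 1/2 * (\<rho> * nrm A (v \<ominus> w) + nrm A (v \<ominus> w) * \<rho>)"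
      using vw nrm_nonneg by (intro mult_left_mono add_mono mult_right_mono mult_left_mono) auto
    also have "\<dots> = \<rho> * nrm A (v \<ominus> w)" by simp
    also have "\<dots> \<le> \<rho> * (\<rho> * \<rho> ^ n)"
      using Suc \<rho> by (intro mult_left_mono) (auto simp: v_def w_def)
    finally show ?case by simp
  qed
  obtain w where w: "tends x w"
    using geometric_tends[OF xc \<rho>(1,2) step] by blast
  then have wc: "w \<in> carrier A" by (simp add: tends_def)
  have "tends (\<lambda>n. x (Suc n)) ((1/2) \<odot> (k \<oplus> w \<otimes> w))"
    unfolding xS using w k by (intro tends_smult tends_add tends_mult tends_const)
  then have "(1/2) \<odot> (k \<oplus> w \<otimes> w) = w"
    using tends_Suc[OF w] tends_unique by blast
  then have "2 \<odot> w = k \<oplus> w \<otimes> w"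
    using k wc smult_smult[of "k \<oplus> w \<otimes> w" 2 "1/2"] by auto
  \<comment> \<open>Equivalently, h^2 = 1 - (1 - w)^2.\<close>
  then have ww: "k = (w \<oplus> w) \<ominus> w \<otimes> w"
    using k wc by (simp add: smult_2 a_minus_def a_assoc r_neg)
  show ?thesis
  proof
    show "w \<in> I" using tends_closedin[OF w] I inv by (simp add: closed_ideal_def)
    show "adj A w = w" using tends_unique[OF tends_adj[OF w]] w inv by simp
    show "h \<otimes> w = w \<otimes> h"
      using tends_unique[OF tends_mult[OF tends_const[OF hc] w]] tends_mult[OF w tends_const[OF hc]] inv
      by simp
    show "h \<otimes> h \<oplus> (\<one> \<ominus> w) \<otimes> (\<one> \<ominus> w) = \<one>"
    proof -
      define q where "q = w \<otimes> w"
      have q: "q \<in> carrier A" using wc by (simp add: q_def)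
      have "(\<one> \<ominus> w) \<otimes> (\<one> \<ominus> w) = \<one> \<ominus> w \<ominus> w \<oplus> q"
        unfolding q_def using wc
        by (simp add: a_minus_def l_distr r_distr l_minus r_minus minus_add a_ac)
      then show ?thesis
        unfolding k_def[symmetric] ww q_def[symmetric] using wc q by simp algebra
    qed
  qed
qed

text \<open>
  One step of the approximation: for \<open>h\<close> a multiple of \<open>x x\<^sup>*\<close> of norm 9/10, take \<open>x' = \<surd>(1 - h\<^sup>2) x\<close>.
\<close>

lemma closed_ideal_shrink:
  assumes I: "closed_ideal A I" and x: "x \<in> I"
  obtains x' where "x' \<in> I" "adj A x \<ominus> adj A x' \<in> I" "(nrm A x')\<^sup>2 \<le> 5/9 * (nrm A x)\<^sup>2"
proof (cases "nrm A x = 0")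
  case True
  have "\<zero> \<in> I" using I ideal.axioms(1) by (metis additive_subgroup.zero_closed closed_ideal_def)
  moreover have "x = \<zero>" using True x I nrm_eq_0_iff ideal.Icarr by (metis closed_ideal_def)
  ultimately show ?thesis using that[of \<zero>] by simp
next
  case False
  interpret I: ideal I A using I by (simp add: closed_ideal_def)
  have xc: "x \<in> carrier A" using x by (simp add: I.Icarr)
  define y where "y = x \<otimes> adj A x"
  have y: "y \<in> I" "y \<in> carrier A" "adj A y = y" "nrm A y = (nrm A x)\<^sup>2"
    using x xc by (auto simp: y_def I.I_r_closed adj_mult nrm_sq)
  \<comment> \<open>The scaling puts \<open>h\<close> at norm exactly 9/10: below 1, so that the
    square root exists, and together with the bound 1/2 for \<open>h \<otimes> s\<close> it gives
    the factor (1/2) / (9/10) = 5/9.\<close>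
  define t where "t = 9 / (10 * (nrm A x)\<^sup>2)"
  have t: "t > 0" "t * (nrm A x)\<^sup>2 = 9/10" using False by (auto simp: t_def)
  define h where "h = complex_of_real t \<odot> y"
  have hI: "h \<in> I"
    using y I.I_l_closed[of y "complex_of_real t \<odot> \<one>"] by (simp add: h_def smult_mult_left)
  have h: "h \<in> carrier A" "adj A h = h" "nrm A h < 1"
    using y t by (auto simp: h_def adj_smult nrm_smult)
  obtain w where w: "w \<in> I" "adj A w = w" "h \<otimes> w = w \<otimes> h"
    "h \<otimes> h \<oplus> (\<one> \<ominus> w) \<otimes> (\<one> \<ominus> w) = \<one>"
    using sqrt_one_minus_square[OF I hI h(2,3)] by blast
  have wc: "w \<in> carrier A" using w by (simp add: I.Icarr)
  define s where "s = \<one> \<ominus> w"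
  have s: "s \<in> carrier A" "adj A s = s" "h \<otimes> s = s \<otimes> h" "h \<otimes> h \<oplus> s \<otimes> s = \<one>"
    using w wc h by (auto simp: s_def adj_add adj_minus a_minus_def l_distr r_distr l_minus r_minus)
  have s1: "nrm A s \<le> 1"
    using s h by (intro nrm_le_1_of_sum_squares[of s h]) (auto simp: a_comm)
  have "nrm A (h \<otimes> s) \<le> 1/2"
    using s h by (intro nrm_mult_le_half_of_sum_squares) auto
  then have "t * nrm A (y \<otimes> s) \<le> 1/2"
    using t y s by (simp add: h_def smult_mult_left nrm_smult)
  then have "(t * nrm A (y \<otimes> s)) * (nrm A x)\<^sup>2 \<le> 1/2 * (nrm A x)\<^sup>2"
    by (intro mult_right_mono) auto
  then have "(t * (nrm A x)\<^sup>2) * nrm A (y \<otimes> s) \<le> 1/2 * (nrm A x)\<^sup>2"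
    by (simp only: mult_ac)
  then have ys: "nrm A (y \<otimes> s) \<le> 5/9 * (nrm A x)\<^sup>2" unfolding t(2) by simp
  show ?thesis
  proof
    show "s \<otimes> x \<in> I" using x s by (simp add: I.I_l_closed)
    \<comment> \<open>The adjoint of \<open>x\<close> is not yet known to lie in the ideal, but
      \<open>w\<close> does, so the change of the adjoint, \<open>adj A x \<otimes> w\<close>, lies
      in it.\<close>
    have "adj A (s \<otimes> x) = adj A x \<ominus> adj A x \<otimes> w"
      unfolding adj_mult[OF s(1) xc] s(2) unfolding s_def using xc wc
      by (simp add: a_minus_def r_distr r_minus)
    then have "adj A x \<ominus> adj A (s \<otimes> x) = adj A x \<otimes> w"
      using xc wc by (simp add: a_minus_def minus_add r_neg flip: a_assoc)
    then show "adj A x \<ominus> adj A (s \<otimes> x) \<in> I" using w xc by (simp add: I.I_l_closed)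
    have "(nrm A (s \<otimes> x))\<^sup>2 = nrm A (s \<otimes> (y \<otimes> s))"
      using s xc by (simp add: nrm_sq adj_mult y_def m_assoc)
    also have "\<dots> \<le> nrm A s * nrm A (y \<otimes> s)" using s y by (intro nrm_mult) auto
    also have "\<dots> \<le> 1 * nrm A (y \<otimes> s)" using s1 s y nrm_nonneg by (intro mult_right_mono) auto
    finally show "(nrm A (s \<otimes> x))\<^sup>2 \<le> 5/9 * (nrm A x)\<^sup>2" using ys by simp
  qed
qed

text \<open>Iterating \<open>closed_ideal_shrink\<close> replaces \<open>x\<close> by elements
  \<open>z n\<close> of the ideal that tend to zero, while the adjoint changes only by elements of
  the ideal. So \<open>adj A x\<close> is the limit of the elements
  \<open>adj A x \<ominus> adj A (z n)\<close> of the closed set \<open>I\<close>.\<close>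

lemma closed_ideal_adj:
  assumes I: "closed_ideal A I" and x: "x \<in> I"
  shows "adj A x \<in> I"
proof -
  interpret I: ideal I A using I by (simp add: closed_ideal_def)
  have "\<exists>z. z \<in> I \<and> adj A x \<ominus> adj A z \<in> I \<and> (nrm A z)\<^sup>2 \<le> (5/9) ^ n * (nrm A x)\<^sup>2" for n
  proof (induction n)
    case 0
    show ?case using x I.Icarr by (intro exI[of _ x]) auto
  next
    case (Suc n)
    then obtain z where z: "z \<in> I" "adj A x \<ominus> adj A z \<in> I" "(nrm A z)\<^sup>2 \<le> (5/9) ^ n * (nrm A x)\<^sup>2"
      by blast
    obtain z' where z': "z' \<in> I" "adj A z \<ominus> adj A z' \<in> I" "(nrm A z')\<^sup>2 \<le> 5/9 * (nrm A z)\<^sup>2"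
      using closed_ideal_shrink[OF I z(1)] by blast
    have c: "adj A x \<in> carrier A" "adj A z \<in> carrier A" "adj A z' \<in> carrier A"
      using x z z' I.Icarr by auto
    have "adj A x \<ominus> adj A z' = (adj A x \<ominus> adj A z) \<oplus> (adj A z \<ominus> adj A z')"
      using c by algebra
    then have "adj A x \<ominus> adj A z' \<in> I" using z z' by simp
    then show ?case using z z' by (intro exI[of _ z']) auto
  qed
  then obtain z where z: "\<And>n. z n \<in> I" "\<And>n. adj A x \<ominus> adj A (z n) \<in> I"
    "\<And>n. (nrm A (z n))\<^sup>2 \<le> (5/9) ^ n * (nrm A x)\<^sup>2" by metis
  have c: "x \<in> carrier A" "\<And>n. z n \<in> carrier A" using x z I.Icarr by auto
  have "tends (\<lambda>n. adj A x \<ominus> adj A (z n)) (adj A x)"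
  proof (rule tends_bound)
    have "(\<lambda>n. sqrt ((5/9) ^ n * (nrm A x)\<^sup>2)) \<longlonglongrightarrow> sqrt (0 * (nrm A x)\<^sup>2)"
      by (intro tendsto_intros LIMSEQ_realpow_zero) auto
    then show "(\<lambda>n. sqrt ((5/9) ^ n * (nrm A x)\<^sup>2)) \<longlonglongrightarrow> 0" by simp
    fix n
    have "adj A x \<ominus> adj A (z n) \<ominus> adj A x = \<ominus> adj A (z n)"
      using adj_closed[OF c(1)] adj_closed[OF c(2)[of n]] by algebra
    then show "nrm A (adj A x \<ominus> adj A (z n) \<ominus> adj A x) \<le> sqrt ((5/9) ^ n * (nrm A x)\<^sup>2)"
      using c z(3)[of n] by (simp add: real_le_rsqrt)
  qed (use c in auto)
  then show ?thesis using tends_closedin z(2) I by (metis closed_ideal_def)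
qed

end

lemma unital_star_homD:
  assumes "unital_star_hom A B f"
  shows "x \<in> carrier A \<Longrightarrow> f x \<in> carrier B"
    "\<lbrakk>x \<in> carrier A; y \<in> carrier A\<rbrakk> \<Longrightarrow> f (x \<otimes>\<^bsub>A\<^esub> y) = f x \<otimes>\<^bsub>B\<^esub> f y"
    "\<lbrakk>x \<in> carrier A; y \<in> carrier A\<rbrakk> \<Longrightarrow> f (x \<oplus>\<^bsub>A\<^esub> y) = f x \<oplus>\<^bsub>B\<^esub> f y"
    "f \<one>\<^bsub>A\<^esub> = \<one>\<^bsub>B\<^esub>"
    "x \<in> carrier A \<Longrightarrow> f (c \<odot>\<^bsub>A\<^esub> x) = c \<odot>\<^bsub>B\<^esub> f x"
    "x \<in> carrier A \<Longrightarrow> f (adj A x) = adj B (f x)"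
  using assms by (auto simp: unital_star_hom_def ring_hom_def)

text \<open>The relation h^2 + s^2 = 1 between commuting self-adjoint elements is algebraic, so it
  survives in \<open>B\<close> and bounds \<open>f h\<close> there by
  \<open>nrm_le_1_of_sum_squares\<close>. Scaling settles self-adjoint elements, and the C*-identity
  reduces the general case to them.\<close>

lemma unital_star_hom_contractive:
  assumes A: "unital_cstar_algebra A" and B: "unital_cstar_algebra B"
    and f: "unital_star_hom A B f" and x: "x \<in> carrier A"
  shows "nrm B (f x) \<le> nrm A x"
proof -
  interpret A: unital_cstar_algebra A by fact
  interpret B: unital_cstar_algebra B by fact
  note f = unital_star_homD[OF f]
  have sa: "nrm B (f h) \<le> 1" if h: "h \<in> carrier A" "adj A h = h" "nrm A h < 1" for h
  proof -
    obtain w where w: "w \<in> carrier A" "adj A w = w" "h \<otimes>\<^bsub>A\<^esub> w = w \<otimes>\<^bsub>A\<^esub> h"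
      "h \<otimes>\<^bsub>A\<^esub> h \<oplus>\<^bsub>A\<^esub> (\<one>\<^bsub>A\<^esub> \<ominus>\<^bsub>A\<^esub> w) \<otimes>\<^bsub>A\<^esub> (\<one>\<^bsub>A\<^esub> \<ominus>\<^bsub>A\<^esub> w) = \<one>\<^bsub>A\<^esub>"
      using A.sqrt_one_minus_square[OF A.closed_ideal_carrier h] by blast
    define s where "s = \<one>\<^bsub>A\<^esub> \<ominus>\<^bsub>A\<^esub> w"
    have s: "s \<in> carrier A" "adj A s = s" "h \<otimes>\<^bsub>A\<^esub> s = s \<otimes>\<^bsub>A\<^esub> h" "h \<otimes>\<^bsub>A\<^esub> h \<oplus>\<^bsub>A\<^esub> s \<otimes>\<^bsub>A\<^esub> s = \<one>\<^bsub>A\<^esub>"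
      using w h by (auto simp: s_def A.adj_add A.adj_minus a_minus_def A.l_distr A.r_distr A.l_minus A.r_minus)
    show ?thesis
    proof (rule B.nrm_le_1_of_sum_squares)
      show "f h \<otimes>\<^bsub>B\<^esub> f h \<oplus>\<^bsub>B\<^esub> f s \<otimes>\<^bsub>B\<^esub> f s = \<one>\<^bsub>B\<^esub>"
        using s h by (simp flip: f(2-4))
      show "f h \<otimes>\<^bsub>B\<^esub> f s = f s \<otimes>\<^bsub>B\<^esub> f h"
        using s h by (simp flip: f(2-4))
      show "adj B (f h) = f h" "adj B (f s) = f s" using s h by (simp_all flip: f(6))
    qed (use s h f(1) in auto)
  qed
  have sa': "nrm B (f h) \<le> nrm A h" if h: "h \<in> carrier A" "adj A h = h" for h
  proof (rule field_le_epsilon)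
    fix e :: real assume e: "e > 0"
    \<comment> \<open>Slightly more than the norm of \<open>h\<close>, since \<open>sa\<close> asks
      for norm strictly below 1.\<close>
    define r where "r = nrm A h + e"
    have r: "r > 0" "nrm A h < r" using e A.nrm_nonneg[OF h(1)] by (auto simp: r_def)
    have "nrm B (f (complex_of_real (1/r) \<odot>\<^bsub>A\<^esub> h)) \<le> 1"
      using r h by (intro sa) (auto simp: A.adj_smult A.nrm_smult norm_divide)
    then show "nrm B (f h) \<le> nrm A h + e"
      using r h f(1) by (simp add: f(5) B.nrm_smult norm_divide r_def[symmetric])
  qed
  have "(nrm B (f x))\<^sup>2 = nrm B (f (adj A x \<otimes>\<^bsub>A\<^esub> x))"
    using x f by (simp add: B.cstar_identity)
  also have "\<dots> \<le> nrm A (adj A x \<otimes>\<^bsub>A\<^esub> x)"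
    using x by (intro sa') (auto simp: A.adj_mult)
  also have "\<dots> = (nrm A x)\<^sup>2" using x by (rule A.cstar_identity)
  finally show ?thesis using x A.nrm_nonneg power2_le_imp_le by blast
qed

section \<open>Quotients\<close>

lemma (in ring) mem_a_r_coset_iff:
  assumes "ideal I R" "x \<in> carrier R"
  shows "y \<in> I +> x \<longleftrightarrow> y \<in> carrier R \<and> y \<ominus> x \<in> I"
proof -
  interpret ideal I R by fact
  show ?thesis
  proof
    assume "y \<in> I +> x"
    then obtain i where i: "i \<in> I" "y = i \<oplus> x" by (auto simp: a_r_coset_def')
    then have "y \<ominus> x = i" using assms(2) by (simp add: a_minus_def a_assoc r_neg)
    then show "y \<in> carrier R \<and> y \<ominus> x \<in> I" using i assms(2) by simp
  next
    assume y: "y \<in> carrier R \<and> y \<ominus> x \<in> I"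
    then have "y = (y \<ominus> x) \<oplus> x" using assms(2) by (simp add: a_minus_def a_assoc l_neg)
    then show "y \<in> I +> x" using y by (auto simp: a_r_coset_def')
  qed
qed

text \<open>All representatives of one coset of \<open>I\<close> are sent into the same coset of
  \<open>J\<close>, so the union collapses. With \<open>I = J\<close> this computes scalar
  multiples, adjoints and group actions on a quotient; with two ideals it computes the canonical map
  from one quotient to a smaller one.\<close>

lemma (in unital_cstar_algebra) coset_map_rcoset:
  assumes I: "ideal I A" and J: "ideal J A" and x: "x \<in> carrier A"
    and f: "\<And>y. \<lbrakk>y \<in> carrier A; y \<ominus> x \<in> I\<rbrakk> \<Longrightarrow> f y \<in> carrier A \<and> f y \<ominus> f x \<in> J"
  shows "coset_map A J f (I +> x) = J +> f x"
proof -
  have x': "x \<in> I +> x" "f x \<in> carrier A"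
    using x f[of x] I ideal.axioms(1) additive_subgroup.zero_closed
    by (fastforce simp: mem_a_r_coset_iff[OF I] right_minus_eq)+
  have "J +> f y = J +> f x" if "y \<in> I +> x" for y
  proof -
    have "y \<in> carrier A" "y \<ominus> x \<in> I" using that x by (auto simp: mem_a_r_coset_iff[OF I])
    then show ?thesis using f x' quotient_eq_iff_same_a_r_cos[OF J] by blast
  qed
  then show ?thesis unfolding coset_map_def using x'(1) by (intro UN_constant_eq) blast+
qed

locale cstar_ideal = unital_cstar_algebra A
  for A :: "('a, 'm) cstar_algebra_scheme" (structure) and I +
  assumes closed_ideal: "closed_ideal A I"
begin

sublocale ideal I A
  using closed_ideal by (simp add: closed_ideal_def)

abbreviation "Q \<equiv> cstar_quotient A I"

lemma quotient_simps:
  "carrier Q = carrier (A Quot I)" "mult Q = mult (A Quot I)" "one Q = one (A Quot I)"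
  "ring.zero Q = ring.zero (A Quot I)" "ring.add Q = ring.add (A Quot I)"
  by (simp_all add: cstar_quotient_def)

lemma rcoset_eq_iff: "\<lbrakk>x \<in> carrier A; y \<in> carrier A\<rbrakk> \<Longrightarrow> I +> x = I +> y \<longleftrightarrow> x \<ominus> y \<in> I"
  using quotient_eq_iff_same_a_r_cos[OF ideal_axioms] by blast

lemma smult_ideal: "x \<in> I \<Longrightarrow> c \<odot> x \<in> I"
  using I_l_closed[of x "c \<odot> \<one>"] by (simp add: smult_mult_left)

lemma quotient_carrier: "carrier Q = (\<lambda>x. I +> x) ` carrier A"
  by (auto simp: quotient_simps FactRing_def A_RCOSETS_def' )

lemma quotientE:
  assumes "S \<in> carrier Q"
  obtains x where "x \<in> carrier A" "S = I +> x"
  using assms by (auto simp: quotient_carrier)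

lemma rcoset_in_quotient [simp]: "x \<in> carrier A \<Longrightarrow> I +> x \<in> carrier Q"
  by (auto simp: quotient_carrier)

lemma quotient_add: "\<lbrakk>x \<in> carrier A; y \<in> carrier A\<rbrakk> \<Longrightarrow> (I +> x) \<oplus>\<^bsub>Q\<^esub> (I +> y) = I +> (x \<oplus> y)"
  by (simp add: quotient_simps FactRing_def a_rcos_sum)

lemma quotient_mult: "\<lbrakk>x \<in> carrier A; y \<in> carrier A\<rbrakk> \<Longrightarrow> (I +> x) \<otimes>\<^bsub>Q\<^esub> (I +> y) = I +> (x \<otimes> y)"
  by (simp add: quotient_simps FactRing_def rcoset_mult_add)

lemma quotient_one: "\<one>\<^bsub>Q\<^esub> = I +> \<one>"
  by (simp add: quotient_simps FactRing_def)

lemma quotient_zero: "\<zero>\<^bsub>Q\<^esub> = I +> \<zero>"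
  using a_rcos_const[of \<zero>] by (simp add: quotient_simps FactRing_def)

lemma quotient_smult: "x \<in> carrier A \<Longrightarrow> c \<odot>\<^bsub>Q\<^esub> (I +> x) = I +> (c \<odot> x)"
  unfolding cstar_quotient_def
  by (simp add: coset_map_rcoset ideal_axioms smult_ideal flip: smult_diff)

text \<open>The place where self-adjointness of closed ideals is used: it makes the adjoint well
  defined on cosets.\<close>

lemma quotient_adj: "x \<in> carrier A \<Longrightarrow> adj Q (I +> x) = I +> adj A x"
  unfolding cstar_quotient_def
  by (simp add: coset_map_rcoset ideal_axioms closed_ideal_adj[OF closed_ideal] flip: adj_diff)

lemma ring_quotient: "ring Q"
proof -
  interpret Q: ring "A Quot I" by (rule quotient_is_ring)
  have "abelian_group Q"
    using Q.l_neg by (intro abelian_groupI) (auto simp: quotient_simps Q.a_ac)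
  moreover have "Group.monoid Q"
    by (intro monoidI) (simp_all add: quotient_simps Q.m_assoc)
  ultimately show ?thesis
    by (intro ringI) (simp_all add: quotient_simps Q.l_distr Q.r_distr)
qed

lemma quotient_minus: 
  assumes "x \<in> carrier A" "y \<in> carrier A"
  shows "(I +> x) \<ominus>\<^bsub>Q\<^esub> (I +> y) = I +> (x \<ominus> y)"
proof -
  interpret Q: ring Q by (rule ring_quotient)
  have "(I +> (\<ominus> y)) \<oplus>\<^bsub>Q\<^esub> (I +> y) = \<zero>\<^bsub>Q\<^esub>"
    using assms by (simp add: quotient_add quotient_zero l_neg)
  then have "\<ominus>\<^bsub>Q\<^esub> (I +> y) = I +> (\<ominus> y)"
    using assms by (intro Q.minus_equality) auto
  then show ?thesis using assms by (simp add: a_minus_def quotient_add)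
qed

lemma quotient_nrm_le:
  assumes "x \<in> carrier A"
  shows "nrm Q (I +> x) \<le> nrm A x"
proof -
  have "bdd_below (nrm A ` (I +> x))"
    using assms by (intro bdd_belowI2[of _ 0]) (auto simp: mem_a_r_coset_iff ideal_axioms nrm_nonneg)
  then show ?thesis
    using assms by (simp add: cstar_quotient_def cINF_lower a_rcos_self)
qed

lemma quotient_nrm_approx:
  assumes "x \<in> carrier A" "nrm Q (I +> x) < e"
  obtains y where "y \<in> carrier A" "I +> y = I +> x" "nrm A y < e"
proof -
  have "(INF y\<in>I +> x. nrm A y) < e" using assms by (simp add: cstar_quotient_def)
  then obtain y where "y \<in> I +> x" "nrm A y < e"
    using assms a_rcos_self by (metis (no_types, lifting) cInf_lessD image_iff image_is_empty empty_iff)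
  then show ?thesis
    using that assms by (auto simp: mem_a_r_coset_iff ideal_axioms rcoset_eq_iff)
qed

text \<open>Inequalities are proved on representatives whose norms almost attain the infimum.
  Definiteness comes from \<open>I\<close> being closed; the adjoint is isometric because it is an
  involution that does not increase the norm.\<close>

lemma star_normed_quotient: "star_normed_algebra Q"
proof -
  interpret Q: ring Q by (rule ring_quotient)
  have nn: "0 \<le> nrm Q (I +> x)" if x: "x \<in> carrier A" for x
  proof (rule ccontr)
    assume "\<not> 0 \<le> nrm Q (I +> x)"
    then obtain y where "y \<in> carrier A" "nrm A y < 0"
      using quotient_nrm_approx[OF x, of 0] by auto
    then show False using nrm_nonneg[of y] by simp
  qed
  have "cring complex_field"
    using scalars.R.is_cring .
  then have "module complex_field Q"
    by (intro moduleI Q.abelian_group_axioms)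
      (auto elim!: quotientE simp: quotient_add quotient_smult smult_add_left smult_add_right smult_smult)
  moreover have "star_normed_algebra_axioms Q"
  proof
    fix S T :: "'a set" and c
    assume "S \<in> carrier Q"
    then obtain x where x: "x \<in> carrier A" "S = I +> x" by (rule quotientE)
    show "adj Q S \<in> carrier Q" "adj Q (adj Q S) = S" "adj Q (c \<odot>\<^bsub>Q\<^esub> S) = cnj c \<odot>\<^bsub>Q\<^esub> adj Q S"
      using x by (auto simp: quotient_adj quotient_smult adj_smult)
    show "0 \<le> nrm Q S" using nn x by simp
    show "nrm Q S = 0 \<longleftrightarrow> S = \<zero>\<^bsub>Q\<^esub>"
    proof
      assume 0: "nrm Q S = 0"
      have "\<exists>y. y \<in> carrier A \<and> I +> y = I +> x \<and> nrm A y < (1/2) ^ n" for n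
        using quotient_nrm_approx[OF x(1), of "(1/2) ^ n"] 0 x(2) by fastforce
      then obtain y where y: "\<And>n. y n \<in> carrier A" "\<And>n. I +> y n = I +> x" "\<And>n. nrm A (y n) < (1/2) ^ n"
        by metis
      have "tends (\<lambda>n. x \<ominus> y n) x"
      proof (rule tends_bound)
        show "(\<lambda>n. (1/2) ^ n :: real) \<longlonglongrightarrow> 0" by (intro LIMSEQ_realpow_zero) auto
        fix n
        have "x \<ominus> y n \<ominus> x = \<ominus> y n" using x(1) y(1)[of n] by algebra
        then show "nrm A (x \<ominus> y n \<ominus> x) \<le> (1/2) ^ n" using y by (simp add: less_imp_le)
      qed (use x y in auto)
      moreover have "x \<ominus> y n \<in> I" for n using y x rcoset_eq_iff by metis
      ultimately have "x \<in> I" using closed_ideal tends_closedin by (metis closed_ideal_def)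
      then show "S = \<zero>\<^bsub>Q\<^esub>" using x by (simp add: quotient_zero rcoset_eq_iff a_minus_def)
    next
      assume "S = \<zero>\<^bsub>Q\<^esub>"
      then show "nrm Q S = 0"
        using nn[of \<zero>] quotient_nrm_le[of \<zero>] by (simp add: quotient_zero)
    qed
    have sm: "nrm Q (c \<odot>\<^bsub>Q\<^esub> (I +> z)) \<le> cmod c * nrm Q (I +> z)" if z: "z \<in> carrier A" for c z
    proof (rule field_le_epsilon)
      fix e :: real assume e: "e > 0"
      \<comment> \<open>The added 1 keeps the denominator positive when \<open>c\<close> is
        zero.\<close>
      define d where "d = e / (cmod c + 1)"
      have d: "d > 0" "cmod c * d \<le> e"
        using e add_nonneg_pos[OF norm_ge_zero[of c], of 1] by (auto simp: d_def divide_simps algebra_simps)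
      obtain y where y: "y \<in> carrier A" "I +> y = I +> z" "nrm A y < nrm Q (I +> z) + d"
        using quotient_nrm_approx[OF z, of "nrm Q (I +> z) + d"] d by auto
      have "nrm Q (c \<odot>\<^bsub>Q\<^esub> (I +> z)) = nrm Q (I +> (c \<odot> y))"
        using y by (metis quotient_smult)
      also have "\<dots> \<le> cmod c * nrm A y" using y quotient_nrm_le[of "c \<odot> y"] by (simp add: nrm_smult)
      also have "\<dots> \<le> cmod c * (nrm Q (I +> z) + d)" using y by (intro mult_left_mono) auto
      finally show "nrm Q (c \<odot>\<^bsub>Q\<^esub> (I +> z)) \<le> cmod c * nrm Q (I +> z) + e"
        using d by (simp add: algebra_simps)
    qed
    show "nrm Q (c \<odot>\<^bsub>Q\<^esub> S) = cmod c * nrm Q S"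
    proof (cases "c = 0")
      case True
      then show ?thesis using sm[OF x(1), of c] x nn[of "c \<odot> x"] by (simp add: quotient_smult)
    next
      case False
      \<comment> \<open>The reverse inequality is \<open>sm\<close> for the inverse scalar.\<close>
      have "inverse c \<odot>\<^bsub>Q\<^esub> (I +> (c \<odot> x)) = S"
        using x False by (simp add: quotient_smult smult_smult)
      then have "nrm Q S \<le> inverse (cmod c) * nrm Q (c \<odot>\<^bsub>Q\<^esub> S)"
        using sm[of "c \<odot> x" "inverse c"] x(1) by (simp add: norm_inverse x(2) quotient_smult[OF x(1), of c])
      then have "cmod c * nrm Q S \<le> cmod c * (inverse (cmod c) * nrm Q (c \<odot>\<^bsub>Q\<^esub> S))"
        by (intro mult_left_mono) auto
      also have "\<dots> = nrm Q (c \<odot>\<^bsub>Q\<^esub> S)" using False by simp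
      finally show ?thesis using sm[OF x(1), of c] by (simp add: x(2))
    qed
    have na: "nrm Q (adj Q (I +> z)) \<le> nrm Q (I +> z)" if z: "z \<in> carrier A" for z
    proof (rule field_le_epsilon)
      fix e :: real assume e: "e > 0"
      obtain y where y: "y \<in> carrier A" "I +> y = I +> z" "nrm A y < nrm Q (I +> z) + e"
        using quotient_nrm_approx[OF z, of "nrm Q (I +> z) + e"] e by auto
      then show "nrm Q (adj Q (I +> z)) \<le> nrm Q (I +> z) + e"
        using quotient_nrm_le[of "adj A y"] by (simp flip: y(2) quotient_adj)
    qed
    show "nrm Q (adj Q S) = nrm Q S"
      using na[OF x(1)] na[of "adj A x"] x by (simp add: quotient_adj)
    assume "T \<in> carrier Q"
    then obtain y where y: "y \<in> carrier A" "T = I +> y" by (rule quotientE)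
    show "(c \<odot>\<^bsub>Q\<^esub> S) \<otimes>\<^bsub>Q\<^esub> T = c \<odot>\<^bsub>Q\<^esub> (S \<otimes>\<^bsub>Q\<^esub> T)" "S \<otimes>\<^bsub>Q\<^esub> (c \<odot>\<^bsub>Q\<^esub> T) = c \<odot>\<^bsub>Q\<^esub> (S \<otimes>\<^bsub>Q\<^esub> T)"
      using x y by (auto simp: quotient_smult quotient_mult smult_mult_left smult_mult_right)
    show "adj Q (S \<oplus>\<^bsub>Q\<^esub> T) = adj Q S \<oplus>\<^bsub>Q\<^esub> adj Q T" "adj Q (S \<otimes>\<^bsub>Q\<^esub> T) = adj Q T \<otimes>\<^bsub>Q\<^esub> adj Q S"
      using x y by (auto simp: quotient_adj quotient_mult quotient_add adj_add adj_mult)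
    have approx: "\<exists>x' y'. x' \<in> carrier A \<and> y' \<in> carrier A \<and> S = I +> x' \<and> T = I +> y' \<and>
       nrm A x' < nrm Q S + e \<and> nrm A y' < nrm Q T + e" if "e > 0" for e
      using quotient_nrm_approx[OF x(1), of "nrm Q S + e"] quotient_nrm_approx[OF y(1), of "nrm Q T + e"]
        that x y by (metis less_add_same_cancel1)
    show "nrm Q (S \<oplus>\<^bsub>Q\<^esub> T) \<le> nrm Q S + nrm Q T"
    proof (rule field_le_epsilon)
      fix e :: real assume e: "e > 0"
      then obtain x' y' where *: "x' \<in> carrier A" "y' \<in> carrier A" "S = I +> x'" "T = I +> y'"
        "nrm A x' < nrm Q S + e/2" "nrm A y' < nrm Q T + e/2" using approx[of "e/2"] by auto
      have "nrm Q (S \<oplus>\<^bsub>Q\<^esub> T) \<le> nrm A (x' \<oplus> y')"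
        using * quotient_nrm_le[of "x' \<oplus> y'"] by (simp add: quotient_add)
      also have "\<dots> \<le> nrm A x' + nrm A y'" using * by (intro nrm_triangle)
      finally show "nrm Q (S \<oplus>\<^bsub>Q\<^esub> T) \<le> nrm Q S + nrm Q T + e" using *(5,6) by simp
    qed
    show "nrm Q (S \<otimes>\<^bsub>Q\<^esub> T) \<le> nrm Q S * nrm Q T"
    proof (rule LIMSEQ_le_const)
      \<comment> \<open>The errors enter a product, so both are sent to zero along (1/2)^n rather
        than collected into one epsilon.\<close>
      show "(\<lambda>n. (nrm Q S + (1/2) ^ n) * (nrm Q T + (1/2) ^ n)) \<longlonglongrightarrow> nrm Q S * nrm Q T"
        by (auto intro!: tendsto_eq_intros LIMSEQ_realpow_zero)
      have "nrm Q (S \<otimes>\<^bsub>Q\<^esub> T) \<le> (nrm Q S + (1/2) ^ n) * (nrm Q T + (1/2) ^ n)" for n :: nat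
      proof -
        obtain x' y' where *: "x' \<in> carrier A" "y' \<in> carrier A" "S = I +> x'" "T = I +> y'"
          "nrm A x' < nrm Q S + (1/2) ^ n" "nrm A y' < nrm Q T + (1/2) ^ n"
          using approx[of "(1/2) ^ n"] by auto
        have "nrm Q (S \<otimes>\<^bsub>Q\<^esub> T) \<le> nrm A (x' \<otimes> y')"
          using * quotient_nrm_le[of "x' \<otimes> y'"] by (simp add: quotient_mult)
        also have "\<dots> \<le> nrm A x' * nrm A y'" using * by (intro nrm_mult)
        also have "\<dots> \<le> (nrm Q S + (1/2) ^ n) * (nrm Q T + (1/2) ^ n)"
          using *(1,2,5,6) nrm_nonneg by (intro mult_mono) (auto intro: less_imp_le order.trans)
        finally show ?thesis .
      qed
      then show "\<exists>N. \<forall>n\<ge>N. nrm Q (S \<otimes>\<^bsub>Q\<^esub> T) \<le> (nrm Q S + (1/2) ^ n) * (nrm Q T + (1/2) ^ n)"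
        by blast
    qed
  qed
  ultimately show ?thesis
    by (simp add: star_normed_algebra_def ring_quotient)
qed

text \<open>Representatives are chosen one after another so that each difference nearly attains its
  quotient norm. They form a Cauchy sequence in \<open>A\<close>, and the coset of its limit is the
  limit of the cosets.\<close>

lemma banach_quotient: "banach_star_algebra Q"
proof -
  interpret Q: star_normed_algebra Q by (rule star_normed_quotient)
  have "Q.metric.mcomplete"
  proof (rule Q.mcompleteI)
    fix Y assume Y: "\<And>n. Y n \<in> carrier Q" "\<And>n. nrm Q (Y (Suc n) \<ominus>\<^bsub>Q\<^esub> Y n) \<le> (1/2) ^ n"
    \<comment> \<open>The factor 2 leaves room for a representative, since the infimum need not be
      attained.\<close>
    have "\<exists>x. \<forall>n. (x n \<in> carrier A \<and> I +> x n = Y n) \<and> nrm A (x (Suc n) \<ominus> x n) \<le> 2 * (1/2) ^ n"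
    proof (rule dependent_nat_choice)
      show "\<exists>x. x \<in> carrier A \<and> I +> x = Y 0" using Y(1)[of 0] by (metis quotientE)
      fix x n assume x: "x \<in> carrier A \<and> I +> x = Y n"
      obtain z where z: "z \<in> carrier A" "Y (Suc n) = I +> z" using Y quotientE by metis
      have "nrm Q (I +> (z \<ominus> x)) < 2 * (1/2) ^ n"
        using Y(2)[of n] z x by (simp add: quotient_minus[symmetric])
          (smt (verit) zero_less_power half_gt_zero)
      then obtain y where y: "y \<in> carrier A" "I +> y = I +> (z \<ominus> x)" "nrm A y < 2 * (1/2) ^ n"
        using quotient_nrm_approx[of "z \<ominus> x"] z x by blast
      have "I +> (x \<oplus> y) = I +> (x \<oplus> (z \<ominus> x))"
        using x y z by (metis quotient_add minus_closed)
      also have "x \<oplus> (z \<ominus> x) = z" using x z(1) by (metis a_comm add.inv_solve_right' a_minus_def minus_closed)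
      finally have "I +> (x \<oplus> y) = Y (Suc n)" using z by simp
      moreover have "x \<oplus> y \<ominus> x = y" using conjunct1[OF x] y(1) by algebra
      ultimately show "\<exists>x'. (x' \<in> carrier A \<and> I +> x' = Y (Suc n)) \<and> nrm A (x' \<ominus> x) \<le> 2 * (1/2) ^ n"
        using x y by (intro exI[of _ "x \<oplus> y"]) auto
    qed
    then obtain x where x: "\<And>n. x n \<in> carrier A" "\<And>n. I +> x n = Y n"
      "\<And>n. nrm A (x (Suc n) \<ominus> x n) \<le> 2 * (1/2) ^ n" by blast
    obtain l where l: "tends x l"
      using geometric_tends[OF x(1) _ _ x(3)] by auto
    then have lc: "l \<in> carrier A" by (simp add: tends_def)
    have "Q.tends Y (I +> l)"
    proof (rule Q.tends_bound)
      show "(\<lambda>n. nrm A (x n \<ominus> l)) \<longlonglongrightarrow> 0" using l by (simp add: tends_def)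
      show "nrm Q (Y n \<ominus>\<^bsub>Q\<^esub> (I +> l)) \<le> nrm A (x n \<ominus> l)" for n
        using quotient_nrm_le[of "x n \<ominus> l"] x lc by (simp add: quotient_minus flip: x(2))
    qed (use Y lc in auto)
    then show "\<exists>l. Q.tends Y l" by blast
  qed
  then show ?thesis
    using star_normed_quotient by (simp add: banach_star_algebra_def banach_star_algebra_axioms_def)
qed

end

section \<open>Bases and traces\<close>

definition clinear_map ::
  "('a, 'm) cstar_algebra_scheme \<Rightarrow> ('b, 'n) cstar_algebra_scheme \<Rightarrow> ('a \<Rightarrow> 'b) \<Rightarrow> bool" where
  "clinear_map A B f \<longleftrightarrow>
     (\<forall>x\<in>carrier A. f x \<in> carrier B) \<and>
     (\<forall>x\<in>carrier A. \<forall>y\<in>carrier A. f (x \<oplus>\<^bsub>A\<^esub> y) = f x \<oplus>\<^bsub>B\<^esub> f y) \<and>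
     (\<forall>c. \<forall>x\<in>carrier A. f (c \<odot>\<^bsub>A\<^esub> x) = c \<odot>\<^bsub>B\<^esub> f x)"

lemma clinear_mapD:
  assumes "clinear_map A B f"
  shows "x \<in> carrier A \<Longrightarrow> f x \<in> carrier B"
    "\<lbrakk>x \<in> carrier A; y \<in> carrier A\<rbrakk> \<Longrightarrow> f (x \<oplus>\<^bsub>A\<^esub> y) = f x \<oplus>\<^bsub>B\<^esub> f y"
    "x \<in> carrier A \<Longrightarrow> f (c \<odot>\<^bsub>A\<^esub> x) = c \<odot>\<^bsub>B\<^esub> f x"
  using assms by (auto simp: clinear_map_def)

lemma unital_star_hom_linear: "unital_star_hom A B f \<Longrightarrow> clinear_map A B f"
  using unital_star_homD[of A B f] by (auto simp: clinear_map_def)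

definition clinear_functional :: "('a, 'm) cstar_algebra_scheme \<Rightarrow> ('a \<Rightarrow> complex) \<Rightarrow> bool" where
  "clinear_functional A f \<longleftrightarrow>
     (\<forall>x\<in>carrier A. \<forall>y\<in>carrier A. f (x \<oplus>\<^bsub>A\<^esub> y) = f x + f y) \<and>
     (\<forall>c. \<forall>x\<in>carrier A. f (c \<odot>\<^bsub>A\<^esub> x) = c * f x)"

text \<open>Gaussian elimination: one equation and one unknown, the pivot \<open>p\<close>, are
  removed at a time. The dimension counts below rest on it: the dependency among powers of an
  element and the existence of a dual basis.\<close>

lemma underdetermined_system:
  fixes a :: "'i \<Rightarrow> 'j \<Rightarrow> complex"
  assumes "finite J" "finite I" "card J < card I"
  shows "\<exists>x. (\<exists>i\<in>I. x i \<noteq> 0) \<and> (\<forall>j\<in>J. (\<Sum>i\<in>I. x i * a i j) = 0)"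
  using assms
proof (induction J arbitrary: I a rule: finite_induct)
  case empty
  then obtain i where "i \<in> I" by fastforce
  then show ?case by (intro exI[of _ "\<lambda>_. 1"]) auto
next
  case (insert j0 J)
  show ?case
  proof (cases "\<forall>i\<in>I. a i j0 = 0")
    case True
    obtain x where "\<exists>i\<in>I. x i \<noteq> 0" "\<forall>j\<in>J. (\<Sum>i\<in>I. x i * a i j) = 0"
      using insert.IH[of I a] insert.prems insert.hyps by auto
    then show ?thesis using True by (intro exI[of _ x]) auto
  next
    case False
    then obtain p where p: "p \<in> I" "a p j0 \<noteq> 0" by blast
    define I' where "I' = I - {p}"
    have I': "finite I'" "I = insert p I'" "p \<notin> I'" "card J < card I'"
      using insert.prems insert.hyps p by (auto simp: I'_def card_Diff_singleton)
    \<comment> \<open>The coefficients after the unknown \<open>p\<close> has been eliminated by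
      means of equation \<open>j0\<close>.\<close>
    define a' where "a' i j = a i j - a i j0 / a p j0 * a p j" for i j
    obtain x where x: "\<exists>i\<in>I'. x i \<noteq> 0" "\<forall>j\<in>J. (\<Sum>i\<in>I'. x i * a' i j) = 0"
      using insert.IH[of I' a'] I' by auto
    \<comment> \<open>The value of the pivot unknown that equation \<open>j0\<close>
      dictates.\<close>
    define s where "s = - (\<Sum>i\<in>I'. x i * a i j0) / a p j0"
    define y where "y = x(p := s)"
    have sum_y: "(\<Sum>i\<in>I. y i * a i j) = s * a p j + (\<Sum>i\<in>I'. x i * a i j)" for j
    proof -
      have "(\<Sum>i\<in>I'. y i * a i j) = (\<Sum>i\<in>I'. x i * a i j)"
        using I'(3) by (intro sum.cong) (auto simp: y_def)
      then show ?thesis using I' by (simp add: y_def)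
    qed
    have "(\<Sum>i\<in>I. y i * a i j) = (\<Sum>i\<in>I'. x i * a' i j)" for j
    proof -
      have "(\<Sum>i\<in>I'. x i * (a i j0 / a p j0 * a p j)) = (\<Sum>i\<in>I'. x i * a i j0) / a p j0 * a p j"
      proof -
        have "(\<Sum>i\<in>I'. x i * (a i j0 / a p j0 * a p j)) = (\<Sum>i\<in>I'. x i * a i j0 * (a p j / a p j0))"
          by (intro sum.cong) auto
        also have "\<dots> = (\<Sum>i\<in>I'. x i * a i j0) * (a p j / a p j0)"
          by (rule sum_distrib_right[symmetric])
        finally show ?thesis by simp
      qed
      then show ?thesis
        unfolding sum_y s_def a'_def by (simp add: right_diff_distrib sum_subtractf)
    qed
    moreover have "(\<Sum>i\<in>I. y i * a i j0) = 0"
      unfolding sum_y s_def using p by simp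
    ultimately have "\<forall>j\<in>insert j0 J. (\<Sum>i\<in>I. y i * a i j) = 0"
      using x by simp
    moreover have "\<exists>i\<in>I. y i \<noteq> 0" using x I' by (auto simp: y_def)
    ultimately show ?thesis by blast
  qed
qed

context star_normed_algebra
begin

definition lincomb :: "('a \<Rightarrow> complex) \<Rightarrow> 'a set \<Rightarrow> 'a" where
  "lincomb c B = (\<Oplus>b\<in>B. c b \<odot> b)"

lemma lincomb_empty [simp]: "lincomb c {} = \<zero>"
  by (simp add: lincomb_def)

lemma lincomb_insert:
  "\<lbrakk>finite B; insert b B \<subseteq> carrier A; b \<notin> B\<rbrakk> \<Longrightarrow> lincomb c (insert b B) = c b \<odot> b \<oplus> lincomb c B"
  unfolding lincomb_def by (intro finsum_insert) auto

lemma lincomb_closed [simp]: "B \<subseteq> carrier A \<Longrightarrow> lincomb c B \<in> carrier A"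
  unfolding lincomb_def by (intro finsum_closed) auto

lemma lincomb_cong:
  "\<lbrakk>B \<subseteq> carrier A; \<And>b. b \<in> B \<Longrightarrow> c b = d b\<rbrakk> \<Longrightarrow> lincomb c B = lincomb d B"
  unfolding lincomb_def by (intro finsum_cong') auto

lemma lincomb_add:
  assumes "finite B" "B \<subseteq> carrier A"
  shows "lincomb c B \<oplus> lincomb d B = lincomb (\<lambda>b. c b + d b) B"
proof -
  have "lincomb (\<lambda>b. c b + d b) B = lincomb c B \<oplus> lincomb d B"
    using assms by (induction B rule: finite_induct) (auto simp: lincomb_insert smult_add_left a_ac)
  then show ?thesis ..
qed

lemma lincomb_smult:
  "\<lbrakk>finite B; B \<subseteq> carrier A\<rbrakk> \<Longrightarrow> k \<odot> lincomb c B = lincomb (\<lambda>b. k * c b) B"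
  by (induction B rule: finite_induct) (auto simp: lincomb_insert smult_add_right smult_smult)

lemma lincomb_diff:
  assumes "finite B" "B \<subseteq> carrier A"
  shows "lincomb c B \<ominus> lincomb d B = lincomb (\<lambda>b. c b - d b) B"
  using assms by (simp add: a_minus_def lincomb_smult lincomb_add flip: smult_neg1)

lemma lincomb_zero_coeffs:
  "\<lbrakk>finite B; B \<subseteq> carrier A; \<And>b. b \<in> B \<Longrightarrow> c b = 0\<rbrakk> \<Longrightarrow> lincomb c B = \<zero>"
  by (induction B rule: finite_induct) (auto simp: lincomb_insert)

lemma lincomb_remove:
  assumes "finite B" "B \<subseteq> carrier A" "b \<in> B"
  shows "lincomb c B = c b \<odot> b \<oplus> lincomb c (B - {b})"
  using lincomb_insert[of "B - {b}" b c] assms by (simp add: insert_absorb insert_Diff)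

lemma lincomb_delta:
  assumes "finite B" "B \<subseteq> carrier A" "b \<in> B"
  shows "lincomb (\<lambda>x. if x = b then 1 else 0) B = b"
  using assms lincomb_zero_coeffs[of "B - {b}" "\<lambda>x. if x = b then 1 else 0", OF _ Diff_subset[THEN order.trans]]
    subsetD[OF assms(2,3)]
  by (subst lincomb_remove[OF assms]) auto

lemma nrm_lincomb_le:
  "\<lbrakk>finite B; B \<subseteq> carrier A\<rbrakk> \<Longrightarrow> nrm A (lincomb c B) \<le> (\<Sum>b\<in>B. cmod (c b) * nrm A b)"
proof (induction B rule: finite_induct)
  case (insert b B)
  then show ?case
    using nrm_triangle[of "c b \<odot> b" "lincomb c B"] by (simp add: lincomb_insert nrm_smult)
qed simp

lemma functional_lincomb:
  assumes "clinear_functional A f"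
  shows "\<lbrakk>finite B; B \<subseteq> carrier A\<rbrakk> \<Longrightarrow> f (lincomb c B) = (\<Sum>b\<in>B. c b * f b)"
proof (induction B rule: finite_induct)
  case empty
  have "f (0 \<odot> \<zero>) = 0 * f \<zero>" using assms zero_closed by (metis clinear_functional_def)
  then show ?case by simp
next
  case (insert b B)
  then show ?case using assms by (simp add: lincomb_insert clinear_functional_def)
qed

definition spans :: "'a set \<Rightarrow> bool" where
  "spans B \<longleftrightarrow> finite B \<and> B \<subseteq> carrier A \<and> (\<forall>x\<in>carrier A. \<exists>c. x = lincomb c B)"

definition lin_independent :: "'a set \<Rightarrow> bool" where
  "lin_independent B \<longleftrightarrow> finite B \<and> B \<subseteq> carrier A \<and> (\<forall>c. lincomb c B = \<zero> \<longrightarrow> (\<forall>b\<in>B. c b = 0))"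

text \<open>A choice of coefficients, meaningful for spanning \<open>B\<close>. Even for a basis it
  is determined on \<open>B\<close> only; the values elsewhere are arbitrary.\<close>

definition coord :: "'a set \<Rightarrow> 'a \<Rightarrow> 'a \<Rightarrow> complex" where
  "coord B x = (SOME c. x = lincomb c B)"

text \<open>A spanning subset of least cardinality is independent, since a dependency would allow
  one vector to be dropped.\<close>

lemma spanning_set_contains_basis:
  assumes "spans S"
  obtains B where "B \<subseteq> S" "spans B" "lin_independent B"
proof -
  define B where "B = arg_min card (\<lambda>B. B \<subseteq> S \<and> spans B)"
  have B: "B \<subseteq> S" "spans B"
    using arg_min_natI[of "\<lambda>B. B \<subseteq> S \<and> spans B" S card] assms by (auto simp: B_def)
  have min: "card B \<le> card B'" if "B' \<subseteq> S" "spans B'" for B'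
    using arg_min_nat_le[of "\<lambda>B. B \<subseteq> S \<and> spans B" B' card] that by (simp add: B_def)
  have fin: "finite B" "B \<subseteq> carrier A" using B by (auto simp: spans_def)
  have "c b = 0" if c: "lincomb c B = \<zero>" and b: "b \<in> B" for c b
  proof (rule ccontr)
    assume cb: "c b \<noteq> 0"
    have "\<exists>e. x = lincomb e (B - {b})" if x: "x \<in> carrier A" for x
    proof -
      obtain d where d: "x = lincomb d B" using B x by (auto simp: spans_def)
      \<comment> \<open>Subtracting this multiple of the dependency \<open>c\<close> kills the
        coefficient of \<open>b\<close>.\<close>
      define e where "e = (\<lambda>y. d y - d b / c b * c y)"
      have "x \<ominus> (d b / c b) \<odot> lincomb c B = lincomb e B"
        using fin by (simp add: d lincomb_smult lincomb_diff e_def)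
      then have "x = lincomb e B" using c x by (simp add: a_minus_def)
      also have "\<dots> = lincomb e (B - {b})"
        using cb fin b lincomb_remove[OF fin b, of e] subsetD[OF fin(2) b] lincomb_closed[of "B - {b}" e, OF Diff_subset[THEN order.trans]]
        by (auto simp: e_def)
      finally show ?thesis by blast
    qed
    then have "spans (B - {b})" using fin by (auto simp: spans_def)
    then have "card B \<le> card (B - {b})" using B by (intro min) auto
    then show False using b fin by (metis card_Diff1_less not_le)
  qed
  then have "lin_independent B" using fin by (auto simp: lin_independent_def)
  then show ?thesis using that B by blast
qed

lemma lincomb_coord:
  "\<lbrakk>spans B; x \<in> carrier A\<rbrakk> \<Longrightarrow> lincomb (coord B x) B = x"
  unfolding coord_def spans_def by (metis (mono_tags, lifting) someI_ex)

lemma coord_unique: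
  assumes "spans B" "lin_independent B" "b \<in> B"
  shows "coord B (lincomb c B) b = c b"
proof -
  have fin: "finite B" "B \<subseteq> carrier A" using assms by (auto simp: spans_def)
  have "lincomb (\<lambda>b. coord B (lincomb c B) b - c b) B = \<zero>"
    using lincomb_coord[OF assms(1), of "lincomb c B"] lincomb_diff[OF fin] fin
    by (metis lincomb_closed minus_self)
  then have "coord B (lincomb c B) b - c b = 0"
    using assms unfolding lin_independent_def by blast
  then show ?thesis by simp
qed

lemma coord_functional:
  assumes "spans B" "lin_independent B" "b \<in> B"
  shows "clinear_functional A (\<lambda>x. coord B x b)"
proof -
  have fin: "finite B" "B \<subseteq> carrier A" using assms by (auto simp: spans_def)
  have "coord B (x \<oplus> y) b = coord B x b + coord B y b" if "x \<in> carrier A" "y \<in> carrier A" for x y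
    using coord_unique[OF assms, of "\<lambda>b. coord B x b + coord B y b"] that
      lincomb_add[OF fin, of "coord B x" "coord B y"] lincomb_coord[OF assms(1)] by simp
  moreover have "coord B (k \<odot> x) b = k * coord B x b" if "x \<in> carrier A" for x k
    using coord_unique[OF assms, of "\<lambda>b. k * coord B x b"] that
      lincomb_smult[OF fin, of k "coord B x"] lincomb_coord[OF assms(1)] by simp
  ultimately show ?thesis by (simp add: clinear_functional_def)
qed

lemma coord_basis:
  assumes "spans B" "lin_independent B" "b \<in> B" "b' \<in> B"
  shows "coord B b b' = (if b' = b then 1 else 0)"
  using coord_unique[OF assms(1,2,4), of "\<lambda>x. if x = b then 1 else 0"] lincomb_delta[of B b] assms
  by (simp add: spans_def)

definition trace :: "'a set \<Rightarrow> ('a \<Rightarrow> 'a) \<Rightarrow> complex" where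
  "trace B L = (\<Sum>b\<in>B. coord B (L b) b)"

lemma functional_linear_comp:
  "\<lbrakk>clinear_functional A f; clinear_map A A L\<rbrakk> \<Longrightarrow> clinear_functional A (\<lambda>x. f (L x))"
  by (simp add: clinear_functional_def clinear_map_def)

text \<open>Expanding each basis in the other turns both traces into the same double sum. This
  permits computing the trace in a basis moved by an automorphism or adapted to an
  idempotent.\<close>

lemma trace_basis_independent:
  assumes B: "spans B" "lin_independent B" and B': "spans B'" "lin_independent B'" and L: "clinear_map A A L"
  shows "trace B L = trace B' L"
proof -
  have fin: "finite B" "B \<subseteq> carrier A" "finite B'" "B' \<subseteq> carrier A" 
    using B B' by (auto simp: spans_def)
  have Lc: "L x \<in> carrier A" if "x \<in> carrier A" for x using L that by (simp add: clinear_mapD)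
  have 1: "coord B (L b) b = (\<Sum>b'\<in>B'. coord B' b b' * coord B (L b') b)" if "b \<in> B" for b
  proof -
    have "coord B (L (lincomb (coord B' b) B')) b = (\<Sum>b'\<in>B'. coord B' b b' * coord B (L b') b)"
      using functional_lincomb[OF functional_linear_comp[OF coord_functional[OF B that] L]] fin by simp
    then show ?thesis using lincomb_coord[OF B'(1)] that fin by auto
  qed
  have 2: "coord B' (L b') b' = (\<Sum>b\<in>B. coord B (L b') b * coord B' b b')" if "b' \<in> B'" for b'
  proof -
    have "coord B' (lincomb (coord B (L b')) B) b' = (\<Sum>b\<in>B. coord B (L b') b * coord B' b b')"
      using functional_lincomb[OF coord_functional[OF B' that]] fin by simp
    then show ?thesis using lincomb_coord[OF B(1)] that fin Lc by auto
  qed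
  have "trace B L = (\<Sum>b\<in>B. \<Sum>b'\<in>B'. coord B' b b' * coord B (L b') b)"
    unfolding trace_def using 1 by simp
  also have "\<dots> = (\<Sum>b'\<in>B'. \<Sum>b\<in>B. coord B (L b') b * coord B' b b')"
    by (subst sum.swap) (simp add: mult.commute)
  also have "\<dots> = trace B' L" unfolding trace_def using 2 by simp
  finally show ?thesis .
qed

lemma finsum_swap:
  assumes "finite S" "finite T" "\<And>s t. \<lbrakk>s \<in> S; t \<in> T\<rbrakk> \<Longrightarrow> f s t \<in> carrier A"
  shows "(\<Oplus>s\<in>S. \<Oplus>t\<in>T. f s t) = (\<Oplus>t\<in>T. \<Oplus>s\<in>S. f s t)"
  using assms
proof (induction S rule: finite_induct)
  case (insert s S)
  have "(\<Oplus>r\<in>insert s S. \<Oplus>t\<in>T. f r t) = (\<Oplus>t\<in>T. f s t) \<oplus> (\<Oplus>t\<in>T. \<Oplus>r\<in>S. f r t)"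
    using insert by (subst finsum_insert) (auto intro!: finsum_closed)
  also have "\<dots> = (\<Oplus>t\<in>T. f s t \<oplus> (\<Oplus>r\<in>S. f r t))"
    using insert by (intro finsum_addf[symmetric]) (auto intro!: finsum_closed)
  also have "\<dots> = (\<Oplus>t\<in>T. \<Oplus>r\<in>insert s S. f r t)"
    using insert by (intro finsum_cong' refl) (auto intro!: finsum_closed simp: finsum_insert)
  finally show ?case .
qed simp

lemma nrm_finsum_le:
  "\<lbrakk>finite S; \<And>s. s \<in> S \<Longrightarrow> f s \<in> carrier A\<rbrakk> \<Longrightarrow> nrm A (\<Oplus>s\<in>S. f s) \<le> (\<Sum>s\<in>S. nrm A (f s))"
proof (induction S rule: finite_induct)
  case (insert s S)
  then have "(\<Oplus>s\<in>insert s S. f s) = f s \<oplus> (\<Oplus>s\<in>S. f s)" by (intro finsum_insert) auto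
  then show ?case
    using insert nrm_triangle[of "f s" "\<Oplus>s\<in>S. f s"] by (force intro: finsum_closed)
qed simp

end

lemma clinear_map_finsum:
  assumes A: "star_normed_algebra A" and D: "star_normed_algebra D" and f: "clinear_map A D f"
  shows "\<lbrakk>finite S; \<And>s. s \<in> S \<Longrightarrow> x s \<in> carrier A\<rbrakk> \<Longrightarrow>
    f (finsum A x S) = (\<Oplus>\<^bsub>D\<^esub>s\<in>S. f (x s))"
proof (induction S rule: finite_induct)
  interpret A: star_normed_algebra A by fact
  interpret D: star_normed_algebra D by fact
  {
    case empty
    have "f (0 \<odot>\<^bsub>A\<^esub> \<zero>\<^bsub>A\<^esub>) = 0 \<odot>\<^bsub>D\<^esub> f \<zero>\<^bsub>A\<^esub>" using f by (intro clinear_mapD(3)) auto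
    moreover have "f \<zero>\<^bsub>A\<^esub> \<in> carrier D" using f by (simp add: clinear_mapD)
    ultimately show ?case by simp
  next
    case (insert s S)
    have "finsum A x (insert s S) = x s \<oplus>\<^bsub>A\<^esub> finsum A x S"
      using insert by (intro A.finsum_insert) auto
    moreover have "(\<Oplus>\<^bsub>D\<^esub>s\<in>insert s S. f (x s)) = f (x s) \<oplus>\<^bsub>D\<^esub> (\<Oplus>\<^bsub>D\<^esub>s\<in>S. f (x s))"
      using insert f by (intro D.finsum_insert) (auto simp: clinear_mapD)
    moreover have "finsum A x S \<in> carrier A" using insert by (intro A.finsum_closed) auto
    ultimately show ?case using insert clinear_mapD(2)[OF f] by simp
  }
qed

lemma clinear_map_lincomb:
  assumes A: "star_normed_algebra A" and D: "star_normed_algebra D" and f: "clinear_map A D f"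
    and B: "finite B" "B \<subseteq> carrier A"
  shows "f (star_normed_algebra.lincomb A c B) = (\<Oplus>\<^bsub>D\<^esub>b\<in>B. c b \<odot>\<^bsub>D\<^esub> f b)"
proof -
  interpret A: star_normed_algebra A by fact
  interpret D: star_normed_algebra D by fact
  have "f (A.lincomb c B) = (\<Oplus>\<^bsub>D\<^esub>b\<in>B. f (c b \<odot>\<^bsub>A\<^esub> b))"
    unfolding A.lincomb_def using B by (intro clinear_map_finsum[OF A D f]) auto
  also have "\<dots> = (\<Oplus>\<^bsub>D\<^esub>b\<in>B. c b \<odot>\<^bsub>D\<^esub> f b)"
    using B f by (intro D.finsum_cong') (auto simp: clinear_mapD)
  finally show ?thesis .
qed

section \<open>Idempotents supporting self-adjoint elements\<close>

context unital_cstar_algebra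
begin

text \<open>By the C*-identity the squared norm of \<open>h \<otimes> y\<close> is the norm of
  \<open>adj A y \<otimes> (h \<otimes> (h \<otimes> y))\<close>. In this form the C*-identity
  excludes nilpotent behaviour of self-adjoint elements.\<close>

lemma zero_of_mult_sa_twice:
  assumes "h \<in> carrier A" "adj A h = h" "y \<in> carrier A" "h \<otimes> (h \<otimes> y) = \<zero>"
  shows "h \<otimes> y = \<zero>"
proof -
  have "(nrm A (h \<otimes> y))\<^sup>2 = nrm A (adj A y \<otimes> (h \<otimes> (h \<otimes> y)))"
    using assms(1-3) cstar_identity[of "h \<otimes> y"] by (simp add: adj_mult m_assoc)
  then show ?thesis using assms nrm_eq_0_iff by simp
qed

text \<open>\<open>zero_of_mult_sa_twice\<close> lowers an exponent of at least 2 by one; for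
  exponent 0 already \<open>y\<close> is zero.\<close>

lemma power_zero_imp_mult_zero:
  assumes "h \<in> carrier A" "adj A h = h" "y \<in> carrier A" "h [^] (k::nat) \<otimes> y = \<zero>"
  shows "h \<otimes> y = \<zero>"
  using assms(4)
proof (induction k)
  case 0
  then show ?case using assms by simp
next
  case (Suc k)
  show ?case
  proof (cases k)
    case 0
    then show ?thesis using Suc.prems assms by simp
  next
    case (Suc j)
    have pow: "h [^] Suc i \<otimes> y = h \<otimes> (h [^] i \<otimes> y)" for i :: nat
      unfolding nat_pow_Suc2[OF assms(1)] using assms(1,3) by (simp add: m_assoc)
    have "h \<otimes> (h \<otimes> (h [^] j \<otimes> y)) = \<zero>"
      using Suc.prems unfolding Suc pow .
    then have "h [^] k \<otimes> y = \<zero>"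
      using zero_of_mult_sa_twice[of h "h [^] j \<otimes> y"] assms(1-3) unfolding Suc pow by simp
    then show ?thesis by (rule Suc.IH)
  qed
qed

text \<open>A dependency among the powers of \<open>h\<close> is divided by its lowest term.\<close>

lemma power_factor_of_dependency:
  assumes "h \<in> carrier A" "\<exists>i\<le>n. c i \<noteq> 0" "h [^] (m::nat) \<otimes> (\<Oplus>i\<in>{..n::nat}. c i \<odot> (h [^] i)) = \<zero>"
  shows "\<exists>k. \<exists>q\<in>carrier A. h [^] (k::nat) = h [^] (Suc k) \<otimes> q"
  using assms(2,3)
proof (induction n arbitrary: c m)
  case 0
  then have "h [^] m \<otimes> (c 0 \<odot> \<one>) = \<zero>" using assms(1) by simp
  then have "c 0 \<odot> (h [^] m) = c 0 \<odot> \<zero>" using assms(1) by (simp add: smult_mult_right)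
  then have "h [^] m = \<zero>" using 0 assms(1) smult_cancel[of "c 0" "h [^] m" \<zero>] by auto
  then show ?case using assms(1) by (intro exI[of _ m] bexI[of _ \<zero>]) auto
next
  case (Suc n)
  define P where "P = (\<Oplus>i\<in>{..n}. c (Suc i) \<odot> (h [^] i))"
  have P: "P \<in> carrier A" using assms(1) by (auto simp: P_def intro: finsum_closed)
  have "(\<Oplus>i\<in>{..Suc n}. c i \<odot> (h [^] i)) = (\<Oplus>i\<in>{..n}. c (Suc i) \<odot> (h [^] Suc i)) \<oplus> c 0 \<odot> \<one>"
    using assms(1) by (subst finsum_Suc2) auto
  also have "(\<Oplus>i\<in>{..n}. c (Suc i) \<odot> (h [^] Suc i)) = h \<otimes> P"
    unfolding P_def using assms(1)
    unfolding nat_pow_Suc2[OF assms(1)]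
    by (subst finsum_rdistr) (auto simp: smult_mult_right intro!: finsum_cong')
  finally have eq: "h [^] m \<otimes> (h \<otimes> P \<oplus> c 0 \<odot> \<one>) = \<zero>" using Suc.prems by simp
  then have eq': "h [^] Suc m \<otimes> P \<oplus> c 0 \<odot> (h [^] m) = \<zero>"
    using assms(1) P by (simp add: r_distr smult_mult_right m_assoc)
  \<comment> \<open>If the constant term vanishes, one factor \<open>h\<close> moves from the
    polynomial into the power in front; otherwise h^m can be isolated, and \<open>q\<close> is
    \<open>P\<close> divided by the negative of the constant term.\<close>
  show ?case
  proof (cases "c 0 = 0")
    case True
    then have "h [^] Suc m \<otimes> P = \<zero>" using eq' assms(1) P by simp
    moreover have "\<exists>i\<le>n. c (Suc i) \<noteq> 0"
    proof -
      obtain i where i: "i \<le> Suc n" "c i \<noteq> 0" using Suc.prems by blast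
      then show ?thesis using True by (cases i) auto
    qed
    ultimately show ?thesis using Suc.IH[of "\<lambda>i. c (Suc i)" "Suc m"] by (simp add: P_def)
  next
    case False
    define q where "q = (- inverse (c 0)) \<odot> P"
    have q: "q \<in> carrier A" using P by (simp add: q_def)
    have "c 0 \<odot> (h [^] m) = \<ominus> (h [^] Suc m \<otimes> P)"
      using eq' assms(1) P by (intro minus_equality[symmetric]) (auto simp: a_comm)
    then have "inverse (c 0) \<odot> (c 0 \<odot> (h [^] m)) = inverse (c 0) \<odot> ((-1) \<odot> (h [^] Suc m \<otimes> P))"
      using assms(1) P by (simp add: smult_neg1)
    then have "h [^] m = h [^] Suc m \<otimes> q"
      using False assms(1) P by (simp add: smult_smult q_def smult_mult_right)
    then show ?thesis using q by blast
  qed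
qed

lemma dependent_powers:
  assumes B: "spans B" and h: "h \<in> carrier A"
  obtains n c where "\<exists>i\<le>n. c i \<noteq> (0::complex)" "(\<Oplus>i\<in>{..n}. c i \<odot> (h [^] (i::nat))) = \<zero>"
proof -
  obtain B' where B': "spans B'" "lin_independent B'" using spanning_set_contains_basis[OF B] by blast
  have fin: "finite B'" "B' \<subseteq> carrier A" using B' by (auto simp: spans_def)
  \<comment> \<open>The exponents in \<open>{..n}\<close> give n + 1 powers against n
    coordinates.\<close>
  define n where "n = card B'"
  obtain x where x: "\<exists>i\<in>{..n}. x i \<noteq> 0"
    "\<forall>b\<in>B'. (\<Sum>i\<in>{..n}. x i * coord B' (h [^] i) b) = 0"
    using underdetermined_system[of B' "{..n}" "\<lambda>i. coord B' (h [^] i)"] fin by (auto simp: n_def)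
  define z where "z = (\<Oplus>i\<in>{..n}. x i \<odot> (h [^] i))"
  have z: "z \<in> carrier A" using h by (auto simp: z_def intro: finsum_closed)
  have "coord B' (\<Oplus>i\<in>{..m}. x i \<odot> (h [^] i)) b = (\<Sum>i\<in>{..m}. x i * coord B' (h [^] i) b)"
    if b: "b \<in> B'" for b m
  proof (induction m)
    case 0
    show ?case using coord_functional[OF B' b] h by (simp add: clinear_functional_def)
  next
    case (Suc m)
    have "(\<Oplus>i\<in>{..m}. x i \<odot> (h [^] i)) \<in> carrier A" using h by (auto intro: finsum_closed)
    then have "coord B' (\<Oplus>i\<in>{..Suc m}. x i \<odot> (h [^] i)) b
        = coord B' (x (Suc m) \<odot> (h [^] Suc m)) b + coord B' (\<Oplus>i\<in>{..m}. x i \<odot> (h [^] i)) b"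
      using coord_functional[OF B' b] h by (simp add: finsum_Suc clinear_functional_def)
    moreover have "coord B' (x (Suc m) \<odot> (h [^] Suc m)) b = x (Suc m) * coord B' (h [^] Suc m) b"
      using coord_functional[OF B' b] nat_pow_closed[OF h, of "Suc m"] unfolding clinear_functional_def by blast
    ultimately show ?case using Suc by simp
  qed
  then have "coord B' z b = 0" if "b \<in> B'" for b using x that by (simp add: z_def)
  then have "z = \<zero>"
    using lincomb_coord[OF B'(1) z] lincomb_zero_coeffs[OF fin, of "coord B' z"] by simp
  then show ?thesis using that[of n x] x by (auto simp: z_def)
qed

text \<open>A factorization h^k = h^(k+1) q means that h^k annihilates 1 - h q, hence so does h
  itself. Then e = h q is a right unit for h. It carries h inside a multiple of h by one element,
  which is what the trace argument needs.\<close>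

lemma support_projection:
  assumes B: "spans B" and h: "h \<in> carrier A" "adj A h = h"
  obtains e q where "e \<in> carrier A" "q \<in> carrier A" "e = h \<otimes> q" "h \<otimes> e = h" "e \<otimes> e = e"
proof -
  obtain n c where c: "\<exists>i\<le>n. c i \<noteq> (0::complex)" "(\<Oplus>i\<in>{..n}. c i \<odot> (h [^] (i::nat))) = \<zero>"
    using dependent_powers[OF B h(1)] by blast
  obtain k q where q: "q \<in> carrier A" "h [^] (k::nat) = h [^] (Suc k) \<otimes> q"
    using power_factor_of_dependency[OF h(1) c(1), of 0] c(2) by auto
  have "h [^] k \<otimes> (\<one> \<ominus> h \<otimes> q) = \<zero>"
  proof -
    have "h [^] k \<otimes> (\<one> \<ominus> h \<otimes> q) = h [^] k \<ominus> h [^] Suc k \<otimes> q"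
      using h q(1) by (simp add: a_minus_def r_distr r_minus m_assoc)
    then show ?thesis using q h by (metis minus_self nat_pow_closed)
  qed
  then have "h \<otimes> (\<one> \<ominus> h \<otimes> q) = \<zero>"
    using power_zero_imp_mult_zero[of h "\<one> \<ominus> h \<otimes> q" k] h q(1) by simp
  then have "h \<ominus> h \<otimes> (h \<otimes> q) = \<zero>"
    using h q(1) by (simp add: a_minus_def r_distr r_minus)
  then have he: "h \<otimes> (h \<otimes> q) = h" using h q(1) minus_eq_zero_iff[of h "h \<otimes> (h \<otimes> q)"] by simp
  define e where "e = h \<otimes> q"
  have e: "e \<in> carrier A" "h \<otimes> e = h" using h q he by (auto simp: e_def)
  \<comment> \<open>Since \<open>h \<otimes> e = h\<close>, the product
    \<open>adj A e \<otimes> e\<close> equals \<open>adj A e\<close>. The product is self-adjoint,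
    so \<open>e\<close> is self-adjoint as well, and the equation becomes idempotency.\<close>
  have "adj A e \<otimes> e = adj A q \<otimes> (h \<otimes> e)" using h q by (simp add: e_def adj_mult m_assoc)
  then have ee: "adj A e \<otimes> e = adj A e" using e h q by (simp add: e_def adj_mult)
  have "adj A (adj A e \<otimes> e) = adj A e \<otimes> e" using e(1) by (simp only: adj_mult adj_closed adj_adj)
  then have "e = adj A e" using e(1) unfolding ee by (simp only: adj_adj)
  then have "e \<otimes> e = e" using ee by metis
  then show ?thesis using that e q e_def by blast
qed

end

section \<open>The trace form of the left regular representation\<close>

locale fd_cstar_algebra = unital_cstar_algebra A
  for A :: "('a, 'm) cstar_algebra_scheme" (structure) and B +
  assumes spans_B: "spans B" and lin_independent_B: "lin_independent B"
begin

lemma finite_B: "finite B" and B_subset: "B \<subseteq> carrier A"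
  using spans_B by (auto simp: spans_def)

lemma B_carrier [simp]: "b \<in> B \<Longrightarrow> b \<in> carrier A"
  using B_subset by blast

lemma left_mult_linear: "a \<in> carrier A \<Longrightarrow> clinear_map A A (\<lambda>x. a \<otimes> x)"
  by (simp add: clinear_map_def r_distr smult_mult_right)

definition \<tau> :: "'a \<Rightarrow> complex" where
  "\<tau> a = trace B (\<lambda>x. a \<otimes> x)"

lemma \<tau>_functional: "clinear_functional A \<tau>"
proof -
  note f = coord_functional[OF spans_B lin_independent_B, unfolded clinear_functional_def]
  show ?thesis using f
    by (simp add: clinear_functional_def \<tau>_def trace_def l_distr smult_mult_left sum.distrib sum_distrib_left)
qed

lemma \<tau>_add: "\<lbrakk>x \<in> carrier A; y \<in> carrier A\<rbrakk> \<Longrightarrow> \<tau> (x \<oplus> y) = \<tau> x + \<tau> y"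
  and \<tau>_smult: "x \<in> carrier A \<Longrightarrow> \<tau> (c \<odot> x) = c * \<tau> x"
  using \<tau>_functional by (auto simp: clinear_functional_def)

lemma \<tau>_zero [simp]: "\<tau> \<zero> = 0"
  using \<tau>_smult[of \<zero> 0] by simp

lemma \<tau>_diff: "\<lbrakk>x \<in> carrier A; y \<in> carrier A\<rbrakk> \<Longrightarrow> \<tau> (x \<ominus> y) = \<tau> x - \<tau> y"
  by (simp add: a_minus_def \<tau>_add \<tau>_smult flip: smult_neg1)

text \<open>Expanding \<open>v \<otimes> b\<close> in the basis is matrix multiplication, and the
  resulting double sum is symmetric in the two factors.\<close>

lemma \<tau>_commute:
  assumes "x \<in> carrier A" "y \<in> carrier A"
  shows "\<tau> (x \<otimes> y) = \<tau> (y \<otimes> x)"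
proof -
  have *: "\<tau> (u \<otimes> v) = (\<Sum>b\<in>B. \<Sum>d\<in>B. coord B (v \<otimes> b) d * coord B (u \<otimes> d) b)"
    if uv: "u \<in> carrier A" "v \<in> carrier A" for u v
    unfolding \<tau>_def trace_def
  proof (rule sum.cong[OF refl])
    fix b assume b: "b \<in> B"
    have "coord B (u \<otimes> lincomb (coord B (v \<otimes> b)) B) b = (\<Sum>d\<in>B. coord B (v \<otimes> b) d * coord B (u \<otimes> d) b)"
      using functional_lincomb[OF functional_linear_comp[OF coord_functional[OF spans_B lin_independent_B b]
          left_mult_linear[OF uv(1)]]] finite_B B_subset by simp
    then show "coord B (u \<otimes> v \<otimes> b) b = (\<Sum>d\<in>B. coord B (v \<otimes> b) d * coord B (u \<otimes> d) b)"
      using uv b lincomb_coord[OF spans_B] by (simp add: m_assoc)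
  qed
  show ?thesis unfolding *[OF assms] *[OF assms(2,1)]
    by (subst sum.swap) (simp add: mult.commute)
qed

lemma \<tau>_automorphism:
  assumes \<alpha>: "star_automorphism A \<alpha>" and a: "a \<in> carrier A"
  shows "\<tau> (\<alpha> a) = \<tau> a"
proof -
  have hom: "unital_star_hom A A \<alpha>" and bij: "bij_betw \<alpha> (carrier A) (carrier A)"
    using \<alpha> by (auto simp: star_automorphism_def)
  note h = unital_star_homD[OF hom]
  have inj: "inj_on \<alpha> B" using bij B_subset by (meson bij_betw_def inj_on_subset)
  have sub: "\<alpha> ` B \<subseteq> carrier A" "finite (\<alpha> ` B)" using h finite_B by auto
  have lc: "\<alpha> (lincomb c B) = lincomb (\<lambda>d. c (inv_into B \<alpha> d)) (\<alpha> ` B)" for c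
  proof -
    have "lincomb (\<lambda>d. c (inv_into B \<alpha> d)) (\<alpha> ` B) = (\<Oplus>b\<in>B. c (inv_into B \<alpha> (\<alpha> b)) \<odot> \<alpha> b)"
      unfolding lincomb_def using inj sub by (intro add.finprod_reindex) auto
    also have "\<dots> = (\<Oplus>b\<in>B. c b \<odot> \<alpha> b)"
      using inj h by (intro finsum_cong') auto
    also have "\<dots> = \<alpha> (lincomb c B)"
      using clinear_map_lincomb[OF star_normed_algebra_axioms star_normed_algebra_axioms
          unital_star_hom_linear[OF hom] finite_B B_subset] by simp
    finally show ?thesis ..
  qed
  have spans: "spans (\<alpha> ` B)"
    unfolding spans_def
  proof (intro conjI ballI)
    fix x assume "x \<in> carrier A"
    then obtain y where y: "y \<in> carrier A" "x = \<alpha> y" using bij by (metis bij_betw_def imageE)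
    then show "\<exists>c. x = lincomb c (\<alpha> ` B)" using lc[of "coord B y"] lincomb_coord[OF spans_B] by metis
  qed (use sub in auto)
  have ind: "lin_independent (\<alpha> ` B)"
    unfolding lin_independent_def
  proof (intro conjI allI impI)
    fix c assume c: "lincomb c (\<alpha> ` B) = \<zero>"
    have "lincomb c (\<alpha> ` B) = \<alpha> (lincomb (\<lambda>b. c (\<alpha> b)) B)"
      unfolding lc using inj sub by (intro lincomb_cong) (auto simp: f_inv_into_f)
    moreover have "\<alpha> \<zero> = \<zero>" using h(5)[of \<zero> 0] h(1)[of \<zero>] by simp
    ultimately have "lincomb (\<lambda>b. c (\<alpha> b)) B = \<zero>"
      using c bij B_subset by (metis bij_betw_def inj_on_eq_iff lincomb_closed zero_closed)
    then show "\<forall>b\<in>\<alpha> ` B. c b = 0" using lin_independent_B by (auto simp: lin_independent_def)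
  qed (use sub in auto)
  have co: "coord (\<alpha> ` B) (\<alpha> x) (\<alpha> b) = coord B x b" if "x \<in> carrier A" "b \<in> B" for x b
    using coord_unique[OF spans ind, of "\<alpha> b" "\<lambda>d. coord B x (inv_into B \<alpha> d)"] that
      lc[of "coord B x"] lincomb_coord[OF spans_B] inj by simp
  have "\<tau> (\<alpha> a) = trace (\<alpha> ` B) (\<lambda>x. \<alpha> a \<otimes> x)"
    unfolding \<tau>_def using a h spans ind
    by (intro trace_basis_independent spans_B lin_independent_B left_mult_linear) auto
  also have "\<dots> = (\<Sum>b\<in>B. coord (\<alpha> ` B) (\<alpha> a \<otimes> \<alpha> b) (\<alpha> b))"
    unfolding trace_def using inj by (simp add: sum.reindex)
  also have "\<dots> = \<tau> a"
    unfolding \<tau>_def trace_def using a by (intro sum.cong refl) (simp flip: h(2) add: co)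
  finally show ?thesis .
qed

text \<open>
  In a basis adapted to the decomposition of \<open>A\<close> into \<open>e A\<close> and \<open>(1 - e) A\<close>, the trace of an
  idempotent \<open>e\<close> counts the basis vectors in \<open>e A\<close>.
\<close>

lemma \<tau>_idempotent_nonzero:
  assumes e: "e \<in> carrier A" "e \<otimes> e = e" "\<tau> e = 0"
  shows "e = \<zero>"
proof -
  \<comment> \<open>Spanning vectors on which left multiplication by \<open>e\<close> acts as 1 or
    as 0; a basis selected from them diagonalizes it.\<close>
  define S where "S = (\<lambda>b. e \<otimes> b) ` B \<union> (\<lambda>b. b \<ominus> e \<otimes> b) ` B"
  have S: "finite S" "S \<subseteq> carrier A" using finite_B e by (auto simp: S_def)
  define span where "span = {x. \<exists>c. x = lincomb c S}"
  have span_add: "x \<oplus> y \<in> span" if "x \<in> span" "y \<in> span" for x y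
    using that lincomb_add[OF S] by (auto simp: span_def)
  have span_smult: "c \<odot> x \<in> span" if "x \<in> span" for x c
    using that lincomb_smult[OF S] by (auto simp: span_def)
  have span_S: "x \<in> span" if "x \<in> S" for x
    using that lincomb_delta[OF S] by (auto simp: span_def) metis
  have span_B: "b \<in> span" if b: "b \<in> B" for b
  proof -
    have "b = e \<otimes> b \<oplus> (b \<ominus> e \<otimes> b)" using B_carrier[OF b] e(1) by algebra
    moreover have "e \<otimes> b \<in> span" "b \<ominus> e \<otimes> b \<in> span" using b by (auto intro!: span_S simp: S_def)
    ultimately show ?thesis using span_add by metis
  qed
  have "\<zero> = lincomb (\<lambda>_. 0) S" using lincomb_zero_coeffs[OF S, of "\<lambda>_. 0"] by simp
  then have zero_span: "\<zero> \<in> span" unfolding span_def by blast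
  have "lincomb c B' \<in> span" if "finite B'" "B' \<subseteq> B" for c B'
    using that
  proof (induction B' rule: finite_induct)
    case (insert b B')
    then have "lincomb c (insert b B') = c b \<odot> b \<oplus> lincomb c B'"
      using B_subset by (intro lincomb_insert) auto
    then show ?case using insert span_add span_smult span_B by auto
  qed (simp add: zero_span)
  then have inspan: "lincomb c B \<in> span" for c using finite_B by blast
  have "\<exists>c. x = lincomb c S" if x: "x \<in> carrier A" for x
    using inspan[of "coord B x"] unfolding span_def lincomb_coord[OF spans_B x] by blast
  then have "spans S" using S by (simp add: spans_def)
  then obtain B' where B': "B' \<subseteq> S" "spans B'" "lin_independent B'"
    using spanning_set_contains_basis by blast
  have cases: "e \<otimes> b = b \<or> e \<otimes> b = \<zero>" if b: "b \<in> B'" for b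
  proof -
    have "b \<in> S" using b B' by blast
    then consider s where "s \<in> B" "b = e \<otimes> s" | s where "s \<in> B" "b = s \<ominus> e \<otimes> s" by (auto simp: S_def)
    then show ?thesis
    proof cases
      case 1
      then show ?thesis using e by (simp flip: m_assoc)
    next
      case 2
      then have "e \<otimes> b = e \<otimes> s \<ominus> (e \<otimes> e) \<otimes> s"
        using e(1) by (simp add: a_minus_def r_distr r_minus m_assoc)
      then show ?thesis using e 2 by simp
    qed
  qed
  have zc: "coord B' \<zero> b = 0" if "b \<in> B'" for b
    using coord_unique[OF B'(2,3) that, of "\<lambda>_. 0"] lincomb_zero_coeffs[of B' "\<lambda>_. 0"] B'(2)
    by (simp add: spans_def)
  have "\<tau> e = trace B' (\<lambda>x. e \<otimes> x)"
    unfolding \<tau>_def using B' e by (intro trace_basis_independent spans_B lin_independent_B left_mult_linear) auto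
  also have "\<dots> = (\<Sum>b\<in>B'. if e \<otimes> b = b then 1 else 0)"
    unfolding trace_def
  proof (rule sum.cong[OF refl])
    fix b assume b: "b \<in> B'"
    show "coord B' (e \<otimes> b) b = (if e \<otimes> b = b then 1 else 0)"
      using cases[OF b] coord_basis[OF B'(2,3) b b] zc[OF b] by auto
  qed
  also have "\<dots> = of_nat (card {b \<in> B'. e \<otimes> b = b})"
    using B'(2) by (simp add: spans_def sum.If_cases Int_def)
  \<comment> \<open>A number of basis vectors is zero as a complex number only if there are
    none.\<close>
  finally have "card {b \<in> B'. e \<otimes> b = b} = 0" using e(3) by simp
  then have "{b \<in> B'. e \<otimes> b = b} = {}" using B'(2) by (simp add: spans_def)
  then have kill: "e \<otimes> b = \<zero>" if "b \<in> B'" for b using cases that by blast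
  \<comment> \<open>Left multiplication by \<open>e\<close> kills a basis, hence also
    \<open>\<one>\<close>, whose image is \<open>e\<close>.\<close>
  have "e \<otimes> lincomb (coord B' \<one>) B' = (\<Oplus>b\<in>B'. coord B' \<one> b \<odot> (e \<otimes> b))"
    using B'(2) e by (intro clinear_map_lincomb left_mult_linear star_normed_algebra_axioms) (auto simp: spans_def)
  also have "\<dots> = (\<Oplus>b\<in>B'. \<zero>)" using kill by (intro finsum_cong') auto
  also have "\<dots> = \<zero>" by simp
  finally show ?thesis using e lincomb_coord[OF B'(2)] by simp
qed

text \<open>For \<open>h = adj A a \<otimes> a\<close> the support idempotent is
  \<open>e = h \<otimes> q\<close>. By cyclicity its trace is the trace of a product ending in
  \<open>a\<close>, hence 0. So \<open>e\<close> vanishes, then \<open>h = h \<otimes> e\<close>,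
  then \<open>a\<close>.\<close>

lemma \<tau>_nondegenerate:
  assumes a: "a \<in> carrier A" and 0: "\<And>b. b \<in> B \<Longrightarrow> \<tau> (b \<otimes> a) = 0"
  shows "a = \<zero>"
proof -
  have all: "\<tau> (x \<otimes> a) = 0" if x: "x \<in> carrier A" for x
  proof -
    have "clinear_functional A (\<lambda>x. \<tau> (x \<otimes> a))"
      using a by (simp add: clinear_functional_def l_distr smult_mult_left \<tau>_add \<tau>_smult)
    then have "\<tau> (lincomb (coord B x) B \<otimes> a) = (\<Sum>b\<in>B. coord B x b * \<tau> (b \<otimes> a))"
      using functional_lincomb finite_B B_subset by blast
    then show ?thesis using lincomb_coord[OF spans_B x] 0 by simp
  qed
  define h where "h = adj A a \<otimes> a"
  have h: "h \<in> carrier A" "adj A h = h" using a by (auto simp: h_def adj_mult)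
  obtain e q where e: "e \<in> carrier A" "q \<in> carrier A" "e = h \<otimes> q" "h \<otimes> e = h" "e \<otimes> e = e"
    using support_projection[OF spans_B h] by blast
  have "\<tau> e = \<tau> (adj A a \<otimes> (a \<otimes> q))" using e a by (simp add: h_def m_assoc)
  also have "\<dots> = \<tau> ((a \<otimes> q) \<otimes> adj A a)" using e a by (intro \<tau>_commute) auto
  also have "\<dots> = \<tau> (a \<otimes> (q \<otimes> adj A a))" using e a by (simp add: m_assoc)
  also have "\<dots> = \<tau> ((q \<otimes> adj A a) \<otimes> a)" using e a by (intro \<tau>_commute) auto
  also have "\<dots> = 0" using e a by (intro all) auto
  finally have "e = \<zero>" using \<tau>_idempotent_nonzero e by blast
  then have "h = \<zero>" using e h by simp
  then have "(nrm A a)\<^sup>2 = 0" using cstar_identity[OF a] by (simp add: h_def)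
  then show ?thesis using nrm_eq_0_iff a by simp
qed

end

section \<open>The diagonal of a finite-dimensional C*-algebra\<close>

context fd_cstar_algebra
begin

text \<open>The inhomogeneous system for a dual vector is solved through a homogeneous one with an
  additional unknown for the right-hand side; nondegeneracy of the trace form excludes the value 0
  for that unknown.\<close>

lemma dual_basis_exists:
  "\<exists>d. \<forall>b\<in>B. d b \<in> carrier A \<and> (\<forall>b'\<in>B. \<tau> (b' \<otimes> d b) = (if b' = b then 1 else 0))"
proof -
  have "\<exists>d. d \<in> carrier A \<and> (\<forall>b'\<in>B. \<tau> (b' \<otimes> d) = (if b' = b then 1 else 0))" if b: "b \<in> B" for b
  proof -
    \<comment> \<open>The unknown \<open>None\<close> multiplies the negative right-hand side, the
      unknowns \<open>Some e\<close> are the coefficients of the dual vector: one unknown more than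
      there are equations.\<close>
    define a where "a i b' = (case i of None \<Rightarrow> - (if b' = b then 1 else 0) | Some e \<Rightarrow> \<tau> (b' \<otimes> e))" for i b'
    obtain x where x: "\<exists>i\<in>insert None (Some ` B). x i \<noteq> 0"
      "\<forall>b'\<in>B. (\<Sum>i\<in>insert None (Some ` B). x i * a i b') = 0"
      using underdetermined_system[of B "insert None (Some ` B)" a] finite_B
      by (auto simp: card_insert_if card_image)
    define s where "s = x None"
    define d where "d = lincomb (\<lambda>e. x (Some e)) B"
    have d: "d \<in> carrier A" using B_subset by (simp add: d_def)
    have \<tau>d: "\<tau> (b' \<otimes> d) = s * (if b' = b then 1 else 0)" if b': "b' \<in> B" for b'
    proof -
      have "clinear_functional A (\<lambda>y. \<tau> (b' \<otimes> y))"
        using functional_linear_comp[OF \<tau>_functional left_mult_linear] b' by simp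
      then have "\<tau> (b' \<otimes> d) = (\<Sum>e\<in>B. x (Some e) * \<tau> (b' \<otimes> e))"
        unfolding d_def using functional_lincomb finite_B B_subset by blast
      also have "\<dots> = s * (if b' = b then 1 else 0)"
        using x(2) b' finite_B by (simp add: sum.reindex a_def s_def)
      finally show ?thesis .
    qed
    \<comment> \<open>With \<open>s = 0\<close> the vector \<open>d\<close> would be orthogonal to
      the whole basis, hence zero, and independence would make the solution trivial.\<close>
    have "s \<noteq> 0"
    proof
      assume s: "s = 0"
      then have "d = \<zero>" using \<tau>d d by (intro \<tau>_nondegenerate) auto
      then have "\<forall>e\<in>B. x (Some e) = 0"
        using lin_independent_B unfolding d_def lin_independent_def by blast
      then show False using x(1) s by (auto simp: s_def)
    qed
    then show ?thesis
      using d \<tau>d by (intro exI[of _ "inverse s \<odot> d"]) (auto simp: smult_mult_right \<tau>_smult)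
  qed
  then show ?thesis by metis
qed

definition dual :: "'a \<Rightarrow> 'a" where
  "dual = (SOME d. \<forall>b\<in>B. d b \<in> carrier A \<and> (\<forall>b'\<in>B. \<tau> (b' \<otimes> d b) = (if b' = b then 1 else 0)))"

lemma dual_carrier [simp]: "b \<in> B \<Longrightarrow> dual b \<in> carrier A"
  and \<tau>_dual: "\<lbrakk>b \<in> B; b' \<in> B\<rbrakk> \<Longrightarrow> \<tau> (b' \<otimes> dual b) = (if b' = b then 1 else 0)"
  using someI_ex[OF dual_basis_exists] unfolding dual_def[symmetric] by auto

lemma coord_eq_\<tau>:
  assumes "x \<in> carrier A" "b \<in> B"
  shows "coord B x b = \<tau> (dual b \<otimes> x)"
proof -
  have "clinear_functional A (\<lambda>y. \<tau> (dual b \<otimes> y))"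
    using functional_linear_comp[OF \<tau>_functional left_mult_linear] assms by simp
  then have "\<tau> (dual b \<otimes> lincomb (coord B x) B) = (\<Sum>e\<in>B. coord B x e * \<tau> (dual b \<otimes> e))"
    using functional_lincomb finite_B B_subset by blast
  also have "\<dots> = (\<Sum>e\<in>B. if e = b then coord B x e else 0)"
    using assms by (intro sum.cong refl) (simp add: \<tau>_commute[of "dual b"] \<tau>_dual)
  also have "\<dots> = coord B x b" using assms finite_B by simp
  finally show ?thesis using lincomb_coord[OF spans_B] assms by simp
qed

text \<open>The difference of the two sides pairs to zero with every basis vector, so nondegeneracy
  applies.\<close>

lemma dual_expansion:
  assumes x: "x \<in> carrier A"
  shows "(\<Oplus>b\<in>B. \<tau> (x \<otimes> b) \<odot> dual b) = x"
proof -
  let ?y = "\<Oplus>b\<in>B. \<tau> (x \<otimes> b) \<odot> dual b"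
  have y: "?y \<in> carrier A" by (auto intro: finsum_closed)
  have "\<tau> (c \<otimes> (x \<ominus> ?y)) = 0" if c: "c \<in> B" for c
  proof -
    have sums: "\<tau> (c \<otimes> (\<Oplus>b\<in>S. \<tau> (x \<otimes> b) \<odot> dual b)) = (\<Sum>b\<in>S. \<tau> (x \<otimes> b) * \<tau> (c \<otimes> dual b))"
      if "finite S" "S \<subseteq> B" for S
      using that
    proof (induction S rule: finite_induct)
      case (insert b S)
      have "(\<Oplus>b\<in>insert b S. \<tau> (x \<otimes> b) \<odot> dual b) = \<tau> (x \<otimes> b) \<odot> dual b \<oplus> (\<Oplus>b\<in>S. \<tau> (x \<otimes> b) \<odot> dual b)"
        using insert by (intro finsum_insert) auto
      moreover have "(\<Oplus>b\<in>S. \<tau> (x \<otimes> b) \<odot> dual b) \<in> carrier A"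
        using insert by (intro finsum_closed) auto
      ultimately show ?case using insert c by (simp add: r_distr smult_mult_right \<tau>_add \<tau>_smult)
    qed (use c in simp)
    have "\<tau> (c \<otimes> ?y) = (\<Sum>b\<in>B. if b = c then \<tau> (x \<otimes> b) else 0)"
      unfolding sums[OF finite_B order_refl] using c by (intro sum.cong refl) (simp add: \<tau>_dual)
    also have "\<dots> = \<tau> (c \<otimes> x)" using c x finite_B by (simp add: \<tau>_commute)
    finally show ?thesis using c x y by (simp add: a_minus_def r_distr r_minus \<tau>_diff[unfolded a_minus_def])
  qed
  then have "x \<ominus> ?y = \<zero>" using x y by (intro \<tau>_nondegenerate) auto
  then show ?thesis using x y by (simp add: minus_eq_zero_iff)
qed

text \<open>Pairing the sum with \<open>a\<close> gives the sum of the diagonal coefficients of left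
  multiplication by \<open>a\<close>, which is \<tau> of \<open>a\<close> by definition. Here it
  matters that \<tau> is the trace of the regular representation and not some other nondegenerate
  trace.\<close>

lemma diagonal_sum: "(\<Oplus>b\<in>B. b \<otimes> dual b) = \<one>"
proof -
  let ?z = "\<Oplus>b\<in>B. b \<otimes> dual b"
  have z: "?z \<in> carrier A" by (auto intro: finsum_closed)
  have "\<tau> (a \<otimes> (?z \<ominus> \<one>)) = 0" if a: "a \<in> carrier A" for a
  proof -
    have sums: "\<tau> (a \<otimes> (\<Oplus>b\<in>S. b \<otimes> dual b)) = (\<Sum>b\<in>S. \<tau> (a \<otimes> (b \<otimes> dual b)))"
      if "finite S" "S \<subseteq> B" for S
      using that
    proof (induction S rule: finite_induct)
      case (insert b S)
      have "(\<Oplus>b\<in>insert b S. b \<otimes> dual b) = b \<otimes> dual b \<oplus> (\<Oplus>b\<in>S. b \<otimes> dual b)"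
        using insert by (intro finsum_insert) auto
      moreover have "(\<Oplus>b\<in>S. b \<otimes> dual b) \<in> carrier A"
        using insert by (intro finsum_closed) auto
      ultimately show ?case using insert a by (simp add: r_distr \<tau>_add)
    qed (use a in simp)
    have "\<tau> (a \<otimes> ?z) = (\<Sum>b\<in>B. coord B (a \<otimes> b) b)"
      unfolding sums[OF finite_B order_refl]
    proof (rule sum.cong[OF refl])
      fix b assume b: "b \<in> B"
      have "\<tau> (a \<otimes> (b \<otimes> dual b)) = \<tau> ((a \<otimes> b) \<otimes> dual b)" using a b by (simp add: m_assoc)
      also have "\<dots> = coord B (a \<otimes> b) b"
        using a b by (simp add: coord_eq_\<tau> \<tau>_commute[of "a \<otimes> b"])
      finally show "\<tau> (a \<otimes> (b \<otimes> dual b)) = coord B (a \<otimes> b) b" .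
    qed
    also have "\<dots> = \<tau> a" by (simp add: \<tau>_def trace_def)
    finally show ?thesis using a z by (simp add: a_minus_def r_distr r_minus \<tau>_diff[unfolded a_minus_def])
  qed
  then have "?z \<ominus> \<one> = \<zero>" using z by (intro \<tau>_nondegenerate) auto
  then show ?thesis using z by (simp add: minus_eq_zero_iff)
qed

end

section \<open>Contracting bilinear maps with the diagonal\<close>

locale fd_to_normed = fd_cstar_algebra A B + D: star_normed_algebra D
  for A :: "('a, 'm) cstar_algebra_scheme" (structure) and B
    and D :: "('d, 'n) cstar_algebra_scheme"
begin

definition bilinear :: "('a \<Rightarrow> 'a \<Rightarrow> 'd) \<Rightarrow> bool" where
  "bilinear f \<longleftrightarrow> (\<forall>x\<in>carrier A. clinear_map A D (f x)) \<and> (\<forall>y\<in>carrier A. clinear_map A D (\<lambda>x. f x y))"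

lemma bilinear_closed: "\<lbrakk>bilinear f; x \<in> carrier A; y \<in> carrier A\<rbrakk> \<Longrightarrow> f x y \<in> carrier D"
  by (auto simp: bilinear_def clinear_map_def)

text \<open>The value of a bilinear map at the tensor \<open>\<Sum>\<^sub>b b \<otimes> dual b\<close>.\<close>

definition ev :: "('a \<Rightarrow> 'a \<Rightarrow> 'd) \<Rightarrow> 'd" where
  "ev f = (\<Oplus>\<^bsub>D\<^esub>b\<in>B. f b (dual b))"

text \<open>An upper bound for the projective tensor norm of the diagonal. It does not involve
  \<open>D\<close>, so a single number serves \<open>C\<close> and all its quotients.\<close>

definition diag_bound :: real where
  "diag_bound = (\<Sum>b\<in>B. nrm A b * nrm A (dual b))"

lemma diag_bound_nonneg: "0 \<le> diag_bound"
  by (auto simp: diag_bound_def nrm_nonneg intro!: sum_nonneg)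

lemma ev_closed [simp]:
  "(\<And>u v. \<lbrakk>u \<in> carrier A; v \<in> carrier A\<rbrakk> \<Longrightarrow> f u v \<in> carrier D) \<Longrightarrow> ev f \<in> carrier D"
  unfolding ev_def by (intro D.finsum_closed) auto

lemma ev_cong:
  "\<lbrakk>\<And>u v. \<lbrakk>u \<in> carrier A; v \<in> carrier A\<rbrakk> \<Longrightarrow> f u v = g u v;
    \<And>u v. \<lbrakk>u \<in> carrier A; v \<in> carrier A\<rbrakk> \<Longrightarrow> g u v \<in> carrier D\<rbrakk> \<Longrightarrow> ev f = ev g"
  unfolding ev_def by (intro D.finsum_cong') auto

lemma ev_add:
  "\<lbrakk>\<And>u v. \<lbrakk>u \<in> carrier A; v \<in> carrier A\<rbrakk> \<Longrightarrow> f u v \<in> carrier D;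
    \<And>u v. \<lbrakk>u \<in> carrier A; v \<in> carrier A\<rbrakk> \<Longrightarrow> g u v \<in> carrier D\<rbrakk>
   \<Longrightarrow> ev (\<lambda>u v. f u v \<oplus>\<^bsub>D\<^esub> g u v) = ev f \<oplus>\<^bsub>D\<^esub> ev g"
  unfolding ev_def by (intro D.finsum_addf) auto

lemma ev_linear:
  assumes "star_normed_algebra E" "clinear_map D E L"
    "\<And>u v. \<lbrakk>u \<in> carrier A; v \<in> carrier A\<rbrakk> \<Longrightarrow> f u v \<in> carrier D"
  shows "L (ev f) = (\<Oplus>\<^bsub>E\<^esub>b\<in>B. L (f b (dual b)))"
  unfolding ev_def using finite_B assms
  by (intro clinear_map_finsum[OF D.star_normed_algebra_axioms]) auto

lemma ev_linear_self:
  assumes "clinear_map D D L" "\<And>u v. \<lbrakk>u \<in> carrier A; v \<in> carrier A\<rbrakk> \<Longrightarrow> f u v \<in> carrier D"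
  shows "L (ev f) = ev (\<lambda>u v. L (f u v))"
  using ev_linear[OF D.star_normed_algebra_axioms assms] by (simp add: ev_def)

lemma ev_nrm_le:
  assumes "\<And>u v. \<lbrakk>u \<in> carrier A; v \<in> carrier A\<rbrakk> \<Longrightarrow> f u v \<in> carrier D"
    "\<And>u v. \<lbrakk>u \<in> carrier A; v \<in> carrier A\<rbrakk> \<Longrightarrow> nrm D (f u v) \<le> c * (nrm A u * nrm A v)"
  shows "nrm D (ev f) \<le> diag_bound * c"
proof -
  have "nrm D (ev f) \<le> (\<Sum>b\<in>B. nrm D (f b (dual b)))"
    unfolding ev_def using assms(1) finite_B by (intro D.nrm_finsum_le) auto
  also have "\<dots> \<le> (\<Sum>b\<in>B. c * (nrm A b * nrm A (dual b)))"
    using assms(2) by (intro sum_mono) auto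
  finally show ?thesis by (simp add: diag_bound_def sum_distrib_left mult.commute)
qed

text \<open>
  Moving a matrix \<open>m\<close> across the tensor: the common core of the two invariance properties of
  the diagonal.
\<close>

lemma ev_transfer:
  assumes f: "bilinear f"
    and V: "\<And>b. b \<in> B \<Longrightarrow> V b \<in> carrier A"
    and P: "\<And>b. b \<in> B \<Longrightarrow> P b = (\<Oplus>d\<in>B. m d b \<odot> d)"
    and R: "\<And>d. d \<in> B \<Longrightarrow> R d = (\<Oplus>b\<in>B. m d b \<odot> V b)"
  shows "(\<Oplus>\<^bsub>D\<^esub>b\<in>B. f (P b) (V b)) = (\<Oplus>\<^bsub>D\<^esub>d\<in>B. f d (R d))"
proof -
  note fc = bilinear_closed[OF f]
  have 1: "f (P b) (V b) = (\<Oplus>\<^bsub>D\<^esub>d\<in>B. m d b \<odot>\<^bsub>D\<^esub> f d (V b))" if b: "b \<in> B" for b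
  proof -
    have lin: "clinear_map A D (\<lambda>x. f x (V b))" using f V[OF b] by (simp add: bilinear_def)
    have "f (P b) (V b) = (\<Oplus>\<^bsub>D\<^esub>d\<in>B. f (m d b \<odot> d) (V b))"
      unfolding P[OF b]
      by (rule clinear_map_finsum[OF star_normed_algebra_axioms D.star_normed_algebra_axioms lin finite_B]) auto
    also have "\<dots> = (\<Oplus>\<^bsub>D\<^esub>d\<in>B. m d b \<odot>\<^bsub>D\<^esub> f d (V b))"
      using V[OF b] fc clinear_mapD(3)[OF lin] by (intro D.finsum_cong') auto
    finally show ?thesis .
  qed
  have 2: "f d (R d) = (\<Oplus>\<^bsub>D\<^esub>b\<in>B. m d b \<odot>\<^bsub>D\<^esub> f d (V b))" if d: "d \<in> B" for d
  proof -
    have lin: "clinear_map A D (f d)" using f d by (simp add: bilinear_def)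
    have "f d (R d) = (\<Oplus>\<^bsub>D\<^esub>b\<in>B. f d (m d b \<odot> V b))"
      unfolding R[OF d] using V
      by (intro clinear_map_finsum[OF star_normed_algebra_axioms D.star_normed_algebra_axioms lin finite_B]) auto
    also have "\<dots> = (\<Oplus>\<^bsub>D\<^esub>b\<in>B. m d b \<odot>\<^bsub>D\<^esub> f d (V b))"
      using V d fc clinear_mapD(3)[OF lin] by (intro D.finsum_cong') auto
    finally show ?thesis .
  qed
  have "(\<Oplus>\<^bsub>D\<^esub>b\<in>B. f (P b) (V b)) = (\<Oplus>\<^bsub>D\<^esub>b\<in>B. \<Oplus>\<^bsub>D\<^esub>d\<in>B. m d b \<odot>\<^bsub>D\<^esub> f d (V b))"
    using 1 V fc by (intro D.finsum_cong') (auto intro!: D.finsum_closed)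
  also have "\<dots> = (\<Oplus>\<^bsub>D\<^esub>d\<in>B. \<Oplus>\<^bsub>D\<^esub>b\<in>B. m d b \<odot>\<^bsub>D\<^esub> f d (V b))"
    using V fc finite_B by (intro D.finsum_swap) auto
  also have "\<dots> = (\<Oplus>\<^bsub>D\<^esub>d\<in>B. f d (R d))"
    using 2 V fc by (intro D.finsum_cong') (auto intro!: D.finsum_closed)
  finally show ?thesis .
qed

lemma coord_expansion: "x \<in> carrier A \<Longrightarrow> x = (\<Oplus>d\<in>B. \<tau> (dual d \<otimes> x) \<odot> d)"
  using lincomb_coord[OF spans_B, of x] lincomb_cong[OF B_subset, of "coord B x" "\<lambda>d. \<tau> (dual d \<otimes> x)"]
  by (simp add: coord_eq_\<tau> lincomb_def)

text \<open>The matrix of left multiplication by \<open>a\<close> in the basis is also the matrix of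
  right multiplication by \<open>a\<close> in the dual basis. Together with
  \<open>diagonal_sum\<close> this makes the tensor a separability idempotent.\<close>

lemma ev_module:
  assumes f: "bilinear f" and a: "a \<in> carrier A"
  shows "ev (\<lambda>u v. f (a \<otimes> u) v) = ev (\<lambda>u v. f u (v \<otimes> a))"
  unfolding ev_def
proof (rule ev_transfer[OF f, where m = "\<lambda>d b. \<tau> (dual d \<otimes> (a \<otimes> b))"])
  show "a \<otimes> b = (\<Oplus>d\<in>B. \<tau> (dual d \<otimes> (a \<otimes> b)) \<odot> d)" if "b \<in> B" for b
    using coord_expansion[of "a \<otimes> b"] a that by simp
  show "dual d \<otimes> a = (\<Oplus>b\<in>B. \<tau> (dual d \<otimes> (a \<otimes> b)) \<odot> dual b)" if d: "d \<in> B" for d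
  proof -
    have "(\<Oplus>b\<in>B. \<tau> (dual d \<otimes> (a \<otimes> b)) \<odot> dual b) = (\<Oplus>b\<in>B. \<tau> (dual d \<otimes> a \<otimes> b) \<odot> dual b)"
      using a d by (intro finsum_cong') (auto simp: m_assoc)
    then show ?thesis using dual_expansion[of "dual d \<otimes> a"] a d by simp
  qed
qed auto

text \<open>An automorphism preserves \<tau>, so it carries the pair of dual bases to another pair
  of dual bases for the same form, and the tensor of such a pair is independent of the pair.\<close>

lemma ev_automorphism:
  assumes f: "bilinear f" and \<alpha>: "star_automorphism A \<alpha>"
  shows "ev (\<lambda>u v. f (\<alpha> u) (\<alpha> v)) = ev f"
  unfolding ev_def
proof (rule ev_transfer[OF f, where m = "\<lambda>d b. \<tau> (dual d \<otimes> \<alpha> b)"])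
  have hom: "unital_star_hom A A \<alpha>" and bij: "bij_betw \<alpha> (carrier A) (carrier A)"
    using \<alpha> by (auto simp: star_automorphism_def)
  note h = unital_star_homD[OF hom]
  show "\<alpha> b = (\<Oplus>d\<in>B. \<tau> (dual d \<otimes> \<alpha> b) \<odot> d)" if "b \<in> B" for b
    using coord_expansion[of "\<alpha> b"] h that by simp
  show "\<alpha> (dual b) \<in> carrier A" if "b \<in> B" for b using h that by simp
  show "dual d = (\<Oplus>b\<in>B. \<tau> (dual d \<otimes> \<alpha> b) \<odot> \<alpha> (dual b))" if d: "d \<in> B" for d
  proof -
    \<comment> \<open>The preimage is expanded in the dual basis; invariance of \<tau> rewrites the
      coefficients after \<alpha> is applied.\<close>
    obtain y where y: "y \<in> carrier A" "dual d = \<alpha> y" using bij d by (metis bij_betw_def imageE dual_carrier)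
    have t: "\<tau> (\<alpha> y \<otimes> \<alpha> b) = \<tau> (y \<otimes> b)" if "b \<in> B" for b
      using \<tau>_automorphism[OF \<alpha>, of "y \<otimes> b"] h(2) y that by simp
    have "\<alpha> y = \<alpha> (\<Oplus>b\<in>B. \<tau> (y \<otimes> b) \<odot> dual b)" using dual_expansion[OF y(1)] by simp
    also have "\<dots> = (\<Oplus>b\<in>B. \<alpha> (\<tau> (y \<otimes> b) \<odot> dual b))"
      using finite_B by (intro clinear_map_finsum[OF star_normed_algebra_axioms star_normed_algebra_axioms
          unital_star_hom_linear[OF hom]]) auto
    also have "\<dots> = (\<Oplus>b\<in>B. \<tau> (\<alpha> y \<otimes> \<alpha> b) \<odot> \<alpha> (dual b))"
      using h t by (intro finsum_cong') auto
    finally show ?thesis using y(2) by simp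
  qed
qed

end

section \<open>Newton iteration for almost multiplicative maps\<close>

context fd_to_normed
begin

definition star_linear :: "('a \<Rightarrow> 'd) \<Rightarrow> bool" where
  "star_linear f \<longleftrightarrow> clinear_map A D f \<and> (\<forall>x\<in>carrier A. f (adj A x) = adj D (f x))"

lemma star_linearD:
  assumes "star_linear f"
  shows "x \<in> carrier A \<Longrightarrow> f x \<in> carrier D"
    "\<lbrakk>x \<in> carrier A; y \<in> carrier A\<rbrakk> \<Longrightarrow> f (x \<oplus> y) = f x \<oplus>\<^bsub>D\<^esub> f y"
    "x \<in> carrier A \<Longrightarrow> f (c \<odot> x) = c \<odot>\<^bsub>D\<^esub> f x"
    "x \<in> carrier A \<Longrightarrow> f (adj A x) = adj D (f x)"
  using assms by (auto simp: star_linear_def clinear_map_def)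

definition defect :: "('a \<Rightarrow> 'd) \<Rightarrow> 'a \<Rightarrow> 'a \<Rightarrow> 'd" where
  "defect f a b = f (a \<otimes> b) \<ominus>\<^bsub>D\<^esub> f a \<otimes>\<^bsub>D\<^esub> f b"

text \<open>
  The multiplicative defect of a linear map satisfies the 2-cocycle identity. Contracting it with the
  diagonal, as in the proof that separable algebras have no second cohomology, gives a correction
  that removes it up to a quadratic error.
\<close>

definition corr :: "('a \<Rightarrow> 'd) \<Rightarrow> 'a \<Rightarrow> 'd" where
  "corr f b = ev (\<lambda>u v. f u \<otimes>\<^bsub>D\<^esub> defect f v b)"

text \<open>\<open>corr f\<close> need not respect adjoints. Averaging it with its conjugate keeps
  the iterates star-preserving and, because the defect has the matching symmetry
  \<open>defect_adj\<close>, still solves the coboundary equation.\<close>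

definition sym_corr :: "('a \<Rightarrow> 'd) \<Rightarrow> 'a \<Rightarrow> 'd" where
  "sym_corr f b = (1/2) \<odot>\<^bsub>D\<^esub> (corr f b \<oplus>\<^bsub>D\<^esub> adj D (corr f (adj A b)))"

definition newton :: "('a \<Rightarrow> 'd) \<Rightarrow> 'a \<Rightarrow> 'd" where
  "newton f b = f b \<oplus>\<^bsub>D\<^esub> sym_corr f b"

lemma defect_closed [simp]:
  "\<lbrakk>star_linear f; a \<in> carrier A; b \<in> carrier A\<rbrakk> \<Longrightarrow> defect f a b \<in> carrier D"
  by (simp add: defect_def star_linearD)

lemma defect_bilinear:
  assumes f: "star_linear f"
  shows "bilinear (defect f)"
proof -
  note fD = star_linearD[OF f]
  have add: "x \<oplus>\<^bsub>D\<^esub> y \<ominus>\<^bsub>D\<^esub> (z \<oplus>\<^bsub>D\<^esub> w) = (x \<ominus>\<^bsub>D\<^esub> z) \<oplus>\<^bsub>D\<^esub> (y \<ominus>\<^bsub>D\<^esub> w)"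
    if "x \<in> carrier D" "y \<in> carrier D" "z \<in> carrier D" "w \<in> carrier D" for x y z w
    using that by algebra
  show ?thesis
    unfolding bilinear_def clinear_map_def defect_def
    by (auto simp: fD r_distr l_distr D.r_distr D.l_distr add smult_mult_left smult_mult_right
        D.smult_mult_left D.smult_mult_right D.smult_diff)
qed

lemma defect_adj:
  assumes f: "star_linear f" and "a \<in> carrier A" "b \<in> carrier A"
  shows "adj D (defect f a b) = defect f (adj A b) (adj A a)"
  using assms by (simp add: defect_def star_linearD[OF f] D.adj_diff D.adj_mult adj_mult flip: star_linearD(4)[OF f])

lemma ev_diff:
  assumes "\<And>u v. \<lbrakk>u \<in> carrier A; v \<in> carrier A\<rbrakk> \<Longrightarrow> f u v \<in> carrier D"
    "\<And>u v. \<lbrakk>u \<in> carrier A; v \<in> carrier A\<rbrakk> \<Longrightarrow> g u v \<in> carrier D"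
  shows "ev (\<lambda>u v. f u v \<ominus>\<^bsub>D\<^esub> g u v) = ev f \<ominus>\<^bsub>D\<^esub> ev g"
proof -
  have "clinear_map D D (\<lambda>x. \<ominus>\<^bsub>D\<^esub> x)" by (simp add: clinear_map_def D.minus_add D.smult_minus)
  from ev_linear_self[OF this assms(2)] show ?thesis
    using assms by (simp add: a_minus_def ev_add)
qed

lemma ev_smult:
  assumes "\<And>u v. \<lbrakk>u \<in> carrier A; v \<in> carrier A\<rbrakk> \<Longrightarrow> f u v \<in> carrier D"
  shows "ev (\<lambda>u v. c \<odot>\<^bsub>D\<^esub> f u v) = c \<odot>\<^bsub>D\<^esub> ev f"
proof -
  have "clinear_map D D (\<lambda>x. c \<odot>\<^bsub>D\<^esub> x)"
    by (simp add: clinear_map_def D.smult_add_right D.smult_smult mult.commute)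
  from ev_linear_self[OF this assms] show ?thesis by simp
qed

lemma ev_mult_left:
  assumes "\<And>u v. \<lbrakk>u \<in> carrier A; v \<in> carrier A\<rbrakk> \<Longrightarrow> f u v \<in> carrier D" "x \<in> carrier D"
  shows "ev (\<lambda>u v. x \<otimes>\<^bsub>D\<^esub> f u v) = x \<otimes>\<^bsub>D\<^esub> ev f"
proof -
  have "clinear_map D D (\<lambda>y. x \<otimes>\<^bsub>D\<^esub> y)"
    using assms(2) by (simp add: clinear_map_def D.r_distr D.smult_mult_right)
  from ev_linear_self[OF this assms(1)] show ?thesis by simp
qed

lemma ev_mult_right:
  assumes "\<And>u v. \<lbrakk>u \<in> carrier A; v \<in> carrier A\<rbrakk> \<Longrightarrow> f u v \<in> carrier D" "x \<in> carrier D"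
  shows "ev (\<lambda>u v. f u v \<otimes>\<^bsub>D\<^esub> x) = ev f \<otimes>\<^bsub>D\<^esub> x"
proof -
  have "clinear_map D D (\<lambda>y. y \<otimes>\<^bsub>D\<^esub> x)"
    using assms(2) by (simp add: clinear_map_def D.l_distr D.smult_mult_left)
  from ev_linear_self[OF this assms(1)] show ?thesis by simp
qed

lemma corr_linear:
  assumes f: "star_linear f"
  shows "clinear_map A D (corr f)"
proof -
  note fD = star_linearD[OF f]
  note lin = defect_bilinear[OF f, unfolded bilinear_def clinear_map_def]
  have "corr f (x \<oplus> y) = corr f x \<oplus>\<^bsub>D\<^esub> corr f y" if "x \<in> carrier A" "y \<in> carrier A" for x y
  proof -
    have "corr f (x \<oplus> y) = ev (\<lambda>u v. f u \<otimes>\<^bsub>D\<^esub> defect f v x \<oplus>\<^bsub>D\<^esub> f u \<otimes>\<^bsub>D\<^esub> defect f v y)"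
      unfolding corr_def using f that fD lin by (intro ev_cong) (auto simp: D.r_distr)
    then show ?thesis using that f fD by (simp add: ev_add corr_def)
  qed
  moreover have "corr f (c \<odot> x) = c \<odot>\<^bsub>D\<^esub> corr f x" if "x \<in> carrier A" for c x
  proof -
    have "corr f (c \<odot> x) = ev (\<lambda>u v. c \<odot>\<^bsub>D\<^esub> (f u \<otimes>\<^bsub>D\<^esub> defect f v x))"
      unfolding corr_def using f that fD lin by (intro ev_cong) (auto simp: D.smult_mult_right)
    then show ?thesis using that f fD by (simp add: ev_smult corr_def)
  qed
  moreover have "corr f x \<in> carrier D" if "x \<in> carrier A" for x
    unfolding corr_def using that f fD by simp
  ultimately show ?thesis by (simp add: clinear_map_def)
qed

lemma sym_corr_linear:
  assumes f: "star_linear f"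
  shows "star_linear (sym_corr f)"
proof -
  note S = clinear_mapD[OF corr_linear[OF f]]
  have "x \<oplus>\<^bsub>D\<^esub> y \<oplus>\<^bsub>D\<^esub> (z \<oplus>\<^bsub>D\<^esub> w) = (x \<oplus>\<^bsub>D\<^esub> z) \<oplus>\<^bsub>D\<^esub> (y \<oplus>\<^bsub>D\<^esub> w)"
    if "x \<in> carrier D" "y \<in> carrier D" "z \<in> carrier D" "w \<in> carrier D" for x y z w
    using that by algebra
  then show ?thesis
    by (auto simp: star_linear_def clinear_map_def sym_corr_def S adj_add adj_smult D.adj_add D.adj_smult
        D.smult_add_right D.smult_smult mult.commute D.a_comm)
qed

lemma newton_linear: "star_linear f \<Longrightarrow> star_linear (newton f)"
  using sym_corr_linear[of f]
  by (auto simp: star_linear_def clinear_map_def newton_def D.adj_add D.smult_add_right D.a_ac)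

text \<open>The expression in \<open>S\<close> is its Hochschild coboundary, with \<open>f\<close>
  in the role of both module actions; it is compared with the defect in the bilinear norm.\<close>

definition approx_solves :: "('a \<Rightarrow> 'd) \<Rightarrow> real \<Rightarrow> ('a \<Rightarrow> 'd) \<Rightarrow> bool" where
  "approx_solves f \<rho> S \<longleftrightarrow> (\<forall>a\<in>carrier A. \<forall>b\<in>carrier A.
     nrm D ((f a \<otimes>\<^bsub>D\<^esub> S b \<ominus>\<^bsub>D\<^esub> S (a \<otimes> b) \<oplus>\<^bsub>D\<^esub> S a \<otimes>\<^bsub>D\<^esub> f b) \<ominus>\<^bsub>D\<^esub> defect f a b)
       \<le> \<rho> * (nrm A a * nrm A b))"

text \<open>Linearity moves \<open>f\<close> outside the sum, and \<open>diagonal_sum\<close>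
  evaluates it.\<close>

lemma ev_map_product:
  assumes f: "star_linear f"
  shows "ev (\<lambda>u v. f (u \<otimes> v)) = f \<one>"
  using clinear_map_finsum[OF star_normed_algebra_axioms D.star_normed_algebra_axioms, of f B "\<lambda>b. b \<otimes> dual b"]
    f finite_B by (simp add: ev_def star_linear_def diagonal_sum)

text \<open>Contracting the cocycle identity with the diagonal: the terms with
  \<open>a \<otimes> u\<close> and \<open>v \<otimes> a\<close> cancel by \<open>ev_module\<close>,
  and the contraction of \<open>f (u \<otimes> v)\<close> is \<open>f \<one>\<close>. Apart from
  \<open>f \<one>\<close> times the defect, everything left is quadratic in the defect.\<close>

lemma corr_cobound:
  assumes f: "star_linear f" and ab: "a \<in> carrier A" "b \<in> carrier A"
  shows "f a \<otimes>\<^bsub>D\<^esub> corr f b \<ominus>\<^bsub>D\<^esub> corr f (a \<otimes> b) \<oplus>\<^bsub>D\<^esub> corr f a \<otimes>\<^bsub>D\<^esub> f b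
    = f \<one> \<otimes>\<^bsub>D\<^esub> defect f a b \<ominus>\<^bsub>D\<^esub> ev (defect f) \<otimes>\<^bsub>D\<^esub> defect f a b
      \<ominus>\<^bsub>D\<^esub> ev (\<lambda>u v. defect f a u \<otimes>\<^bsub>D\<^esub> defect f v b)"
proof -
  note fD = star_linearD[OF f]
  let ?F = "defect f"
  \<comment> \<open>The cocycle identity multiplied from the left by \<open>f u\<close>, in which
    the products of \<open>f a\<close> with \<open>f u\<close> and of \<open>f u\<close> with
    \<open>f v\<close> are rewritten as values of \<open>f\<close> minus a defect. The first bracket
    on the right is the one that \<open>ev_module\<close> kills.\<close>
  have pointwise: "f a \<otimes>\<^bsub>D\<^esub> (f u \<otimes>\<^bsub>D\<^esub> ?F v b) \<ominus>\<^bsub>D\<^esub> f u \<otimes>\<^bsub>D\<^esub> ?F v (a \<otimes> b) \<oplus>\<^bsub>D\<^esub> (f u \<otimes>\<^bsub>D\<^esub> ?F v a) \<otimes>\<^bsub>D\<^esub> f b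
    = (f (a \<otimes> u) \<otimes>\<^bsub>D\<^esub> ?F v b \<ominus>\<^bsub>D\<^esub> f u \<otimes>\<^bsub>D\<^esub> ?F (v \<otimes> a) b) \<oplus>\<^bsub>D\<^esub>
      (f (u \<otimes> v) \<otimes>\<^bsub>D\<^esub> ?F a b \<ominus>\<^bsub>D\<^esub> ?F u v \<otimes>\<^bsub>D\<^esub> ?F a b \<ominus>\<^bsub>D\<^esub> ?F a u \<otimes>\<^bsub>D\<^esub> ?F v b)"
    if uv: "u \<in> carrier A" "v \<in> carrier A" for u v
  proof -
    have "f (v \<otimes> a \<otimes> b) = f (v \<otimes> (a \<otimes> b))" using ab uv by (simp add: m_assoc)
    then show ?thesis
      unfolding defect_def
      using fD(1)[OF ab(1)] fD(1)[OF ab(2)] fD(1)[OF uv(1)] fD(1)[OF uv(2)]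
        fD(1)[of "a \<otimes> b"] fD(1)[of "v \<otimes> b"] fD(1)[of "v \<otimes> a"] fD(1)[of "a \<otimes> u"] fD(1)[of "u \<otimes> v"]
        fD(1)[of "v \<otimes> (a \<otimes> b)"] ab uv
      by (simp add: m_closed a_minus_def D.l_distr D.r_distr D.l_minus D.r_minus D.m_assoc D.minus_add)
        algebra
  qed
  have module: "ev (\<lambda>u v. f (a \<otimes> u) \<otimes>\<^bsub>D\<^esub> ?F v b) = ev (\<lambda>u v. f u \<otimes>\<^bsub>D\<^esub> ?F (v \<otimes> a) b)"
  proof (rule ev_module[where f = "\<lambda>u v. f u \<otimes>\<^bsub>D\<^esub> ?F v b"])
    note lin = defect_bilinear[OF f, unfolded bilinear_def clinear_map_def]
    show "bilinear (\<lambda>u v. f u \<otimes>\<^bsub>D\<^esub> ?F v b)"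
      unfolding bilinear_def clinear_map_def using f fD lin ab
      by (auto simp: D.l_distr D.r_distr D.smult_mult_left D.smult_mult_right)
  qed (use ab in auto)
  have "f a \<otimes>\<^bsub>D\<^esub> corr f b \<ominus>\<^bsub>D\<^esub> corr f (a \<otimes> b) \<oplus>\<^bsub>D\<^esub> corr f a \<otimes>\<^bsub>D\<^esub> f b
    = ev (\<lambda>u v. f a \<otimes>\<^bsub>D\<^esub> (f u \<otimes>\<^bsub>D\<^esub> ?F v b) \<ominus>\<^bsub>D\<^esub> f u \<otimes>\<^bsub>D\<^esub> ?F v (a \<otimes> b) \<oplus>\<^bsub>D\<^esub> (f u \<otimes>\<^bsub>D\<^esub> ?F v a) \<otimes>\<^bsub>D\<^esub> f b)"
    using f fD ab by (simp add: corr_def ev_add ev_diff ev_mult_left ev_mult_right)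
  also have "\<dots> = ev (\<lambda>u v. (f (a \<otimes> u) \<otimes>\<^bsub>D\<^esub> ?F v b \<ominus>\<^bsub>D\<^esub> f u \<otimes>\<^bsub>D\<^esub> ?F (v \<otimes> a) b) \<oplus>\<^bsub>D\<^esub>
      (f (u \<otimes> v) \<otimes>\<^bsub>D\<^esub> ?F a b \<ominus>\<^bsub>D\<^esub> ?F u v \<otimes>\<^bsub>D\<^esub> ?F a b \<ominus>\<^bsub>D\<^esub> ?F a u \<otimes>\<^bsub>D\<^esub> ?F v b))"
    using f fD ab pointwise by (intro ev_cong) auto
  also have "\<dots> = f \<one> \<otimes>\<^bsub>D\<^esub> ?F a b \<ominus>\<^bsub>D\<^esub> ev ?F \<otimes>\<^bsub>D\<^esub> ?F a b \<ominus>\<^bsub>D\<^esub> ev (\<lambda>u v. ?F a u \<otimes>\<^bsub>D\<^esub> ?F v b)"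
    using f fD ab by (simp add: ev_add ev_diff ev_mult_right ev_map_product module)
  finally show ?thesis .
qed

text \<open>In \<open>corr_cobound\<close> the two products of defects are of order \<delta>^2, and
  replacing \<open>f \<one>\<close> by the unit costs \<eta> * \<delta>. Since \<eta> will only be
  kept below a constant, the estimate yields a fixed factor per step.\<close>

lemma corr_approx_solves:
  assumes f: "star_linear f"
    and \<delta>: "\<And>a b. \<lbrakk>a \<in> carrier A; b \<in> carrier A\<rbrakk> \<Longrightarrow> nrm D (defect f a b) \<le> \<delta> * (nrm A a * nrm A b)"
    and \<delta>0: "0 \<le> \<delta>" and \<eta>: "nrm D (f \<one> \<ominus>\<^bsub>D\<^esub> \<one>\<^bsub>D\<^esub>) \<le> \<eta>"
  shows "approx_solves f ((2 * diag_bound * \<delta> + \<eta>) * \<delta>) (corr f)"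
  unfolding approx_solves_def
proof (intro ballI)
  note fD = star_linearD[OF f]
  fix a b assume ab: "a \<in> carrier A" "b \<in> carrier A"
  let ?K = diag_bound and ?F = "defect f a b"
  let ?E = "ev (\<lambda>u v. defect f a u \<otimes>\<^bsub>D\<^esub> defect f v b)"
  have c: "?F \<in> carrier D" "?E \<in> carrier D" "ev (defect f) \<in> carrier D" "f \<one> \<in> carrier D"
    using f ab fD by auto
  have E: "nrm D ?E \<le> ?K * (\<delta> * \<delta> * (nrm A a * nrm A b))"
  proof (rule ev_nrm_le)
    fix u v assume uv: "u \<in> carrier A" "v \<in> carrier A"
    show "defect f a u \<otimes>\<^bsub>D\<^esub> defect f v b \<in> carrier D" using f ab uv by simp
    have "nrm D (defect f a u \<otimes>\<^bsub>D\<^esub> defect f v b) \<le> nrm D (defect f a u) * nrm D (defect f v b)"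
      using f ab uv by (intro D.nrm_mult) auto
    also have "\<dots> \<le> (\<delta> * (nrm A a * nrm A u)) * (\<delta> * (nrm A v * nrm A b))"
      using f ab uv \<delta>0 by (intro mult_mono \<delta> D.nrm_nonneg mult_nonneg_nonneg nrm_nonneg) auto
    finally show "nrm D (defect f a u \<otimes>\<^bsub>D\<^esub> defect f v b) \<le> \<delta> * \<delta> * (nrm A a * nrm A b) * (nrm A u * nrm A v)"
      by (simp add: mult_ac)
  qed
  have "nrm D (ev (defect f)) \<le> ?K * \<delta>"
    using f \<delta> by (intro ev_nrm_le) auto
  then have EF: "nrm D (ev (defect f) \<otimes>\<^bsub>D\<^esub> ?F) \<le> (?K * \<delta>) * (\<delta> * (nrm A a * nrm A b))"
    using c ab \<delta> \<delta>0 diag_bound_nonneg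
    by (intro order.trans[OF D.nrm_mult] mult_mono D.nrm_nonneg mult_nonneg_nonneg) auto
  have \<eta>0: "0 \<le> \<eta>" using \<eta> D.nrm_nonneg[of "f \<one> \<ominus>\<^bsub>D\<^esub> \<one>\<^bsub>D\<^esub>"] c by simp
  have 1: "nrm D ((f \<one> \<ominus>\<^bsub>D\<^esub> \<one>\<^bsub>D\<^esub>) \<otimes>\<^bsub>D\<^esub> ?F) \<le> \<eta> * (\<delta> * (nrm A a * nrm A b))"
    using c ab \<delta> \<eta> \<eta>0 by (intro order.trans[OF D.nrm_mult] mult_mono D.nrm_nonneg) auto
  have eq: "(f a \<otimes>\<^bsub>D\<^esub> corr f b \<ominus>\<^bsub>D\<^esub> corr f (a \<otimes> b) \<oplus>\<^bsub>D\<^esub> corr f a \<otimes>\<^bsub>D\<^esub> f b) \<ominus>\<^bsub>D\<^esub> ?F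
    = (f \<one> \<ominus>\<^bsub>D\<^esub> \<one>\<^bsub>D\<^esub>) \<otimes>\<^bsub>D\<^esub> ?F \<ominus>\<^bsub>D\<^esub> ev (defect f) \<otimes>\<^bsub>D\<^esub> ?F \<ominus>\<^bsub>D\<^esub> ?E"
  proof -
    have "x \<otimes>\<^bsub>D\<^esub> z \<ominus>\<^bsub>D\<^esub> y \<otimes>\<^bsub>D\<^esub> z \<ominus>\<^bsub>D\<^esub> w \<ominus>\<^bsub>D\<^esub> z = (x \<ominus>\<^bsub>D\<^esub> \<one>\<^bsub>D\<^esub>) \<otimes>\<^bsub>D\<^esub> z \<ominus>\<^bsub>D\<^esub> y \<otimes>\<^bsub>D\<^esub> z \<ominus>\<^bsub>D\<^esub> w"
      if "x \<in> carrier D" "y \<in> carrier D" "z \<in> carrier D" "w \<in> carrier D" for x y z w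
      using that by algebra
    then show ?thesis unfolding corr_cobound[OF f ab] using c by simp
  qed
  have "nrm D ((f \<one> \<ominus>\<^bsub>D\<^esub> \<one>\<^bsub>D\<^esub>) \<otimes>\<^bsub>D\<^esub> ?F \<ominus>\<^bsub>D\<^esub> ev (defect f) \<otimes>\<^bsub>D\<^esub> ?F \<ominus>\<^bsub>D\<^esub> ?E)
    \<le> nrm D ((f \<one> \<ominus>\<^bsub>D\<^esub> \<one>\<^bsub>D\<^esub>) \<otimes>\<^bsub>D\<^esub> ?F) + nrm D (ev (defect f) \<otimes>\<^bsub>D\<^esub> ?F) + nrm D ?E"
    using c by (intro order.trans[OF D.nrm_diff_le] add_right_mono D.nrm_diff_le) auto
  also have "\<dots> \<le> (2 * ?K * \<delta> + \<eta>) * \<delta> * (nrm A a * nrm A b)"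
    using E EF 1 by (simp add: algebra_simps)
  finally show "nrm D ((f a \<otimes>\<^bsub>D\<^esub> corr f b \<ominus>\<^bsub>D\<^esub> corr f (a \<otimes> b) \<oplus>\<^bsub>D\<^esub> corr f a \<otimes>\<^bsub>D\<^esub> f b) \<ominus>\<^bsub>D\<^esub> ?F)
    \<le> (2 * ?K * \<delta> + \<eta>) * \<delta> * (nrm A a * nrm A b)"
    unfolding eq .
qed

text \<open>The adjoint of the error of \<open>corr f\<close> at the pair (\<open>adj A b\<close>,
  \<open>adj A a\<close>) is the error of the conjugate correction at (\<open>a\<close>,
  \<open>b\<close>), with the same bound; the symmetrized error is the mean of the two.\<close>

lemma sym_corr_approx_solves:
  assumes f: "star_linear f" and app: "approx_solves f \<rho> (corr f)"
  shows "approx_solves f \<rho> (sym_corr f)"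
  unfolding approx_solves_def
proof (intro ballI)
  note fD = star_linearD[OF f]
  note S = clinear_mapD[OF corr_linear[OF f]]
  let ?S = "corr f"
  let ?G = "\<lambda>a b. (f a \<otimes>\<^bsub>D\<^esub> ?S b \<ominus>\<^bsub>D\<^esub> ?S (a \<otimes> b) \<oplus>\<^bsub>D\<^esub> ?S a \<otimes>\<^bsub>D\<^esub> f b) \<ominus>\<^bsub>D\<^esub> defect f a b"
  fix a b assume ab: "a \<in> carrier A" "b \<in> carrier A"
  let ?a = "adj A a" and ?b = "adj A b"
  have ab': "?a \<in> carrier A" "?b \<in> carrier A" using ab by auto
  have G: "nrm D (?G a b) \<le> \<rho> * (nrm A a * nrm A b)" "nrm D (?G ?b ?a) \<le> \<rho> * (nrm A a * nrm A b)"
    using app ab app[unfolded approx_solves_def, rule_format, OF ab'(2,1)]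
    unfolding approx_solves_def by (auto simp: mult.commute)
  have Gc: "?G a b \<in> carrier D" "?G ?b ?a \<in> carrier D" using ab f fD S by auto
  have adj_G: "adj D (?G ?b ?a)
      = (f a \<otimes>\<^bsub>D\<^esub> adj D (?S ?b) \<ominus>\<^bsub>D\<^esub> adj D (?S (adj A (a \<otimes> b))) \<oplus>\<^bsub>D\<^esub> adj D (?S ?a) \<otimes>\<^bsub>D\<^esub> f b)
        \<ominus>\<^bsub>D\<^esub> defect f a b"
    using ab f S by (simp add: D.adj_diff D.adj_add D.adj_mult fD adj_mult defect_adj)
      (simp add: a_minus_def D.a_ac fD S)
  have "?G a b \<oplus>\<^bsub>D\<^esub> adj D (?G ?b ?a)
    = (f a \<otimes>\<^bsub>D\<^esub> (?S b \<oplus>\<^bsub>D\<^esub> adj D (?S ?b)) \<ominus>\<^bsub>D\<^esub> (?S (a \<otimes> b) \<oplus>\<^bsub>D\<^esub> adj D (?S (adj A (a \<otimes> b))))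
       \<oplus>\<^bsub>D\<^esub> (?S a \<oplus>\<^bsub>D\<^esub> adj D (?S ?a)) \<otimes>\<^bsub>D\<^esub> f b) \<ominus>\<^bsub>D\<^esub> (defect f a b \<oplus>\<^bsub>D\<^esub> defect f a b)"
    unfolding adj_G
    using fD(1)[OF ab(1)] fD(1)[OF ab(2)] S(1)[OF ab(1)] S(1)[OF ab(2)] S(1)[of "a \<otimes> b"]
      D.adj_closed[OF S(1)[OF ab'(1)]] D.adj_closed[OF S(1)[OF ab'(2)]]
      D.adj_closed[OF S(1)[of "adj A (a \<otimes> b)"]] defect_closed[OF f ab] ab
    by (simp only: m_closed adj_closed) algebra
  then have "(1/2) \<odot>\<^bsub>D\<^esub> (?G a b \<oplus>\<^bsub>D\<^esub> adj D (?G ?b ?a))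
    = (f a \<otimes>\<^bsub>D\<^esub> sym_corr f b \<ominus>\<^bsub>D\<^esub> sym_corr f (a \<otimes> b) \<oplus>\<^bsub>D\<^esub> sym_corr f a \<otimes>\<^bsub>D\<^esub> f b) \<ominus>\<^bsub>D\<^esub> defect f a b"
    using ab ab' f fD(1) S(1) defect_closed[OF f ab]
    by (simp add: sym_corr_def D.smult_diff D.smult_add_right D.smult_half_add
        D.smult_mult_left D.smult_mult_right D.l_distr D.r_distr)
  moreover have "nrm D ((1/2) \<odot>\<^bsub>D\<^esub> (?G a b \<oplus>\<^bsub>D\<^esub> adj D (?G ?b ?a))) \<le> \<rho> * (nrm A a * nrm A b)"
  proof -
    have "nrm D ((1/2) \<odot>\<^bsub>D\<^esub> (?G a b \<oplus>\<^bsub>D\<^esub> adj D (?G ?b ?a))) = 1/2 * nrm D (?G a b \<oplus>\<^bsub>D\<^esub> adj D (?G ?b ?a))"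
      using Gc by (subst D.nrm_smult) (auto intro!: D.add.m_closed D.adj_closed)
    also have "\<dots> \<le> 1/2 * (nrm D (?G a b) + nrm D (?G ?b ?a))"
      using D.nrm_triangle[OF Gc(1) D.adj_closed[OF Gc(2)]] D.nrm_adj[OF Gc(2)] by (intro mult_left_mono) auto
    also have "\<dots> \<le> \<rho> * (nrm A a * nrm A b)"
    proof -
      have "1/2 * (x + y) \<le> c" if "x \<le> c" "y \<le> c" for x y c :: real
        using that by simp
      then show ?thesis using G by blast
    qed
    finally show ?thesis .
  qed
  ultimately show "nrm D ((f a \<otimes>\<^bsub>D\<^esub> sym_corr f b \<ominus>\<^bsub>D\<^esub> sym_corr f (a \<otimes> b) \<oplus>\<^bsub>D\<^esub> sym_corr f a \<otimes>\<^bsub>D\<^esub> f b)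
      \<ominus>\<^bsub>D\<^esub> defect f a b) \<le> \<rho> * (nrm A a * nrm A b)" by simp
qed

lemma corr_nrm_le:
  assumes f: "star_linear f" and M: "\<And>x. x \<in> carrier A \<Longrightarrow> nrm D (f x) \<le> M * nrm A x" "0 \<le> M"
    and \<delta>: "\<And>a b. \<lbrakk>a \<in> carrier A; b \<in> carrier A\<rbrakk> \<Longrightarrow> nrm D (defect f a b) \<le> \<delta> * (nrm A a * nrm A b)"
    and b: "b \<in> carrier A"
  shows "nrm D (corr f b) \<le> diag_bound * M * \<delta> * nrm A b"
proof -
  have "nrm D (corr f b) \<le> diag_bound * (M * \<delta> * nrm A b)"
    unfolding corr_def
  proof (rule ev_nrm_le)
    fix u v assume uv: "u \<in> carrier A" "v \<in> carrier A"
    show "f u \<otimes>\<^bsub>D\<^esub> defect f v b \<in> carrier D" using f star_linearD(1)[OF f] b uv by simp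
    have "nrm D (f u \<otimes>\<^bsub>D\<^esub> defect f v b) \<le> nrm D (f u) * nrm D (defect f v b)"
      using f star_linearD(1)[OF f] b uv by (intro D.nrm_mult) auto
    also have "\<dots> \<le> (M * nrm A u) * (\<delta> * (nrm A v * nrm A b))"
      using f b uv M by (intro mult_mono \<delta> M D.nrm_nonneg mult_nonneg_nonneg nrm_nonneg) auto
    finally show "nrm D (f u \<otimes>\<^bsub>D\<^esub> defect f v b) \<le> M * \<delta> * nrm A b * (nrm A u * nrm A v)"
      by (simp add: mult_ac)
  qed
  then show ?thesis by (simp add: mult_ac)
qed

lemma sym_corr_nrm_le:
  assumes f: "star_linear f" and M: "\<And>x. x \<in> carrier A \<Longrightarrow> nrm D (f x) \<le> M * nrm A x" "0 \<le> M"
    and \<delta>: "\<And>a b. \<lbrakk>a \<in> carrier A; b \<in> carrier A\<rbrakk> \<Longrightarrow> nrm D (defect f a b) \<le> \<delta> * (nrm A a * nrm A b)"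
    and b: "b \<in> carrier A"
  shows "nrm D (sym_corr f b) \<le> diag_bound * M * \<delta> * nrm A b"
proof -
  note S = clinear_mapD(1)[OF corr_linear[OF f]]
  have "nrm D (sym_corr f b) = 1/2 * nrm D (corr f b \<oplus>\<^bsub>D\<^esub> adj D (corr f (adj A b)))"
    using S b by (simp add: sym_corr_def D.nrm_smult)
  also have "\<dots> \<le> 1/2 * (nrm D (corr f b) + nrm D (corr f (adj A b)))"
    using D.nrm_triangle[of "corr f b" "adj D (corr f (adj A b))"] S b by simp
  also have "\<dots> \<le> diag_bound * M * \<delta> * nrm A b"
    using corr_nrm_le[OF f M \<delta> b] corr_nrm_le[OF f M \<delta> adj_closed[OF b]] b by simp
  finally show ?thesis .
qed

text \<open>Expanding the defect of \<open>f\<close> plus its correction, the linear part cancels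
  the old defect up to the error of \<open>approx_solves\<close>, and only the product of two
  corrections is added.\<close>

lemma newton_defect_le:
  assumes f: "star_linear f" and M: "\<And>x. x \<in> carrier A \<Longrightarrow> nrm D (f x) \<le> M * nrm A x" "0 \<le> M"
    and \<delta>: "\<And>a b. \<lbrakk>a \<in> carrier A; b \<in> carrier A\<rbrakk> \<Longrightarrow> nrm D (defect f a b) \<le> \<delta> * (nrm A a * nrm A b)"
    and \<delta>0: "0 \<le> \<delta>" and \<eta>: "nrm D (f \<one> \<ominus>\<^bsub>D\<^esub> \<one>\<^bsub>D\<^esub>) \<le> \<eta>"
    and ab: "a \<in> carrier A" "b \<in> carrier A"
  shows "nrm D (defect (newton f) a b)
    \<le> ((2 * diag_bound * \<delta> + \<eta>) * \<delta> + (diag_bound * M * \<delta>)\<^sup>2) * (nrm A a * nrm A b)"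
proof -
  let ?H = "sym_corr f" and ?KM = "diag_bound * M * \<delta>"
  note fD = star_linearD[OF f] and HD = star_linearD[OF sym_corr_linear[OF f]]
  let ?E = "(f a \<otimes>\<^bsub>D\<^esub> ?H b \<ominus>\<^bsub>D\<^esub> ?H (a \<otimes> b) \<oplus>\<^bsub>D\<^esub> ?H a \<otimes>\<^bsub>D\<^esub> f b) \<ominus>\<^bsub>D\<^esub> defect f a b"
  have c: "f a \<in> carrier D" "f b \<in> carrier D" "?H a \<in> carrier D" "?H b \<in> carrier D"
    "f (a \<otimes> b) \<in> carrier D" "?H (a \<otimes> b) \<in> carrier D"
    using fD(1) HD(1) ab by auto
  have "?E \<in> carrier D" using c f ab by simp
  have "approx_solves f ((2 * diag_bound * \<delta> + \<eta>) * \<delta>) ?H"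
    using sym_corr_approx_solves corr_approx_solves f \<delta> \<delta>0 \<eta> by blast
  then have E: "nrm D ?E \<le> (2 * diag_bound * \<delta> + \<eta>) * \<delta> * (nrm A a * nrm A b)"
    using ab unfolding approx_solves_def by blast
  have KM: "0 \<le> ?KM" using M(2) \<delta>0 diag_bound_nonneg by simp
  have "nrm D (?H a \<otimes>\<^bsub>D\<^esub> ?H b) \<le> nrm D (?H a) * nrm D (?H b)"
    using c by (intro D.nrm_mult)
  also have "\<dots> \<le> (?KM * nrm A a) * (?KM * nrm A b)"
    using sym_corr_nrm_le[OF f M \<delta>] ab c KM nrm_nonneg D.nrm_nonneg by (intro mult_mono) auto
  finally have HH: "nrm D (?H a \<otimes>\<^bsub>D\<^esub> ?H b) \<le> ?KM\<^sup>2 * (nrm A a * nrm A b)"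
    by (simp add: power2_eq_square mult_ac)
  have "defect (newton f) a b = \<ominus>\<^bsub>D\<^esub> ?E \<ominus>\<^bsub>D\<^esub> ?H a \<otimes>\<^bsub>D\<^esub> ?H b"
    unfolding defect_def newton_def using c by algebra
  then have "nrm D (defect (newton f) a b) \<le> nrm D ?E + nrm D (?H a \<otimes>\<^bsub>D\<^esub> ?H b)"
    using D.nrm_diff_le[of "\<ominus>\<^bsub>D\<^esub> ?E" "?H a \<otimes>\<^bsub>D\<^esub> ?H b"] D.nrm_minus[OF \<open>?E \<in> carrier D\<close>]
      D.a_inv_closed[OF \<open>?E \<in> carrier D\<close>] c by simp
  then show ?thesis using E HH by (simp add: algebra_simps)
qed

end

section \<open>Naturality of the Newton step\<close>

context fd_to_normed
begin

text \<open>Precomposition with \<alpha> amounts to applying \<alpha> to both legs of the diagonal,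
  which \<open>ev_automorphism\<close> absorbs. This is the source half of equivariance;
  \<open>newton_natural\<close> is the target half.\<close>

lemma newton_automorphism:
  assumes f: "star_linear f" and \<alpha>: "star_automorphism A \<alpha>"
    and g: "\<And>x. x \<in> carrier A \<Longrightarrow> g x = f (\<alpha> x)" and b: "b \<in> carrier A"
  shows "newton g b = newton f (\<alpha> b)"
proof -
  have hom: "unital_star_hom A A \<alpha>" using \<alpha> by (auto simp: star_automorphism_def)
  note h = unital_star_homD[OF hom]
  note fD = star_linearD[OF f]
  note lin = defect_bilinear[OF f, unfolded bilinear_def clinear_map_def]
  have corr: "corr g c = corr f (\<alpha> c)" if c: "c \<in> carrier A" for c
  proof -
    have bil: "bilinear (\<lambda>u v. f u \<otimes>\<^bsub>D\<^esub> defect f v (\<alpha> c))"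
      unfolding bilinear_def clinear_map_def using f fD lin h c
      by (auto simp: D.l_distr D.r_distr D.smult_mult_left D.smult_mult_right)
    have "corr g c = ev (\<lambda>u v. f (\<alpha> u) \<otimes>\<^bsub>D\<^esub> defect f (\<alpha> v) (\<alpha> c))"
      unfolding corr_def using c h g f fD by (intro ev_cong) (auto simp: defect_def)
    also have "\<dots> = corr f (\<alpha> c)"
      unfolding corr_def by (rule ev_automorphism[OF bil \<alpha>])
    finally show ?thesis .
  qed
  show ?thesis using b h by (simp add: newton_def sym_corr_def corr g)
qed

text \<open>A homomorphism has zero defect, so nothing is corrected. This keeps all iterates above
  \<phi>.\<close>

lemma newton_of_hom:
  assumes f: "star_linear f" and mult: "\<And>a b. \<lbrakk>a \<in> carrier A; b \<in> carrier A\<rbrakk> \<Longrightarrow> f (a \<otimes> b) = f a \<otimes>\<^bsub>D\<^esub> f b"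
    and b: "b \<in> carrier A"
  shows "newton f b = f b"
proof -
  note fD = star_linearD[OF f]
  have "corr f c = \<zero>\<^bsub>D\<^esub>" if "c \<in> carrier A" for c
  proof -
    have "corr f c = (\<Oplus>\<^bsub>D\<^esub>b\<in>B. \<zero>\<^bsub>D\<^esub>)"
      unfolding corr_def ev_def defect_def using that fD by (intro D.finsum_cong') (auto simp: mult)
    then show ?thesis by simp
  qed
  then show ?thesis using b fD by (simp add: newton_def sym_corr_def)
qed

end

text \<open>The step is assembled from linear operations, products, adjoints and a finite sum over
  the diagonal, all of which \<theta> respects. It is applied to the action of a group element on
  \<open>C/I n\<close> and to the canonical map onto \<open>C/J\<close>.\<close>

lemma newton_natural:
  assumes D: "fd_to_normed A B D" and E: "fd_to_normed A B E"
    and f: "fd_to_normed.star_linear A D f"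
    and \<theta>: "clinear_map D E \<theta>"
    and mult: "\<And>x y. \<lbrakk>x \<in> carrier D; y \<in> carrier D\<rbrakk> \<Longrightarrow> \<theta> (x \<otimes>\<^bsub>D\<^esub> y) = \<theta> x \<otimes>\<^bsub>E\<^esub> \<theta> y"
    and adj: "\<And>x. x \<in> carrier D \<Longrightarrow> \<theta> (adj D x) = adj E (\<theta> x)"
    and g: "\<And>x. x \<in> carrier A \<Longrightarrow> g x = \<theta> (f x)" and b: "b \<in> carrier A"
  shows "fd_to_normed.newton A B E g b = \<theta> (fd_to_normed.newton A B D f b)"
proof -
  interpret AD: fd_to_normed A B D by fact
  interpret AE: fd_to_normed A B E by fact
  note fD = AD.star_linearD[OF f] and \<theta>D = clinear_mapD[OF \<theta>]
  have neg: "\<theta> (\<ominus>\<^bsub>D\<^esub> x) = \<ominus>\<^bsub>E\<^esub> \<theta> x" if "x \<in> carrier D" for x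
    using \<theta>D(3)[OF that, of "-1"] that \<theta>D(1) by (simp add: AD.D.smult_neg1 AE.D.smult_neg1)
  have corr: "AE.corr g c = \<theta> (AD.corr f c)" if c: "c \<in> carrier A" for c
  proof -
    have "\<theta> (AD.corr f c) = (\<Oplus>\<^bsub>E\<^esub>b\<in>B. \<theta> (f b \<otimes>\<^bsub>D\<^esub> AD.defect f (AD.dual b) c))"
      unfolding AD.corr_def using c f fD
      by (intro AD.ev_linear[OF AE.D.star_normed_algebra_axioms \<theta>]) auto
    also have "\<dots> = AE.corr g c"
      unfolding AE.corr_def AE.ev_def using c f fD \<theta>D
      by (intro AE.D.finsum_cong')
        (auto simp: g AE.defect_def AD.defect_def mult neg a_minus_def)
    finally show ?thesis ..
  qed
  note SD = clinear_mapD(1)[OF AD.corr_linear[OF f]]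
  show ?thesis
    using b fD \<theta>D SD AD.D.adj_closed AE.D.adj_closed
    by (simp add: AE.newton_def AE.sym_corr_def AD.newton_def AD.sym_corr_def corr g adj)
qed

section \<open>Convergence of the iteration\<close>

locale fd_to_banach = fd_to_normed A B D + D: banach_star_algebra D
  for A :: "('a, 'm) cstar_algebra_scheme" (structure) and B
    and D :: "('d, 'n) cstar_algebra_scheme"
begin

text \<open>The first smallness condition makes each step halve the defect. The second keeps the sum
  of all corrections below 1/8, so that every iterate obeys the bound \<open>M + 1\<close> and has
  its value at \<open>\<one>\<close> within 1/4 of the unit; these two facts are what the next step
  requires.\<close>

lemma newton_converges:
  assumes f: "star_linear f" and M: "0 \<le> M" "\<And>x. x \<in> carrier A \<Longrightarrow> nrm D (f x) \<le> M * nrm A x"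
    and one: "nrm D (f \<one> \<ominus>\<^bsub>D\<^esub> \<one>\<^bsub>D\<^esub>) \<le> 1/8"
    and \<delta>: "0 \<le> \<delta>"
      "\<And>a b. \<lbrakk>a \<in> carrier A; b \<in> carrier A\<rbrakk> \<Longrightarrow> nrm D (defect f a b) \<le> \<delta> * (nrm A a * nrm A b)"
    and small: "(2 * diag_bound + (diag_bound * (M + 1))\<^sup>2) * \<delta> \<le> 1/4"
      "2 * diag_bound * (M + 1) * \<delta> \<le> 1/8"
  obtains \<psi> where "unital_star_hom A D \<psi>"
    "\<And>x. x \<in> carrier A \<Longrightarrow> D.tends (\<lambda>n. (newton ^^ n) f x) (\<psi> x)"
proof -
  define L where "L = M + 1"
  \<comment> \<open>Bounds the first correction; the corrections decay like (1/2)^n, so together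
    they contribute at most 2 * r.\<close>
  define r where "r = diag_bound * L * \<delta>"
  define T where "T n = (newton ^^ n) f" for n
  have T0: "T 0 = f" and TS: "T (Suc n) = newton (T n)" for n by (simp_all add: T_def)
  have L: "0 \<le> L" "M \<le> L" using M by (auto simp: L_def)
  have r: "0 \<le> r" "2 * r \<le> 1/8" using diag_bound_nonneg L \<delta> small by (auto simp: r_def L_def)
  \<comment> \<open>The term 2 * r * (1 - (1/2)^n) is the sum of the bounds r * (1/2)^i of the first
    n corrections.\<close>
  have inv: "star_linear (T n) \<and> (\<forall>x\<in>carrier A. nrm D (T n x) \<le> (M + 2 * r * (1 - (1/2) ^ n)) * nrm A x) \<and>
     nrm D (T n \<one> \<ominus>\<^bsub>D\<^esub> \<one>\<^bsub>D\<^esub>) \<le> 1/8 + 2 * r * (1 - (1/2) ^ n) \<and>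
     (\<forall>a\<in>carrier A. \<forall>b\<in>carrier A. nrm D (defect (T n) a b) \<le> \<delta> * (1/2) ^ n * (nrm A a * nrm A b)) \<and>
     (\<forall>x\<in>carrier A. nrm D (sym_corr (T n) x) \<le> r * (1/2) ^ n * nrm A x)" (is "?P n") for n
  proof (induction n)
    \<comment> \<open>The last clause of \<open>?P n\<close> follows from the others, so it is
      derived once for both cases.\<close>
    have step: "?P n" if sl: "star_linear (T n)"
      and nb: "\<forall>x\<in>carrier A. nrm D (T n x) \<le> (M + 2 * r * (1 - (1/2) ^ n)) * nrm A x"
      and ob: "nrm D (T n \<one> \<ominus>\<^bsub>D\<^esub> \<one>\<^bsub>D\<^esub>) \<le> 1/8 + 2 * r * (1 - (1/2) ^ n)"
      and db: "\<forall>a\<in>carrier A. \<forall>b\<in>carrier A. nrm D (defect (T n) a b) \<le> \<delta> * (1/2) ^ n * (nrm A a * nrm A b)"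
      for n
    proof -
      have "M + 2 * r * (1 - (1/2) ^ n) \<le> L"
        using r mult_left_mono[of "1 - (1/2) ^ n" 1 "2 * r"] by (simp add: L_def)
      then have nb': "nrm D (T n x) \<le> L * nrm A x" if "x \<in> carrier A" for x
        using nb that nrm_nonneg[OF that] by (meson mult_right_mono order.trans)
      have "nrm D (sym_corr (T n) x) \<le> diag_bound * L * (\<delta> * (1/2) ^ n) * nrm A x" if "x \<in> carrier A" for x
        using sl nb' L db that by (intro sym_corr_nrm_le) auto
      then show ?thesis using that by (simp add: r_def mult_ac)
    qed
    case 0
    show ?case using f M one \<delta> by (intro step) (auto simp: T0)
    case (Suc n)
    define q :: real where "q = (1/2) ^ n"
    have q: "0 < q" "q \<le> 1" by (auto simp: q_def power_le_one)
    note sl = conjunct1[OF Suc]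
    have nb: "nrm D (T n x) \<le> (M + 2 * r * (1 - q)) * nrm A x" if "x \<in> carrier A" for x
      using Suc that by (simp add: q_def)
    have ob: "nrm D (T n \<one> \<ominus>\<^bsub>D\<^esub> \<one>\<^bsub>D\<^esub>) \<le> 1/8 + 2 * r * (1 - q)"
      using Suc by (simp add: q_def)
    have db: "nrm D (defect (T n) a b) \<le> \<delta> * q * (nrm A a * nrm A b)"
      if "a \<in> carrier A" "b \<in> carrier A" for a b
      using Suc that by (simp add: q_def)
    have sb: "nrm D (sym_corr (T n) x) \<le> r * q * nrm A x" if "x \<in> carrier A" for x
      using Suc that by (simp add: q_def)
    have rq: "2 * r * (1 - q) \<le> 2 * r" using r q by (simp add: mult_left_le)
    have Tc: "T n x \<in> carrier D" "sym_corr (T n) x \<in> carrier D" if "x \<in> carrier A" for x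
      using star_linearD(1)[OF sl] star_linearD(1)[OF sym_corr_linear[OF sl]] that by auto
    show "?P (Suc n)"
    proof (rule step)
      show "star_linear (T (Suc n))" using newton_linear sl by (simp add: TS)
      show "\<forall>x\<in>carrier A. nrm D (T (Suc n) x) \<le> (M + 2 * r * (1 - (1/2) ^ Suc n)) * nrm A x"
      proof
        fix x assume x: "x \<in> carrier A"
        have "nrm D (T (Suc n) x) \<le> nrm D (T n x) + nrm D (sym_corr (T n) x)"
          using Tc[OF x] by (simp add: TS newton_def D.nrm_triangle)
        also have "\<dots> \<le> (M + 2 * r * (1 - q)) * nrm A x + r * q * nrm A x"
          using nb[OF x] sb[OF x] by simp
        also have "\<dots> = (M + 2 * r * (1 - (1/2) ^ Suc n)) * nrm A x"
          by (simp add: q_def algebra_simps)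
        finally show "nrm D (T (Suc n) x) \<le> (M + 2 * r * (1 - (1/2) ^ Suc n)) * nrm A x" .
      qed
      have "T (Suc n) \<one> \<ominus>\<^bsub>D\<^esub> \<one>\<^bsub>D\<^esub> = (T n \<one> \<ominus>\<^bsub>D\<^esub> \<one>\<^bsub>D\<^esub>) \<oplus>\<^bsub>D\<^esub> sym_corr (T n) \<one>"
        using Tc[of \<one>] by (simp add: TS newton_def a_minus_def D.a_ac)
      then have "nrm D (T (Suc n) \<one> \<ominus>\<^bsub>D\<^esub> \<one>\<^bsub>D\<^esub>) \<le> nrm D (T n \<one> \<ominus>\<^bsub>D\<^esub> \<one>\<^bsub>D\<^esub>) + nrm D (sym_corr (T n) \<one>)"
        using Tc[of \<one>] by (simp add: D.nrm_triangle)
      also have "\<dots> \<le> (1/8 + 2 * r * (1 - q)) + r * q * 1"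
      proof -
        have "r * q * nrm A \<one> \<le> r * q * 1" using nrm_one_le r q by (intro mult_left_mono) auto
        then show ?thesis using ob sb[of \<one>] by simp
      qed
      also have "\<dots> = 1/8 + 2 * r * (1 - (1/2) ^ Suc n)"
        by (simp add: q_def algebra_simps)
      finally show "nrm D (T (Suc n) \<one> \<ominus>\<^bsub>D\<^esub> \<one>\<^bsub>D\<^esub>) \<le> 1/8 + 2 * r * (1 - (1/2) ^ Suc n)" .
      show "\<forall>a\<in>carrier A. \<forall>b\<in>carrier A. nrm D (defect (T (Suc n)) a b) \<le> \<delta> * (1/2) ^ Suc n * (nrm A a * nrm A b)"
      proof (intro ballI)
        fix a b assume ab: "a \<in> carrier A" "b \<in> carrier A"
        have bound: "nrm D (T n x) \<le> L * nrm A x" if x: "x \<in> carrier A" for x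
        proof -
          have "M + 2 * r * (1 - q) \<le> L" using rq r by (simp add: L_def)
          then show ?thesis using nb[OF x] nrm_nonneg[OF x] by (meson mult_right_mono order.trans)
        qed
        have \<eta>: "nrm D (T n \<one> \<ominus>\<^bsub>D\<^esub> \<one>\<^bsub>D\<^esub>) \<le> 1/4" using ob rq r by linarith
        have "nrm D (defect (newton (T n)) a b)
          \<le> ((2 * diag_bound * (\<delta> * q) + 1/4) * (\<delta> * q) + (diag_bound * L * (\<delta> * q))\<^sup>2) * (nrm A a * nrm A b)"
          using q \<delta>(1) by (intro newton_defect_le sl bound L db \<eta> ab) auto
        \<comment> \<open>The quadratic terms contribute a factor 1/4 by \<open>small(1)\<close> and
          the error at the unit another 1/4.\<close>
        also have "\<dots> \<le> (\<delta> * (q / 2)) * (nrm A a * nrm A b)"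
        proof (rule mult_right_mono)
          have "(2 * diag_bound + (diag_bound * L)\<^sup>2) * (\<delta> * q)
            \<le> (2 * diag_bound + (diag_bound * L)\<^sup>2) * \<delta>"
            using q \<delta>(1) diag_bound_nonneg by (intro mult_left_mono) (auto simp: mult_left_le)
          also have "\<dots> \<le> 1/4" using small(1) by (simp add: L_def)
          finally have "((2 * diag_bound + (diag_bound * L)\<^sup>2) * (\<delta> * q) + 1/4) * (\<delta> * q) \<le> 1/2 * (\<delta> * q)"
            using q \<delta>(1) by (intro mult_right_mono) auto
          then show "(2 * diag_bound * (\<delta> * q) + 1/4) * (\<delta> * q) + (diag_bound * L * (\<delta> * q))\<^sup>2 \<le> \<delta> * (q / 2)"
            by (simp add: power2_eq_square algebra_simps)
        qed (use nrm_nonneg ab in auto)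
        finally show "nrm D (defect (T (Suc n)) a b) \<le> \<delta> * (1/2) ^ Suc n * (nrm A a * nrm A b)"
          by (simp add: TS q_def)
      qed
    qed
  qed
  have sl: "star_linear (T n)" for n using inv by blast
  note TD = star_linearD[OF sl]
  have "\<exists>l. D.tends (\<lambda>n. T n x) l" if x: "x \<in> carrier A" for x
  proof (rule D.geometric_tends)
    show "T n x \<in> carrier D" for n using TD x by simp
    have Hc: "sym_corr (T n) x \<in> carrier D" for n using star_linearD(1)[OF sym_corr_linear[OF sl]] x by simp
    have "T (Suc n) x \<ominus>\<^bsub>D\<^esub> T n x = sym_corr (T n) x" for n
      using TD(1)[OF x, of n] Hc[of n] unfolding TS newton_def by algebra
    then show "nrm D (T (Suc n) x \<ominus>\<^bsub>D\<^esub> T n x) \<le> (r * nrm A x) * (1/2) ^ n" for n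
      using inv[of n] x by (simp add: mult_ac)
  qed auto
  then obtain \<psi> where \<psi>: "\<And>x. x \<in> carrier A \<Longrightarrow> D.tends (\<lambda>n. T n x) (\<psi> x)" by metis
  have \<psi>c: "\<psi> x \<in> carrier D" if "x \<in> carrier A" for x using \<psi>[OF that] by (simp add: D.tends_def)
  have add: "\<psi> (x \<oplus> y) = \<psi> x \<oplus>\<^bsub>D\<^esub> \<psi> y" if "x \<in> carrier A" "y \<in> carrier A" for x y
    using D.tends_unique[OF \<psi>[of "x \<oplus> y"]] D.tends_add[OF \<psi>[of x] \<psi>[of y]] that TD by simp
  have smult: "\<psi> (c \<odot> x) = c \<odot>\<^bsub>D\<^esub> \<psi> x" if "x \<in> carrier A" for x c
    using D.tends_unique[OF \<psi>[of "c \<odot> x"]] D.tends_smult[OF \<psi>[of x]] that TD by simp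
  have star: "\<psi> (adj A x) = adj D (\<psi> x)" if "x \<in> carrier A" for x
    using D.tends_unique[OF \<psi>[of "adj A x"]] D.tends_adj[OF \<psi>[of x]] that TD by simp
  have mult: "\<psi> (x \<otimes> y) = \<psi> x \<otimes>\<^bsub>D\<^esub> \<psi> y" if xy: "x \<in> carrier A" "y \<in> carrier A" for x y
  proof -
    have 1: "D.tends (\<lambda>n. defect (T n) x y) (\<psi> (x \<otimes> y) \<ominus>\<^bsub>D\<^esub> \<psi> x \<otimes>\<^bsub>D\<^esub> \<psi> y)"
      unfolding defect_def using xy by (intro D.tends_diff D.tends_mult \<psi>) auto
    have 2: "D.tends (\<lambda>n. defect (T n) x y) \<zero>\<^bsub>D\<^esub>"
    proof (rule D.tends_bound)
      have "(\<lambda>n. \<delta> * (1/2) ^ n * (nrm A x * nrm A y)) \<longlonglongrightarrow> \<delta> * 0 * (nrm A x * nrm A y)"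
        by (intro tendsto_intros LIMSEQ_realpow_zero) auto
      then show "(\<lambda>n. \<delta> * (1/2) ^ n * (nrm A x * nrm A y)) \<longlonglongrightarrow> 0" by simp
      show "nrm D (defect (T n) x y \<ominus>\<^bsub>D\<^esub> \<zero>\<^bsub>D\<^esub>) \<le> \<delta> * (1/2) ^ n * (nrm A x * nrm A y)" for n
        using inv[of n] xy sl[of n] by (simp add: a_minus_def)
    qed (use sl xy in auto)
    show ?thesis using D.tends_unique[OF 1 2] xy \<psi>c by (simp add: D.minus_eq_zero_iff)
  qed
  have one: "\<psi> \<one> = \<one>\<^bsub>D\<^esub>"
  proof -
    \<comment> \<open>This \<open>e\<close> is an idempotent of norm at most 1/4, so its norm is at
      most a quarter of itself, hence 0.\<close>
    define e where "e = \<one>\<^bsub>D\<^esub> \<ominus>\<^bsub>D\<^esub> \<psi> \<one>"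
    have e: "e \<in> carrier D" using \<psi>c by (simp add: e_def)
    have pp: "\<psi> \<one> \<otimes>\<^bsub>D\<^esub> \<psi> \<one> = \<psi> \<one>" using mult[of \<one> \<one>] by simp
    have ee: "e \<otimes>\<^bsub>D\<^esub> e = e"
      using \<psi>c[of \<one>] pp by (simp add: e_def a_minus_def D.l_distr D.r_distr D.l_minus D.r_minus D.minus_add D.l_neg)
    have "D.tends (\<lambda>n. \<one>\<^bsub>D\<^esub> \<ominus>\<^bsub>D\<^esub> T n \<one>) e"
      unfolding e_def by (intro D.tends_diff D.tends_const \<psi>) auto
    moreover have "nrm D (\<one>\<^bsub>D\<^esub> \<ominus>\<^bsub>D\<^esub> T n \<one>) \<le> 1/4" for n
    proof -
      have "2 * r * (1 - (1/2) ^ n) \<le> 2 * r" using r by (simp add: mult_left_le power_le_one)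
      then show ?thesis using inv[of n] r TD(1)[of \<one> n] D.nrm_diff_commute[of "\<one>\<^bsub>D\<^esub>" "T n \<one>"] by auto
    qed
    ultimately have "nrm D e \<le> 1/4" by (rule D.tends_nrm_le)
    moreover have "nrm D e \<le> nrm D e * nrm D e" using D.nrm_mult[OF e e] ee by simp
    moreover have "nrm D e * nrm D e \<le> 1/4 * nrm D e"
      using calculation(1) D.nrm_nonneg[OF e] by (intro mult_right_mono)
    ultimately have "nrm D e = 0" using D.nrm_nonneg[OF e] by linarith
    then have "e = \<zero>\<^bsub>D\<^esub>" using D.nrm_eq_0_iff e by blast
    then show ?thesis using \<psi>c[of \<one>] D.minus_eq_zero_iff[of "\<one>\<^bsub>D\<^esub>" "\<psi> \<one>"] by (simp add: e_def)
  qed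
  have "unital_star_hom A D \<psi>"
    unfolding unital_star_hom_def ring_hom_def using \<psi>c add smult star mult one by auto
  then show ?thesis using that \<psi> by (simp add: T_def)
qed

end

section \<open>Boundedness of linear maps\<close>

context banach_star_algebra
begin

text \<open>
  The induction adds one vector at a time: completeness of the coordinates keeps the new vector at a positive
  distance from the span of the old ones.
\<close>

lemma lin_independent_coeff_bound:
  "lin_independent B \<Longrightarrow> \<exists>K\<ge>0. \<forall>c. \<forall>b\<in>B. cmod (c b) \<le> K * nrm A (lincomb c B)"
proof -
  assume "lin_independent B"
  then have "finite B" by (simp add: lin_independent_def)
  then show ?thesis using \<open>lin_independent B\<close>
  proof (induction B rule: finite_induct)
    case empty
    show ?case by (intro exI[of _ 0]) auto
  next
    case (insert b0 B)
    have sub: "B \<subseteq> carrier A" "b0 \<in> carrier A" using insert.prems by (auto simp: lin_independent_def)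
    have li: "lincomb c (insert b0 B) = c b0 \<odot> b0 \<oplus> lincomb c B" for c
      using insert sub by (intro lincomb_insert) auto
    have ind: "lin_independent B"
      unfolding lin_independent_def
    proof (intro conjI allI impI ballI)
      fix c b assume c: "lincomb c B = \<zero>" and b: "b \<in> B"
      let ?c = "c(b0 := 0)"
      have "lincomb ?c B = lincomb c B" using sub insert.hyps by (intro lincomb_cong) auto
      then have "lincomb ?c (insert b0 B) = \<zero>" using c sub by (simp add: li)
      then have "?c b = 0" using insert.prems b unfolding lin_independent_def by blast
      then show "c b = 0" using b insert.hyps by (auto split: if_splits)
    qed (use insert.hyps sub in auto)
    obtain K where K: "K \<ge> 0" "\<And>c b. b \<in> B \<Longrightarrow> cmod (c b) \<le> K * nrm A (lincomb c B)"
      using insert.IH[OF ind] by blast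
    \<comment> \<open>Otherwise some combinations of \<open>B\<close> approach \<open>- b0\<close>.
      By the bound \<open>K\<close> their coefficients are Cauchy, and the limiting coefficients
      give a dependency in which \<open>b0\<close> has coefficient 1.\<close>
    have "\<exists>\<rho>>0. \<forall>c. \<rho> \<le> nrm A (b0 \<oplus> lincomb c B)"
    proof (rule ccontr)
      assume neg: "\<not> ?thesis"
      have "\<exists>c. nrm A (b0 \<oplus> lincomb c B) < inverse (real (Suc n))" for n
      proof -
        have "(0::real) < inverse (real (Suc n))" by simp
        then show ?thesis using neg by (meson not_less)
      qed
      then obtain c where c: "\<And>n. nrm A (b0 \<oplus> lincomb (c n) B) < inverse (real (Suc n))" by metis
      have "Cauchy (\<lambda>n. c n b)" if b: "b \<in> B" for b
      proof (rule metric_CauchyI)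
        fix e :: real assume e: "e > 0"
        obtain N where N: "inverse (real (Suc N)) < e / (2 * (K + 1))"
          using reals_Archimedean[of "e / (2 * (K + 1))"] e K(1) by auto
        have "dist (c m b) (c n b) < e" if mn: "m \<ge> N" "n \<ge> N" for m n
        proof -
          have inv: "nrm A (b0 \<oplus> lincomb (c k) B) \<le> e / (2 * (K + 1))" if "k \<ge> N" for k
          proof -
            have "inverse (real (Suc k)) \<le> inverse (real (Suc N))"
              using that by (intro le_imp_inverse_le) auto
            then show ?thesis using c[of k] N by linarith
          qed
          have "lincomb (\<lambda>b. c m b - c n b) B = (b0 \<oplus> lincomb (c m) B) \<ominus> (b0 \<oplus> lincomb (c n) B)"
          proof -
            have "(b0 \<oplus> x) \<ominus> (b0 \<oplus> y) = x \<ominus> y" if "x \<in> carrier A" "y \<in> carrier A" for x y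
              using that sub(2) by algebra
            then show ?thesis using lincomb_diff[OF insert.hyps(1) sub(1), of "c m" "c n"] sub(1) by simp
          qed
          then have "nrm A (lincomb (\<lambda>b. c m b - c n b) B)
            \<le> nrm A (b0 \<oplus> lincomb (c m) B) + nrm A (b0 \<oplus> lincomb (c n) B)"
            using nrm_diff_le sub by simp
          also have "\<dots> \<le> e / (2 * (K + 1)) + e / (2 * (K + 1))"
            using inv mn by (intro add_mono) auto
          also have "\<dots> = e / (K + 1) / 2 + e / (K + 1) / 2" by (simp add: mult.commute)
          also have "\<dots> = e / (K + 1)" by (rule field_sum_of_halves)
          finally have "nrm A (lincomb (\<lambda>b. c m b - c n b) B) \<le> e / (K + 1)" .
          then have "K * nrm A (lincomb (\<lambda>b. c m b - c n b) B) \<le> K * (e / (K + 1))"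
            using K(1) by (intro mult_left_mono) auto
          then have "cmod (c m b - c n b) \<le> K * (e / (K + 1))"
            using K(2)[OF b, of "\<lambda>b. c m b - c n b"] by simp
          also have "\<dots> < e" using K(1) e by (simp add: field_simps)
          finally show ?thesis by (simp add: dist_norm)
        qed
        then show "\<exists>M. \<forall>m\<ge>M. \<forall>n\<ge>M. dist (c m b) (c n b) < e" by blast
      qed
      then have "\<exists>l. (\<lambda>n. c n b) \<longlonglongrightarrow> l" if "b \<in> B" for b
        using that Cauchy_convergent_iff convergent_def by blast
      then obtain d where d: "\<And>b. b \<in> B \<Longrightarrow> (\<lambda>n. c n b) \<longlonglongrightarrow> d b" by metis
      have "(\<lambda>n. \<Sum>b\<in>B. cmod (d b - c n b) * nrm A b) \<longlonglongrightarrow> (\<Sum>b\<in>B. cmod (d b - d b) * nrm A b)"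
        using d by (intro tendsto_intros) auto
      then have "(\<lambda>n. inverse (real (Suc n)) + (\<Sum>b\<in>B. cmod (d b - c n b) * nrm A b)) \<longlonglongrightarrow> 0 + 0"
        by (intro tendsto_add LIMSEQ_inverse_real_of_nat) simp
      moreover have "nrm A (b0 \<oplus> lincomb d B) \<le> inverse (real (Suc n)) + (\<Sum>b\<in>B. cmod (d b - c n b) * nrm A b)" for n
      proof -
        have "lincomb d B = lincomb (c n) B \<oplus> lincomb (\<lambda>b. d b - c n b) B"
          using insert.hyps(1) sub(1) by (simp add: lincomb_add)
        then have "b0 \<oplus> lincomb d B = (b0 \<oplus> lincomb (c n) B) \<oplus> lincomb (\<lambda>b. d b - c n b) B"
          using sub by (simp add: a_assoc)
        then have "nrm A (b0 \<oplus> lincomb d B) \<le> nrm A (b0 \<oplus> lincomb (c n) B) + nrm A (lincomb (\<lambda>b. d b - c n b) B)"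
          using sub by (simp add: nrm_triangle)
        also have "\<dots> \<le> inverse (real (Suc n)) + (\<Sum>b\<in>B. cmod (d b - c n b) * nrm A b)"
          using c[of n] insert.hyps sub by (intro add_mono nrm_lincomb_le) auto
        finally show ?thesis .
      qed
      ultimately have "nrm A (b0 \<oplus> lincomb d B) \<le> 0" by (intro LIMSEQ_le_const) auto
      then have z: "b0 \<oplus> lincomb d B = \<zero>"
        using nrm_nonneg[of "b0 \<oplus> lincomb d B"] nrm_eq_0_iff[of "b0 \<oplus> lincomb d B"] sub by simp
      let ?d = "d(b0 := 1)"
      have "lincomb ?d B = lincomb d B" using sub insert.hyps by (intro lincomb_cong) auto
      then have "lincomb ?d (insert b0 B) = \<zero>" using z sub by (simp add: li)
      then have "?d b0 = 0" using insert.prems unfolding lin_independent_def by blast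
      then show False by simp
    qed
    then obtain \<rho> where \<rho>: "\<rho> > 0" "\<And>c. \<rho> \<le> nrm A (b0 \<oplus> lincomb c B)" by blast
    have c0: "cmod (c b0) \<le> inverse \<rho> * nrm A (lincomb c (insert b0 B))" for c
    proof (cases "c b0 = 0")
      case True
      then show ?thesis using \<rho>(1) sub nrm_nonneg by simp
    next
      case False
      have "c b0 \<odot> (b0 \<oplus> lincomb (\<lambda>b. inverse (c b0) * c b) B) = lincomb c (insert b0 B)"
      proof -
        have "(\<lambda>b. c b0 * (inverse (c b0) * c b)) = c" using False by (auto simp: field_simps)
        then show ?thesis using sub insert.hyps by (simp add: li smult_add_right lincomb_smult)
      qed
      then have "nrm A (lincomb c (insert b0 B)) = cmod (c b0) * nrm A (b0 \<oplus> lincomb (\<lambda>b. inverse (c b0) * c b) B)"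
        using sub by (metis nrm_smult lincomb_closed add.m_closed)
      also have "\<dots> \<ge> cmod (c b0) * \<rho>" using \<rho>(2) by (intro mult_left_mono) auto
      finally show ?thesis using \<rho>(1) by (simp add: field_simps)
    qed
    \<comment> \<open>The coefficient of \<open>b0\<close> is bounded by 1/\<rho> times the norm;
      the others by \<open>K\<close> times the norm of what remains after \<open>b0\<close> has been
      subtracted with that coefficient.\<close>
    define K' where "K' = inverse \<rho> + K * (1 + inverse \<rho> * nrm A b0)"
    have K'0: "K' \<ge> 0" using K(1) \<rho>(1) sub nrm_nonneg by (simp add: K'_def)
    have "cmod (c b) \<le> K' * nrm A (lincomb c (insert b0 B))" if b: "b \<in> insert b0 B" for c b
    proof -
      let ?n = "nrm A (lincomb c (insert b0 B))"
      have n0: "0 \<le> ?n" using sub nrm_nonneg by simp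
      have K2: "K * (1 + inverse \<rho> * nrm A b0) \<ge> 0" using K(1) \<rho>(1) sub nrm_nonneg by simp
      show ?thesis
      proof (cases "b = b0")
        case True
        have "inverse \<rho> * ?n \<le> K' * ?n" using K2 n0 by (intro mult_right_mono) (auto simp: K'_def)
        then show ?thesis using c0[of c] True by simp
      next
        case False
        have "lincomb c B = lincomb c (insert b0 B) \<ominus> c b0 \<odot> b0"
        proof -
          have "(x \<oplus> y) \<ominus> x = y" if "x \<in> carrier A" "y \<in> carrier A" for x y
            using that by algebra
          then show ?thesis using sub by (simp add: li)
        qed
        then have "nrm A (lincomb c B) \<le> ?n + cmod (c b0) * nrm A b0"
          using nrm_diff_le[of "lincomb c (insert b0 B)" "c b0 \<odot> b0"] sub by (simp add: nrm_smult)
        also have "\<dots> \<le> ?n + inverse \<rho> * ?n * nrm A b0"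
          using c0[of c] sub nrm_nonneg by (intro add_left_mono mult_right_mono) auto
        also have "\<dots> = (1 + inverse \<rho> * nrm A b0) * ?n" by (simp add: algebra_simps)
        finally have "K * nrm A (lincomb c B) \<le> K * ((1 + inverse \<rho> * nrm A b0) * ?n)"
          using K(1) by (intro mult_left_mono)
        also have "\<dots> \<le> K' * ?n"
          using n0 \<rho>(1) by (simp add: K'_def algebra_simps)
        finally show ?thesis using K(2)[of b c] b False by simp
      qed
    qed
    then show ?case using K'0 by blast
  qed
qed

end

section \<open>Bounds that depend only on the basis\<close>

context fd_cstar_algebra
begin

lemma coord_bound_exists: "\<exists>K\<ge>0. \<forall>x\<in>carrier A. \<forall>b\<in>B. cmod (coord B x b) \<le> K * nrm A x"
  using lin_independent_coeff_bound[OF lin_independent_B] lincomb_coord[OF spans_B] by metis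

definition coord_bound :: real where
  "coord_bound = (SOME K. 0 \<le> K \<and> (\<forall>x\<in>carrier A. \<forall>b\<in>B. cmod (coord B x b) \<le> K * nrm A x))"

text \<open>Converts a bound on the basis vectors into a bound on the operator norm. It involves
  only \<open>A\<close> and its basis, so it is available before a quotient of \<open>C\<close> is
  chosen.\<close>

definition linear_bound :: real where
  "linear_bound = card B * coord_bound"

lemma coord_bound_nonneg: "0 \<le> coord_bound"
  and coord_bound: "\<lbrakk>x \<in> carrier A; b \<in> B\<rbrakk> \<Longrightarrow> cmod (coord B x b) \<le> coord_bound * nrm A x"
  using someI_ex[OF coord_bound_exists] unfolding coord_bound_def[symmetric] by auto

lemma linear_bound_nonneg: "0 \<le> linear_bound"
  by (simp add: linear_bound_def coord_bound_nonneg)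

lemma nrm_linear_le:
  assumes D: "star_normed_algebra D" and f: "clinear_map A D f" and e: "0 \<le> e"
    and fb: "\<And>b. b \<in> B \<Longrightarrow> nrm D (f b) \<le> e" and x: "x \<in> carrier A"
  shows "nrm D (f x) \<le> linear_bound * e * nrm A x"
proof -
  interpret D: star_normed_algebra D by fact
  note fD = clinear_mapD[OF f]
  have "nrm D (f (lincomb (coord B x) B)) \<le> (\<Sum>b\<in>B. nrm D (coord B x b \<odot>\<^bsub>D\<^esub> f b))"
    unfolding clinear_map_lincomb[OF star_normed_algebra_axioms D f finite_B B_subset]
    using fD finite_B by (intro D.nrm_finsum_le) auto
  also have "\<dots> \<le> (\<Sum>b\<in>B. (coord_bound * nrm A x) * e)"
  proof (rule sum_mono)
    fix b assume b: "b \<in> B"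
    have "nrm D (coord B x b \<odot>\<^bsub>D\<^esub> f b) = cmod (coord B x b) * nrm D (f b)"
      using b fD by (simp add: D.nrm_smult)
    also have "\<dots> \<le> (coord_bound * nrm A x) * e"
      using coord_bound coord_bound_nonneg x b fb e fD nrm_nonneg D.nrm_nonneg by (intro mult_mono) auto
    finally show "nrm D (coord B x b \<odot>\<^bsub>D\<^esub> f b) \<le> (coord_bound * nrm A x) * e" .
  qed
  finally show ?thesis
    using lincomb_coord[OF spans_B x] by (simp add: linear_bound_def mult_ac)
qed

lemma linear_bounded:
  assumes D: "star_normed_algebra D" and f: "clinear_map A D f"
  obtains K where "K \<ge> 0" "\<And>x. x \<in> carrier A \<Longrightarrow> nrm D (f x) \<le> K * nrm A x"
proof -
  interpret D: star_normed_algebra D by fact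
  define e where "e = (\<Sum>b\<in>B. nrm D (f b))"
  have nn: "0 \<le> nrm D (f b)" if "b \<in> B" for b using that f by (simp add: clinear_mapD D.nrm_nonneg)
  have "nrm D (f b) \<le> e" if "b \<in> B" for b
    using that finite_B nn unfolding e_def by (intro member_le_sum) auto
  moreover have "0 \<le> e" using nn by (auto simp: e_def intro: sum_nonneg)
  ultimately show ?thesis
    using that[of "linear_bound * e"] nrm_linear_le[OF D f, of e] linear_bound_nonneg by simp
qed

end

section \<open>Averaging over a group of isometries\<close>

text \<open>
  The abstract form of the averaging argument; it replaces the Haar measure. Nothing is known
  about \<open>avg n s\<close> beyond what the arithmetic mean of \<open>s 0, \<dots>, s (n - 1)\<close> in a normed space satisfies.
\<close>

locale isometric_averaging = group G
  for G :: "('g, 'k) monoid_scheme" (structure) +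
  fixes M :: "'v set" and d :: "'v \<Rightarrow> 'v \<Rightarrow> real" and act :: "'g \<Rightarrow> 'v \<Rightarrow> 'v"
    and avg :: "nat \<Rightarrow> (nat \<Rightarrow> 'v) \<Rightarrow> 'v"
  assumes nonempty: "M \<noteq> {}"
    and d_nonneg: "\<lbrakk>x \<in> M; y \<in> M\<rbrakk> \<Longrightarrow> 0 \<le> d x y"
    and d_commute: "\<lbrakk>x \<in> M; y \<in> M\<rbrakk> \<Longrightarrow> d x y = d y x"
    and d_triangle: "\<lbrakk>x \<in> M; y \<in> M; z \<in> M\<rbrakk> \<Longrightarrow> d x z \<le> d x y + d y z"
    and complete: "\<lbrakk>\<And>n. s n \<in> M; \<And>n. d (s (Suc n)) (s n) \<le> (1/2) ^ n\<rbrakk>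
      \<Longrightarrow> \<exists>l\<in>M. (\<lambda>n. d (s n) l) \<longlonglongrightarrow> 0"
    and act_closed: "\<lbrakk>g \<in> carrier G; x \<in> M\<rbrakk> \<Longrightarrow> act g x \<in> M"
    and act_isometry: "\<lbrakk>g \<in> carrier G; x \<in> M; y \<in> M\<rbrakk> \<Longrightarrow> d (act g x) (act g y) = d x y"
    and act_mult: "\<lbrakk>g \<in> carrier G; h \<in> carrier G; x \<in> M\<rbrakk> \<Longrightarrow> act (g \<otimes> h) x = act g (act h x)"
    and avg_closed: "\<lbrakk>0 < n; \<And>i. s i \<in> M\<rbrakk> \<Longrightarrow> avg n s \<in> M"
    and avg_dist: "\<lbrakk>0 < n; \<And>i. s i \<in> M; \<And>i. t i \<in> M\<rbrakk>
      \<Longrightarrow> d (avg n s) (avg n t) \<le> (\<Sum>i<n. d (s i) (t i)) / n"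
    and avg_const: "\<lbrakk>0 < n; y \<in> M\<rbrakk> \<Longrightarrow> d y (avg n (\<lambda>i. y)) = 0"
    and act_avg: "\<lbrakk>0 < n; g \<in> carrier G; \<And>i. s i \<in> M\<rbrakk> \<Longrightarrow> act g (avg n s) = avg n (\<lambda>i. act g (s i))"
    and finite_net: "\<lbrakk>finite F; F \<subseteq> M; 0 < e\<rbrakk> \<Longrightarrow>
      \<exists>H. finite H \<and> H \<subseteq> carrier G \<and> (\<forall>g\<in>carrier G. \<exists>h\<in>H. \<forall>v\<in>F. d (act g v) (act h v) \<le> e)"
begin

definition oscillation_le :: "'v \<Rightarrow> real \<Rightarrow> bool" where
  "oscillation_le w D \<longleftrightarrow> (\<forall>k\<in>carrier G. d (act k w) w \<le> D)"

lemma d_avg_le: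
  assumes "0 < n" "y \<in> M" "\<And>i. x i \<in> M"
  shows "d y (avg n x) \<le> (\<Sum>i<n. d y (x i)) / n"
proof -
  have "d y (avg n x) \<le> d y (avg n (\<lambda>i. y)) + d (avg n (\<lambda>i. y)) (avg n x)"
    using assms by (intro d_triangle avg_closed) auto
  also have "\<dots> \<le> 0 + (\<Sum>i<n. d y (x i)) / n"
    using assms by (intro add_mono avg_dist) (auto simp: avg_const)
  finally show ?thesis by simp
qed

lemma mean_le:
  assumes "0 < (n::nat)" "\<And>i. i < n \<Longrightarrow> f i \<le> (c::real)"
  shows "(\<Sum>i<n. f i) / n \<le> c"
proof -
  have "(\<Sum>i<n. f i) \<le> (\<Sum>i<n. c)" using assms by (intro sum_mono) auto
  then show ?thesis using assms(1) by (simp add: divide_le_eq mult.commute)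
qed

lemma d_triangle4:
  assumes "x \<in> M" "y \<in> M" "z \<in> M" "w \<in> M"
  shows "d x w \<le> d x y + (d y z + d z w)"
  using d_triangle[of x y w] d_triangle[of y z w] assms by linarith

lemma d_act_inv:
  assumes "g \<in> carrier G" "x \<in> M" "k \<in> carrier G" "y \<in> M"
  shows "d (act k y) (act g x) = d (act (inv g \<otimes> k) y) x"
proof -
  have "act k y = act g (act (inv g \<otimes> k) y)"
    using assms by (simp flip: act_mult add: inv_solve_left' m_assoc[symmetric])
  then show ?thesis using assms by (simp add: act_isometry act_closed)
qed

lemma oscillation_le_pair:
  assumes "oscillation_le w D" "g \<in> carrier G" "k \<in> carrier G" "w \<in> M"
  shows "d (act k w) (act g w) \<le> D"
  using assms by (simp add: d_act_inv oscillation_le_def)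

text \<open>The net is uniform over all translates \<open>act k v\<close>; this is inherited by averages of them.\<close>

lemma uniform_net:
  assumes v: "v \<in> M" and e: "0 < e"
  obtains N h where "0 < (N::nat)" "\<And>i. h i \<in> carrier G"
    "\<And>g. g \<in> carrier G \<Longrightarrow> \<exists>i<N. \<forall>k\<in>carrier G. d (act (g \<otimes> k) v) (act (h i \<otimes> k) v) \<le> e"
proof -
  \<comment> \<open>First the orbit of \<open>v\<close> is approximated by finitely many translates,
    then the net \<open>H\<close> is taken for these; replacing a translate, switching the group
    element and replacing back cost e/3 each.\<close>
  obtain K where K: "finite K" "K \<subseteq> carrier G" "\<forall>g\<in>carrier G. \<exists>k\<in>K. \<forall>u\<in>{v}. d (act g u) (act k u) \<le> e/3"
    using finite_net[of "{v}" "e/3"] v e by auto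
  define F where "F = (\<lambda>k. act k v) ` K"
  have F: "finite F" "F \<subseteq> M" using K v act_closed by (auto simp: F_def)
  obtain H where H: "finite H" "H \<subseteq> carrier G" "\<forall>g\<in>carrier G. \<exists>h\<in>H. \<forall>u\<in>F. d (act g u) (act h u) \<le> e/3"
    using finite_net[OF F, of "e/3"] e by auto
  have Hne: "H \<noteq> {}" using H(3) by blast
  define N where "N = card H"
  have N: "0 < N" using H(1) Hne by (simp add: N_def card_gt_0_iff)
  obtain h0 where h0: "bij_betw h0 {0..<N} H" using ex_bij_betw_nat_finite[OF H(1)] by (auto simp: N_def)
  \<comment> \<open>\<open>avg\<close> takes a sequence indexed by all naturals, so the enumeration
    is padded with \<open>\<one>\<close>.\<close>
  define h where "h i = (if i < N then h0 i else \<one>)" for i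
  have hG: "h i \<in> carrier G" for i
    using h0 H(2) by (auto simp: h_def bij_betw_def)
  show ?thesis
  proof (rule that[OF N hG])
    fix g assume g: "g \<in> carrier G"
    then obtain h' where h': "h' \<in> H" "\<forall>u\<in>F. d (act g u) (act h' u) \<le> e/3" using H(3) by blast
    then obtain i where i: "i < N" "h i = h'" using h0 by (auto simp: h_def bij_betw_def)
    have "d (act (g \<otimes> k) v) (act (h i \<otimes> k) v) \<le> e" if k: "k \<in> carrier G" for k
    proof -
      obtain k' where k': "k' \<in> K" "d (act k v) (act k' v) \<le> e/3" using K(3) k by blast
      have kG: "k' \<in> carrier G" using k' K(2) by blast
      let ?x = "act k v" and ?x' = "act k' v"
      have xM: "?x \<in> M" "?x' \<in> M" using v k kG act_closed by auto
      have "d (act g ?x) (act (h i) ?x)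
        \<le> d (act g ?x) (act g ?x') + (d (act g ?x') (act (h i) ?x') + d (act (h i) ?x') (act (h i) ?x))"
        by (intro d_triangle4 act_closed hG g xM)
      also have "\<dots> \<le> e/3 + (e/3 + e/3)"
        using xM g hG k' h'(2) i by (intro add_mono) (auto simp: act_isometry F_def d_commute[of ?x' ?x])
      finally show ?thesis using v g hG k by (simp add: act_mult)
    qed
    then show "\<exists>i<N. \<forall>k\<in>carrier G. d (act (g \<otimes> k) v) (act (h i \<otimes> k) v) \<le> e" using i by blast
  qed
qed

text \<open>The point is averaged repeatedly over the same N group elements of a uniform net. Each
  translate of a point is within e/2 of one of the N averaged translates, so an average reduces the
  part of the oscillation above e/2 by the factor 1 - 1/N. The net property is inherited by the
  averages, which keeps N and the factor fixed.\<close>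

lemma small_oscillation:
  assumes v: "v \<in> M" and D: "oscillation_le v D" "0 \<le> D" and e: "0 < e"
  shows "\<exists>w\<in>M. oscillation_le w e \<and> d w v \<le> 2 * D"
proof -
  obtain N h where N: "0 < (N::nat)" and h: "\<And>i. h i \<in> carrier G"
    and net: "\<And>g. g \<in> carrier G \<Longrightarrow> \<exists>i<N. \<forall>k\<in>carrier G. d (act (g \<otimes> k) v) (act (h i \<otimes> k) v) \<le> e/2"
    using uniform_net[OF v, of "e/2"] e by auto
  define P where "P w = avg N (\<lambda>i. act (h i) w)" for w
  define q where "q = 1 - 1 / real N"
  have q: "0 \<le> q" "q < 1" using N by (auto simp: q_def)
  define w where "w n = (P ^^ n) v" for n
  have w0: "w 0 = v" and wS: "w (Suc n) = P (w n)" for n by (simp_all add: w_def)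
  have inv: "w n \<in> M \<and> oscillation_le (w n) (e/2 + q ^ n * D)
     \<and> (\<forall>g\<in>carrier G. \<exists>i<N. \<forall>k\<in>carrier G. d (act (g \<otimes> k) (w n)) (act (h i \<otimes> k) (w n)) \<le> e/2)
     \<and> (\<forall>k\<in>carrier G. d (act k v) (w n) \<le> D)" for n
  proof (induction n)
    case 0
    show ?case using v D e net by (auto simp: w0 oscillation_le_def intro: add_increasing)
  next
    case (Suc n)
    define u where "u = w n"
    define B where "B = e/2 + q ^ n * D"
    have u: "u \<in> M" "oscillation_le u B"
      and unet: "\<And>g. g \<in> carrier G \<Longrightarrow> \<exists>i<N. \<forall>k\<in>carrier G. d (act (g \<otimes> k) u) (act (h i \<otimes> k) u) \<le> e/2"
      and uv: "\<And>k. k \<in> carrier G \<Longrightarrow> d (act k v) u \<le> D"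
      using Suc by (auto simp: u_def B_def)
    have au: "act g u \<in> M" if "g \<in> carrier G" for g using act_closed u that by blast
    have Pu: "P u \<in> M" unfolding P_def using N h au by (intro avg_closed) auto
    have near: "d (act k u) (P u) \<le> e/2 + q ^ Suc n * D" if k: "k \<in> carrier G" for k
    proof -
      obtain i0 where i0: "i0 < N" "d (act (k \<otimes> \<one>) u) (act (h i0 \<otimes> \<one>) u) \<le> e/2"
        using unet[OF k] one_closed by blast
      have "d (act k u) (P u) \<le> (\<Sum>i<N. d (act k u) (act (h i) u)) / N"
        unfolding P_def using N h au k by (intro d_avg_le) auto
      \<comment> \<open>The index \<open>i0\<close> contributes at most e/2, every other index at
        most the current oscillation bound.\<close>
      also have "(\<Sum>i<N. d (act k u) (act (h i) u)) \<le> (\<Sum>i<N. if i = i0 then e/2 else B)"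
        using i0 k h u by (intro sum_mono) (auto simp: oscillation_le_pair)
      also have "\<dots> = e/2 + (N - 1) * B"
        using i0(1) by (simp add: sum.If_cases Int_absorb1 card_Diff_singleton Compl_eq_Diff_UNIV[symmetric]
            Diff_eq[symmetric] Collect_neg_eq[symmetric])
      also have "(e/2 + (N - 1) * B) / N = e/2 + q ^ Suc n * D"
        using N by (simp add: B_def q_def field_simps of_nat_diff)
      finally show ?thesis using N by (simp add: divide_right_mono)
    qed
    have "oscillation_le (P u) (e/2 + q ^ Suc n * D)"
      unfolding oscillation_le_def
    proof
      \<comment> \<open>Moving \<open>g\<close> to the other side turns the distance to each
        averaged translate into an instance of \<open>near\<close>.\<close>
      fix g assume g: "g \<in> carrier G"
      have "d (act g (P u)) (P u) \<le> (\<Sum>i<N. d (act g (P u)) (act (h i) u)) / N"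
        using N h au Pu g act_closed unfolding P_def[of u] by (intro d_avg_le) auto
      also have "\<dots> \<le> e/2 + q ^ Suc n * D"
      proof (rule mean_le[OF N])
        fix i
        have "d (act g (P u)) (act (h i) u) = d (act (h i) u) (act g (P u))"
          using g h au Pu act_closed d_commute by auto
        also have "\<dots> = d (act (inv g \<otimes> h i) u) (P u)"
          using g h u Pu by (intro d_act_inv) auto
        also have "\<dots> \<le> e/2 + q ^ Suc n * D" using g h by (intro near) auto
        finally show "d (act g (P u)) (act (h i) u) \<le> e/2 + q ^ Suc n * D" .
      qed
      finally show "d (act g (P u)) (P u) \<le> e/2 + q ^ Suc n * D" .
    qed
    moreover have "\<exists>i<N. \<forall>k\<in>carrier G. d (act (g \<otimes> k) (P u)) (act (h i \<otimes> k) (P u)) \<le> e/2"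
      if g: "g \<in> carrier G" for g
    proof -
      obtain i where i: "i < N" "\<And>k. k \<in> carrier G \<Longrightarrow> d (act (g \<otimes> k) u) (act (h i \<otimes> k) u) \<le> e/2"
        using unet[OF g] by blast
      have "d (act (g \<otimes> k) (P u)) (act (h i \<otimes> k) (P u)) \<le> e/2" if k: "k \<in> carrier G" for k
      proof -
        \<comment> \<open>Translating the average by \<open>x \<otimes> k\<close> produces the
          arguments \<open>k \<otimes> h j\<close>; this is why the net has to be uniform over all
          \<open>k\<close>.\<close>
        have "act (x \<otimes> k) (P u) = avg N (\<lambda>j. act (x \<otimes> (k \<otimes> h j)) u)" if "x \<in> carrier G" for x
          unfolding P_def using N h au k that u(1)
          by (simp add: act_avg m_assoc[symmetric] flip: act_mult)
        then have "d (act (g \<otimes> k) (P u)) (act (h i \<otimes> k) (P u))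
          = d (avg N (\<lambda>j. act (g \<otimes> (k \<otimes> h j)) u)) (avg N (\<lambda>j. act (h i \<otimes> (k \<otimes> h j)) u))"
          using g h by simp
        also have "\<dots> \<le> (\<Sum>j<N. d (act (g \<otimes> (k \<otimes> h j)) u) (act (h i \<otimes> (k \<otimes> h j)) u)) / N"
          using N g h k by (intro avg_dist au) auto
        also have "\<dots> \<le> e/2" using h k by (intro mean_le[OF N] i(2)) auto
        finally show ?thesis .
      qed
      then show ?thesis using i(1) by blast
    qed
    moreover have "d (act k v) (P u) \<le> D" if k: "k \<in> carrier G" for k
    proof -
      have "d (act k v) (P u) \<le> (\<Sum>i<N. d (act k v) (act (h i) u)) / N"
        unfolding P_def using N h au k v act_closed by (intro d_avg_le) auto
      also have "\<dots> \<le> D"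
        using N h k u v by (intro mean_le) (auto simp: d_act_inv uv)
      finally show ?thesis .
    qed
    ultimately show ?case using Pu by (simp add: wS u_def[symmetric])
  qed
  have "(\<lambda>n. q ^ n * D) \<longlonglongrightarrow> 0 * D" using q by (intro tendsto_intros LIMSEQ_realpow_zero)
  then have "eventually (\<lambda>n. q ^ n * D < e/2) sequentially"
    using e by (intro order_tendstoD(2)[of _ 0]) auto
  then obtain n where n: "q ^ n * D < e/2" by (auto simp: eventually_sequentially)
  have wM: "w n \<in> M" using inv by blast
  have "oscillation_le (w n) e" using inv[of n] n unfolding oscillation_le_def by fastforce
  moreover have "d (w n) v \<le> 2 * D"
  proof -
    \<comment> \<open>The invariant compares \<open>w n\<close> with translates of \<open>v\<close>,
      so the route passes through \<open>act \<one> v\<close>; each half costs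
      \<open>D\<close>.\<close>
    have "d (w n) v \<le> d (w n) (act \<one> v) + d (act \<one> v) v"
      using wM v act_closed by (intro d_triangle) auto
    also have "\<dots> \<le> D + D"
      using inv[of n] D(1) wM v act_closed[OF one_closed v] d_commute[OF wM, of "act \<one> v"]
      by (intro add_mono) (auto simp: oscillation_le_def)
    finally show ?thesis by simp
  qed
  ultimately show ?thesis using wM by blast
qed

text \<open>\<open>small_oscillation\<close> moves a point by at most twice its oscillation, so
  halving the oscillation again and again gives a summable sequence whose limit has oscillation 0.
  Since \<open>d\<close> is only assumed to be a pseudo-distance, the limit is fixed up to distance
  0.\<close>

theorem fixed_point:
  obtains l where "l \<in> M" "\<And>g. g \<in> carrier G \<Longrightarrow> d (act g l) l = 0"
proof -
  obtain v where v: "v \<in> M" using nonempty by blast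
  obtain H where H: "finite H" "H \<subseteq> carrier G" "\<forall>g\<in>carrier G. \<exists>h\<in>H. \<forall>u\<in>{v}. d (act g u) (act h u) \<le> 1"
    using finite_net[of "{v}" 1] v by auto
  \<comment> \<open>A net of mesh 1 for the single point \<open>v\<close> shows that its oscillation
    is finite.\<close>
  define D where "D = 1 + (\<Sum>h\<in>H. d (act h v) v)"
  have nn: "0 \<le> d (act h v) v" if "h \<in> carrier G" for h using that v act_closed d_nonneg by auto
  have D0: "0 \<le> D" using nn H(2) by (auto simp: D_def intro!: add_nonneg_nonneg sum_nonneg)
  have "oscillation_le v D"
    unfolding oscillation_le_def
  proof
    fix k assume k: "k \<in> carrier G"
    then obtain h where h: "h \<in> H" "d (act k v) (act h v) \<le> 1" using H(3) by auto
    have "d (act k v) v \<le> d (act k v) (act h v) + d (act h v) v"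
      using k h H(2) v act_closed by (intro d_triangle) auto
    also have "d (act h v) v \<le> (\<Sum>h\<in>H. d (act h v) v)"
      using H h nn by (intro member_le_sum) auto
    finally show "d (act k v) v \<le> D" using h by (simp add: D_def)
  qed
  then obtain v' where v': "v' \<in> M" "oscillation_le v' (1/2)"
    using small_oscillation[OF v _ D0, of "1/2"] by auto
  \<comment> \<open>With oscillation (1/2)^n / 2 at stage n, the displacement bound 2 * D becomes
    (1/2)^n, the rate that \<open>complete\<close> asks for.\<close>
  have "\<exists>s. \<forall>n. (s n \<in> M \<and> oscillation_le (s n) ((1/2) ^ n / 2)) \<and> d (s (Suc n)) (s n) \<le> (1/2) ^ n"
  proof (rule dependent_nat_choice)
    show "\<exists>x. x \<in> M \<and> oscillation_le x ((1/2) ^ 0 / 2)" using v' by auto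
    fix x n assume x: "x \<in> M \<and> oscillation_le x ((1/2) ^ n / 2)"
    then show "\<exists>y. (y \<in> M \<and> oscillation_le y ((1/2) ^ Suc n / 2)) \<and> d y x \<le> (1/2) ^ n"
      using small_oscillation[of x "(1/2) ^ n / 2" "(1/2) ^ Suc n / 2"] by auto
  qed
  then obtain s where s: "\<And>n. s n \<in> M" "\<And>n. oscillation_le (s n) ((1/2) ^ n / 2)"
    "\<And>n. d (s (Suc n)) (s n) \<le> (1/2) ^ n" by blast
  obtain l where l: "l \<in> M" "(\<lambda>n. d (s n) l) \<longlonglongrightarrow> 0" using complete s by blast
  show ?thesis
  proof (rule that[OF l(1)])
    fix g assume g: "g \<in> carrier G"
    have "d (act g l) l \<le> d (s n) l + (1/2) ^ n / 2 + d (s n) l" for n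
    proof -
      have "d (act g l) l \<le> d (act g l) (act g (s n)) + (d (act g (s n)) (s n) + d (s n) l)"
        using g l s act_closed by (intro d_triangle4) auto
      moreover have "d (act g l) (act g (s n)) = d (s n) l"
        using g l s act_isometry d_commute by metis
      moreover have "d (act g (s n)) (s n) \<le> (1/2) ^ n / 2"
        using s(2) g by (simp add: oscillation_le_def)
      ultimately show ?thesis by linarith
    qed
    moreover have "(\<lambda>n. d (s n) l + (1/2) ^ n / 2 + d (s n) l) \<longlonglongrightarrow> 0 + 0 / 2 + 0"
      using l by (intro tendsto_intros LIMSEQ_realpow_zero) auto
    ultimately have "d (act g l) l \<le> 0" by (intro LIMSEQ_le_const) auto
    then show "d (act g l) l = 0" using d_nonneg[of "act g l" l] g l act_closed by force
  qed
qed

end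

section \<open>Equivariant linear lifts\<close>

context star_normed_algebra
begin

lemma smult_linear: "clinear_map A A (\<lambda>x. c \<odot> x)"
  by (simp add: clinear_map_def smult_add_right smult_smult mult.commute)

lemma finsum_smult:
  "\<lbrakk>finite S; \<And>s. s \<in> S \<Longrightarrow> f s \<in> carrier A\<rbrakk> \<Longrightarrow> c \<odot> (\<Oplus>s\<in>S. f s) = (\<Oplus>s\<in>S. c \<odot> f s)"
  by (rule clinear_map_finsum[OF star_normed_algebra_axioms star_normed_algebra_axioms smult_linear])

lemma finsum_diff:
  assumes "finite S" "\<And>s. s \<in> S \<Longrightarrow> f s \<in> carrier A" "\<And>s. s \<in> S \<Longrightarrow> g s \<in> carrier A"
  shows "(\<Oplus>s\<in>S. f s \<ominus> g s) = (\<Oplus>s\<in>S. f s) \<ominus> (\<Oplus>s\<in>S. g s)"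
proof -
  have "(\<Oplus>s\<in>S. f s \<ominus> g s) = (\<Oplus>s\<in>S. f s \<oplus> (-1) \<odot> g s)"
    using assms by (intro finsum_cong') (auto simp: a_minus_def smult_neg1)
  also have "\<dots> = (\<Oplus>s\<in>S. f s) \<oplus> (\<Oplus>s\<in>S. (-1) \<odot> g s)"
    using assms by (intro finsum_addf) auto
  also have "(\<Oplus>s\<in>S. (-1) \<odot> g s) = (-1) \<odot> (\<Oplus>s\<in>S. g s)"
    using assms by (intro finsum_smult[symmetric]) auto
  finally show ?thesis using assms by (simp add: a_minus_def smult_neg1 finsum_closed)
qed

lemma finsum_lessThan_const: "y \<in> carrier A \<Longrightarrow> (\<Oplus>i\<in>{..<n::nat}. y) = of_nat n \<odot> y"
proof (induction n)
  case (Suc n)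
  then show ?case by (simp add: lessThan_Suc finsum_insert smult_add_left)
qed simp

lemma continuous_map_nbhd:
  assumes f: "continuous_map T (norm_topology A) f" and g: "g \<in> topspace T" and e: "0 < e"
  obtains U where "openin T U" "g \<in> U" "\<And>h. h \<in> U \<Longrightarrow> nrm A (f h \<ominus> f g) < e"
proof -
  have fc: "f h \<in> carrier A" if "h \<in> topspace T" for h
    using continuous_map_image_subset_topspace[OF f] that by auto
  have "openin T {h \<in> topspace T. f h \<in> metric.mball (f g) e}"
    using f by (intro openin_continuous_map_preimage[OF f]) (auto simp: norm_topology_def)
  moreover have "g \<in> {h \<in> topspace T. f h \<in> metric.mball (f g) e}"
    using g e fc[OF g] by simp
  moreover have "nrm A (f h \<ominus> f g) < e" if "h \<in> {h \<in> topspace T. f h \<in> metric.mball (f g) e}" for h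
    using that fc[OF g] by (auto simp: norm_dist_def nrm_diff_commute split: if_splits)
  ultimately show ?thesis by (rule that)
qed

end

section \<open>Elementary facts about group actions on algebras\<close>

lemma unital_G_algebraD:
  assumes "unital_G_algebra G T A \<alpha>"
  shows "group G" "topspace T = carrier G" "continuous_map T T (\<lambda>g. inv\<^bsub>G\<^esub> g)" "unital_cstar_algebra A"
    "g \<in> carrier G \<Longrightarrow> star_automorphism A (\<alpha> g)"
    "g \<in> carrier G \<Longrightarrow> unital_star_hom A A (\<alpha> g)"
    "\<lbrakk>g \<in> carrier G; h \<in> carrier G; a \<in> carrier A\<rbrakk> \<Longrightarrow> \<alpha> (g \<otimes>\<^bsub>G\<^esub> h) a = \<alpha> g (\<alpha> h a)"
    "a \<in> carrier A \<Longrightarrow> continuous_map T (norm_topology A) (\<lambda>g. \<alpha> g a)"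
  using assms by (auto simp: unital_G_algebra_def topological_group_def star_automorphism_def)

text \<open>Not part of the definition of an action: multiplicativity makes
  \<open>\<alpha> \<one>\<close> idempotent under composition, and it is injective.\<close>

lemma G_algebra_one:
  assumes A: "unital_G_algebra G T A \<alpha>" and a: "a \<in> carrier A"
  shows "\<alpha> \<one>\<^bsub>G\<^esub> a = a"
proof -
  interpret group G using unital_G_algebraD(1)[OF A] .
  have bij: "bij_betw (\<alpha> \<one>\<^bsub>G\<^esub>) (carrier A) (carrier A)"
    using unital_G_algebraD(5)[OF A one_closed] by (simp add: star_automorphism_def)
  have "\<alpha> \<one>\<^bsub>G\<^esub> (\<alpha> \<one>\<^bsub>G\<^esub> a) = \<alpha> \<one>\<^bsub>G\<^esub> a"
    using unital_G_algebraD(7)[OF A one_closed one_closed a] by simp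
  then show ?thesis
    using bij a by (metis bij_betw_def bij_betwE inj_on_eq_iff)
qed

lemma G_algebra_inv:
  assumes A: "unital_G_algebra G T A \<alpha>" and g: "g \<in> carrier G" and a: "a \<in> carrier A"
  shows "\<alpha> (inv\<^bsub>G\<^esub> g) (\<alpha> g a) = a" "\<alpha> g (\<alpha> (inv\<^bsub>G\<^esub> g) a) = a"
proof -
  interpret group G using unital_G_algebraD(1)[OF A] .
  show "\<alpha> (inv\<^bsub>G\<^esub> g) (\<alpha> g a) = a" "\<alpha> g (\<alpha> (inv\<^bsub>G\<^esub> g) a) = a"
    using unital_G_algebraD(7)[OF A _ _ a] G_algebra_one[OF A a] g
    by (metis inv_closed l_inv, metis inv_closed r_inv)
qed

text \<open>Both the automorphism of \<open>g\<close> and that of its inverse are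
  contractive.\<close>

lemma G_algebra_isometry:
  assumes A: "unital_G_algebra G T A \<alpha>" and g: "g \<in> carrier G" and a: "a \<in> carrier A"
  shows "nrm A (\<alpha> g a) = nrm A a"
proof -
  interpret group G using unital_G_algebraD(1)[OF A] .
  note hom = unital_G_algebraD(6)[OF A]
  have le: "nrm A (\<alpha> h b) \<le> nrm A b" if "h \<in> carrier G" "b \<in> carrier A" for h b
    using unital_G_algebraD(4)[OF A] unital_G_algebraD(4)[OF A] hom[OF that(1)] that(2)
    by (rule unital_star_hom_contractive)
  have "nrm A a \<le> nrm A (\<alpha> g a)"
    using le[of "inv\<^bsub>G\<^esub> g" "\<alpha> g a"] G_algebra_inv(1)[OF A g a] g a unital_star_homD(1)[OF hom[OF g]] by simp
  then show ?thesis using le[OF g a] by simp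
qed

section \<open>The space of linear lifts\<close>

locale equivariant_lifting = fd_cstar_algebra A B + C: cstar_ideal C J + G: group G
  for A :: "('a, 'm) cstar_algebra_scheme" (structure) and B
    and C :: "('c, 'n) cstar_algebra_scheme" and J
    and G :: "('g, 'k) monoid_scheme" and T :: "'g topology" +
  fixes \<alpha> :: "'g \<Rightarrow> 'a \<Rightarrow> 'a" and \<gamma> :: "'g \<Rightarrow> 'c \<Rightarrow> 'c" and \<phi> :: "'a \<Rightarrow> 'c set"
  assumes compact: "compact_space T"
    and A_action: "unital_G_algebra G T A \<alpha>"
    and C_action: "unital_G_algebra G T C \<gamma>"
    and J_invariant: "g \<in> carrier G \<Longrightarrow> \<gamma> g ` J \<subseteq> J"
    and \<phi>: "unital_equivariant_hom G A \<alpha> (cstar_quotient C J) (quotient_action C J \<gamma>) \<phi>"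
begin

lemma \<alpha>_hom: "g \<in> carrier G \<Longrightarrow> unital_star_hom A A (\<alpha> g)"
  and \<gamma>_hom: "g \<in> carrier G \<Longrightarrow> unital_star_hom C C (\<gamma> g)"
  and \<phi>_hom: "unital_star_hom A C.Q \<phi>"
  using unital_G_algebraD(6)[OF A_action] unital_G_algebraD(6)[OF C_action] \<phi>
  by (auto simp: unital_equivariant_hom_def)

lemmas \<alpha>D = unital_star_homD[OF \<alpha>_hom]
lemmas \<gamma>D = unital_star_homD[OF \<gamma>_hom]
lemmas \<phi>D = unital_star_homD[OF \<phi>_hom]

lemma \<alpha>_closed [simp]: "\<lbrakk>g \<in> carrier G; x \<in> carrier A\<rbrakk> \<Longrightarrow> \<alpha> g x \<in> carrier A"
  and \<gamma>_closed [simp]: "\<lbrakk>g \<in> carrier G; y \<in> carrier C\<rbrakk> \<Longrightarrow> \<gamma> g y \<in> carrier C"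
  by (rule \<alpha>D(1), auto) (rule \<gamma>D(1), auto)

lemma \<gamma>_diff: "\<lbrakk>g \<in> carrier G; x \<in> carrier C; y \<in> carrier C\<rbrakk> \<Longrightarrow> \<gamma> g (x \<ominus>\<^bsub>C\<^esub> y) = \<gamma> g x \<ominus>\<^bsub>C\<^esub> \<gamma> g y"
  using \<gamma>D(2,3)[of g x "\<ominus>\<^bsub>C\<^esub> y"] \<gamma>D(5)[of g y "-1"] by (simp add: a_minus_def C.smult_neg1)

lemma quotient_action_rcoset:
  assumes g: "g \<in> carrier G" and x: "x \<in> carrier C"
  shows "quotient_action C J \<gamma> g (J +>\<^bsub>C\<^esub> x) = J +>\<^bsub>C\<^esub> \<gamma> g x"
  unfolding quotient_action_def
proof (rule C.coset_map_rcoset[OF C.ideal_axioms C.ideal_axioms x])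
  fix y assume "y \<in> carrier C" "y \<ominus>\<^bsub>C\<^esub> x \<in> J"
  then show "\<gamma> g y \<in> carrier C \<and> \<gamma> g y \<ominus>\<^bsub>C\<^esub> \<gamma> g x \<in> J"
    using g x J_invariant[OF g] by (auto simp flip: \<gamma>_diff)
qed

lemma \<phi>_equivariant: "\<lbrakk>g \<in> carrier G; a \<in> carrier A\<rbrakk> \<Longrightarrow> \<phi> (\<alpha> g a) = quotient_action C J \<gamma> g (\<phi> a)"
  using \<phi> by (simp add: unital_equivariant_hom_def)

text \<open>Extensionality makes lifts that agree on the carrier equal as functions, which the
  equations of \<open>isometric_averaging\<close> require. Compatibility with adjoints is not
  imposed here; it is restored after averaging.\<close>

definition lifts :: "('a \<Rightarrow> 'c) set" where
  "lifts = {f \<in> extensional (carrier A). clinear_map A C f \<and> (\<forall>a\<in>carrier A. J +>\<^bsub>C\<^esub> f a = \<phi> a)}"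

text \<open>The operator norm of the difference; the supremum is finite because linear maps on
  \<open>A\<close> are bounded.\<close>

definition lift_dist :: "('a \<Rightarrow> 'c) \<Rightarrow> ('a \<Rightarrow> 'c) \<Rightarrow> real" where
  "lift_dist f h = (SUP a\<in>{a \<in> carrier A. nrm A a \<le> 1}. nrm C (f a \<ominus>\<^bsub>C\<^esub> h a))"

text \<open>The conjugation action, whose fixed points are the equivariant maps.\<close>

definition lift_act :: "'g \<Rightarrow> ('a \<Rightarrow> 'c) \<Rightarrow> 'a \<Rightarrow> 'c" where
  "lift_act g f = restrict (\<lambda>a. \<gamma> g (f (\<alpha> (inv\<^bsub>G\<^esub> g) a))) (carrier A)"

definition lift_avg :: "nat \<Rightarrow> (nat \<Rightarrow> 'a \<Rightarrow> 'c) \<Rightarrow> 'a \<Rightarrow> 'c" where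
  "lift_avg n s = restrict (\<lambda>a. (1 / of_nat n) \<odot>\<^bsub>C\<^esub> (\<Oplus>\<^bsub>C\<^esub>i\<in>{..<n}. s i a)) (carrier A)"

lemma liftsD:
  assumes "f \<in> lifts"
  shows "clinear_map A C f" "a \<in> carrier A \<Longrightarrow> f a \<in> carrier C" "a \<in> carrier A \<Longrightarrow> J +>\<^bsub>C\<^esub> f a = \<phi> a"
  using assms by (auto simp: lifts_def clinear_map_def)

lemma difference_linear:
  assumes "clinear_map A C f" "clinear_map A C h"
  shows "clinear_map A C (\<lambda>a. f a \<ominus>\<^bsub>C\<^esub> h a)"
proof -
  have "x \<oplus>\<^bsub>C\<^esub> y \<ominus>\<^bsub>C\<^esub> (z \<oplus>\<^bsub>C\<^esub> w) = (x \<ominus>\<^bsub>C\<^esub> z) \<oplus>\<^bsub>C\<^esub> (y \<ominus>\<^bsub>C\<^esub> w)"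
    if "x \<in> carrier C" "y \<in> carrier C" "z \<in> carrier C" "w \<in> carrier C" for x y z w
    using that by algebra
  then show ?thesis using assms by (simp add: clinear_map_def C.smult_diff)
qed

lemma lift_dist_upper:
  assumes "f \<in> lifts" "h \<in> lifts" "a \<in> carrier A" "nrm A a \<le> 1"
  shows "nrm C (f a \<ominus>\<^bsub>C\<^esub> h a) \<le> lift_dist f h"
proof -
  obtain K where K: "K \<ge> 0" "\<And>x. x \<in> carrier A \<Longrightarrow> nrm C (f x \<ominus>\<^bsub>C\<^esub> h x) \<le> K * nrm A x"
    using linear_bounded[OF C.star_normed_algebra_axioms difference_linear[OF liftsD(1) liftsD(1)]] assms by metis
  have "bdd_above ((\<lambda>a. nrm C (f a \<ominus>\<^bsub>C\<^esub> h a)) ` {a \<in> carrier A. nrm A a \<le> 1})"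
  proof (rule bdd_aboveI2)
    fix x assume "x \<in> {a \<in> carrier A. nrm A a \<le> 1}"
    then show "nrm C (f x \<ominus>\<^bsub>C\<^esub> h x) \<le> K"
      using K(2)[of x] mult_left_mono[of "nrm A x" 1 K] K(1) by simp
  qed
  then show ?thesis unfolding lift_dist_def using assms by (intro cSUP_upper) auto
qed

lemma lift_dist_least:
  assumes "\<And>a. \<lbrakk>a \<in> carrier A; nrm A a \<le> 1\<rbrakk> \<Longrightarrow> nrm C (f a \<ominus>\<^bsub>C\<^esub> h a) \<le> c"
  shows "lift_dist f h \<le> c"
proof -
  have "\<zero> \<in> {a \<in> carrier A. nrm A a \<le> 1}" by simp
  then show ?thesis unfolding lift_dist_def using assms by (intro cSUP_least) blast+
qed

lemma lift_dist_nonneg: "\<lbrakk>f \<in> lifts; h \<in> lifts\<rbrakk> \<Longrightarrow> 0 \<le> lift_dist f h"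
  using lift_dist_upper[of f h \<zero>] C.nrm_nonneg[of "f \<zero> \<ominus>\<^bsub>C\<^esub> h \<zero>"] liftsD(2) by fastforce

lemma lift_dist_scaled:
  assumes f: "f \<in> lifts" "h \<in> lifts" and a: "a \<in> carrier A"
  shows "nrm C (f a \<ominus>\<^bsub>C\<^esub> h a) \<le> lift_dist f h * nrm A a"
proof (cases "nrm A a = 0")
  case True
  then have a0: "a = \<zero>" using a nrm_eq_0_iff by simp
  obtain K where "\<And>x. x \<in> carrier A \<Longrightarrow> nrm C (f x \<ominus>\<^bsub>C\<^esub> h x) \<le> K * nrm A x"
    using linear_bounded[OF C.star_normed_algebra_axioms difference_linear[OF liftsD(1) liftsD(1)]] f by metis
  from this[of \<zero>] show ?thesis by (simp add: a0)
next
  case False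
  define r where "r = nrm A a"
  have r: "r > 0" using False nrm_nonneg[OF a] by (simp add: r_def)
  note lin = clinear_mapD[OF difference_linear[OF liftsD(1)[OF f(1)] liftsD(1)[OF f(2)]]]
  let ?x = "complex_of_real (inverse r) \<odot> a"
  have "nrm C (f ?x \<ominus>\<^bsub>C\<^esub> h ?x) \<le> lift_dist f h"
    using f a r by (intro lift_dist_upper) (auto simp: nrm_smult norm_inverse r_def)
  then have "inverse r * nrm C (f a \<ominus>\<^bsub>C\<^esub> h a) \<le> lift_dist f h"
    using a r lin by (simp add: C.nrm_smult norm_inverse)
  then show ?thesis using r by (simp add: r_def field_simps)
qed

text \<open>Representatives are chosen on the basis and extended linearly.\<close>

lemma linear_lift_exists: "lifts \<noteq> {}"
proof -
  have "\<exists>x. x \<in> carrier C \<and> J +>\<^bsub>C\<^esub> x = \<phi> b" if "b \<in> B" for b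
    using \<phi>D(1)[of b] that C.quotientE by (metis B_carrier)
  then obtain x where x: "\<And>b. b \<in> B \<Longrightarrow> x b \<in> carrier C" "\<And>b. b \<in> B \<Longrightarrow> J +>\<^bsub>C\<^esub> x b = \<phi> b" by metis
  define f where "f = restrict (\<lambda>a. \<Oplus>\<^bsub>C\<^esub>b\<in>B. coord B a b \<odot>\<^bsub>C\<^esub> x b) (carrier A)"
  have f: "f a = (\<Oplus>\<^bsub>C\<^esub>b\<in>B. coord B a b \<odot>\<^bsub>C\<^esub> x b)" if "a \<in> carrier A" for a using that by (simp add: f_def)
  note co = coord_functional[OF spans_B lin_independent_B, unfolded clinear_functional_def]
  have fc: "f a \<in> carrier C" if "a \<in> carrier A" for a
    using x that by (auto simp: f intro!: C.finsum_closed)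
  have "f (a \<oplus> b) = f a \<oplus>\<^bsub>C\<^esub> f b" if ab: "a \<in> carrier A" "b \<in> carrier A" for a b
  proof -
    have "f (a \<oplus> b) = (\<Oplus>\<^bsub>C\<^esub>d\<in>B. coord B a d \<odot>\<^bsub>C\<^esub> x d \<oplus>\<^bsub>C\<^esub> coord B b d \<odot>\<^bsub>C\<^esub> x d)"
      unfolding f[OF add.m_closed[OF ab]] using ab x co by (intro C.finsum_cong') (auto simp: C.smult_add_left)
    also have "\<dots> = (\<Oplus>\<^bsub>C\<^esub>d\<in>B. coord B a d \<odot>\<^bsub>C\<^esub> x d) \<oplus>\<^bsub>C\<^esub> (\<Oplus>\<^bsub>C\<^esub>d\<in>B. coord B b d \<odot>\<^bsub>C\<^esub> x d)"
      using x by (intro C.finsum_addf) auto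
    finally show ?thesis unfolding f[OF ab(1)] f[OF ab(2)] .
  qed
  moreover have "f (c \<odot> a) = c \<odot>\<^bsub>C\<^esub> f a" if a: "a \<in> carrier A" for a c
  proof -
    have "f (c \<odot> a) = (\<Oplus>\<^bsub>C\<^esub>d\<in>B. c \<odot>\<^bsub>C\<^esub> (coord B a d \<odot>\<^bsub>C\<^esub> x d))"
      using a x co by (auto simp: f C.smult_smult intro!: C.finsum_cong')
    then show ?thesis using a x finite_B by (simp add: f C.finsum_smult)
  qed
  ultimately have lin: "clinear_map A C f" using fc by (simp add: clinear_map_def)
  interpret Q: star_normed_algebra C.Q by (rule C.star_normed_quotient)
  have qlin: "clinear_map C C.Q (\<lambda>x. J +>\<^bsub>C\<^esub> x)"
    by (simp add: clinear_map_def C.quotient_add C.quotient_smult)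
  have "J +>\<^bsub>C\<^esub> f a = \<phi> a" if a: "a \<in> carrier A" for a
  proof -
    have "J +>\<^bsub>C\<^esub> f a = (\<Oplus>\<^bsub>C.Q\<^esub>b\<in>B. J +>\<^bsub>C\<^esub> (coord B a b \<odot>\<^bsub>C\<^esub> x b))"
      unfolding f[OF a] using x finite_B
      by (intro clinear_map_finsum[OF C.star_normed_algebra_axioms Q.star_normed_algebra_axioms qlin]) auto
    also have "\<dots> = (\<Oplus>\<^bsub>C.Q\<^esub>b\<in>B. coord B a b \<odot>\<^bsub>C.Q\<^esub> \<phi> b)"
    proof (rule Q.finsum_cong')
      show "J +>\<^bsub>C\<^esub> (coord B a b \<odot>\<^bsub>C\<^esub> x b) = coord B a b \<odot>\<^bsub>C.Q\<^esub> \<phi> b" if "b \<in> B" for b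
        using C.quotient_smult[OF x(1)[OF that], of "coord B a b"] x(2)[OF that] by simp
    qed (use \<phi>D(1) in auto)
    also have "\<dots> = \<phi> (lincomb (coord B a) B)"
      using finite_B B_subset
      by (intro clinear_map_lincomb[symmetric, OF star_normed_algebra_axioms Q.star_normed_algebra_axioms
          unital_star_hom_linear[OF \<phi>_hom]])
    finally show ?thesis using lincomb_coord[OF spans_B a] by simp
  qed
  then have "f \<in> lifts" using lin by (auto simp: lifts_def f_def)
  then show ?thesis by blast
qed

text \<open>The limit is taken pointwise; it is again a lift because limits in the quotient are
  unique, and the convergence is uniform on the unit ball by a geometric tail estimate.\<close>

lemma lifts_complete:
  assumes s: "\<And>n. s n \<in> lifts" and step: "\<And>n. lift_dist (s (Suc n)) (s n) \<le> (1/2) ^ n"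
  shows "\<exists>l\<in>lifts. (\<lambda>n. lift_dist (s n) l) \<longlonglongrightarrow> 0"
proof -
  note sc = liftsD(2)[OF s] and lin = clinear_mapD[OF liftsD(1)[OF s]]
  have step': "nrm C (s (Suc n) a \<ominus>\<^bsub>C\<^esub> s n a) \<le> nrm A a * (1/2) ^ n" if a: "a \<in> carrier A" for a n
    using lift_dist_scaled[OF s s a, of "Suc n" n] mult_right_mono[OF step[of n] nrm_nonneg[OF a]]
    by (simp add: mult.commute)
  have "\<exists>l. C.tends (\<lambda>n. s n a) l" if a: "a \<in> carrier A" for a
    using step'[OF a] sc[OF a] by (intro C.geometric_tends[where r = "1/2" and c = "nrm A a"]) auto
  then obtain l0 where l0: "\<And>a. a \<in> carrier A \<Longrightarrow> C.tends (\<lambda>n. s n a) (l0 a)" by metis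
  define l where "l = restrict l0 (carrier A)"
  have l: "C.tends (\<lambda>n. s n a) (l a)" if "a \<in> carrier A" for a using l0 that by (simp add: l_def)
  have lc: "l a \<in> carrier C" if "a \<in> carrier A" for a using l[OF that] by (simp add: C.tends_def)
  have "l (a \<oplus> b) = l a \<oplus>\<^bsub>C\<^esub> l b" if "a \<in> carrier A" "b \<in> carrier A" for a b
    using C.tends_unique[OF l[of "a \<oplus> b"]] C.tends_add[OF l[of a] l[of b]] that lin by simp
  moreover have "l (c \<odot> a) = c \<odot>\<^bsub>C\<^esub> l a" if "a \<in> carrier A" for a c
    using C.tends_unique[OF l[of "c \<odot> a"]] C.tends_smult[OF l[of a]] that lin by simp
  moreover have "J +>\<^bsub>C\<^esub> l a = \<phi> a" if a: "a \<in> carrier A" for a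
  proof -
    interpret Q: star_normed_algebra C.Q by (rule C.star_normed_quotient)
    have "Q.tends (\<lambda>n. J +>\<^bsub>C\<^esub> s n a) (J +>\<^bsub>C\<^esub> l a)"
    proof (rule Q.tends_bound)
      show "(\<lambda>n. nrm C (s n a \<ominus>\<^bsub>C\<^esub> l a)) \<longlonglongrightarrow> 0" using l[OF a] by (simp add: C.tends_def)
      show "nrm C.Q ((J +>\<^bsub>C\<^esub> s n a) \<ominus>\<^bsub>C.Q\<^esub> (J +>\<^bsub>C\<^esub> l a)) \<le> nrm C (s n a \<ominus>\<^bsub>C\<^esub> l a)" for n
        using sc[OF a] lc[OF a] by (simp add: C.quotient_minus C.quotient_nrm_le)
    qed (use sc lc a in auto)
    then have "Q.tends (\<lambda>n. \<phi> a) (J +>\<^bsub>C\<^esub> l a)" using liftsD(3)[OF s a] by simp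
    then show ?thesis using Q.tends_unique Q.tends_const \<phi>D(1)[OF a] by blast
  qed
  ultimately have lL: "l \<in> lifts" using lc by (auto simp: lifts_def clinear_map_def l_def)
  \<comment> \<open>The subtracted term makes the induction over \<open>k\<close> close up; dropping
    it gives a bound independent of \<open>k\<close>.\<close>
  have tail: "nrm C (s (n + k) a \<ominus>\<^bsub>C\<^esub> s n a) \<le> 2 * (1/2) ^ n - 2 * (1/2) ^ (n + k)"
    if a: "a \<in> carrier A" "nrm A a \<le> 1" for a n k
  proof (induction k)
    case 0
    show ?case using sc a by simp
  next
    case (Suc k)
    have "nrm C (s (n + Suc k) a \<ominus>\<^bsub>C\<^esub> s n a)
      \<le> nrm C (s (Suc (n + k)) a \<ominus>\<^bsub>C\<^esub> s (n + k) a) + nrm C (s (n + k) a \<ominus>\<^bsub>C\<^esub> s n a)"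
      using C.nrm_diff_triangle[OF sc sc sc] a by simp
    moreover have "nrm C (s (Suc (n + k)) a \<ominus>\<^bsub>C\<^esub> s (n + k) a) \<le> (1/2) ^ (n + k)"
      using lift_dist_upper[OF s s a] step order.trans by blast
    ultimately show ?case using Suc by simp
  qed
  have "lift_dist (s n) l \<le> 2 * (1/2) ^ n" for n
  proof (rule lift_dist_least)
    fix a assume a: "a \<in> carrier A" "nrm A a \<le> 1"
    have "C.tends (\<lambda>k. s (n + k) a) (l a)"
      using l[OF a(1)] LIMSEQ_ignore_initial_segment[of _ _ n] unfolding C.tends_def by (auto simp: add.commute)
    then have "C.tends (\<lambda>k. s (n + k) a \<ominus>\<^bsub>C\<^esub> s n a) (l a \<ominus>\<^bsub>C\<^esub> s n a)"
      using sc a by (intro C.tends_diff C.tends_const) auto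
    moreover have "nrm C (s (n + k) a \<ominus>\<^bsub>C\<^esub> s n a) \<le> 2 * (1/2) ^ n" for k
      using tail[OF a, of n k] zero_le_power[of "1/2 :: real" "n + k"] by linarith
    ultimately have "nrm C (l a \<ominus>\<^bsub>C\<^esub> s n a) \<le> 2 * (1/2) ^ n" by (rule C.tends_nrm_le)
    then show "nrm C (s n a \<ominus>\<^bsub>C\<^esub> l a) \<le> 2 * (1/2) ^ n"
      using C.nrm_diff_commute sc lc a by simp
  qed
  then have ub: "\<forall>n. lift_dist (s n) l \<le> 2 * (1/2) ^ n" by blast
  have "(\<lambda>n. 2 * (1/2) ^ n :: real) \<longlonglongrightarrow> 2 * 0"
    by (intro tendsto_intros LIMSEQ_realpow_zero) auto
  then have lim: "(\<lambda>n. 2 * (1/2) ^ n :: real) \<longlonglongrightarrow> 0" by simp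
  have "(\<lambda>n. lift_dist (s n) l) \<longlonglongrightarrow> 0"
    by (rule tendsto_sandwich[OF always_eventually always_eventually tendsto_const lim])
      (use ub lift_dist_nonneg[OF s lL] in auto)
  then show ?thesis using lL by blast
qed

lemma lift_act_apply: "a \<in> carrier A \<Longrightarrow> lift_act g f a = \<gamma> g (f (\<alpha> (inv\<^bsub>G\<^esub> g) a))"
  by (simp add: lift_act_def)

lemma lift_act_closed:
  assumes g: "g \<in> carrier G" and f: "f \<in> lifts"
  shows "lift_act g f \<in> lifts"
proof -
  have "clinear_map A C (lift_act g f)"
    unfolding clinear_map_def using g clinear_mapD[OF liftsD(1)[OF f]]
    by (simp add: lift_act_apply \<alpha>D(3,5) \<gamma>D(3,5))
  moreover have "J +>\<^bsub>C\<^esub> lift_act g f a = \<phi> a" if a: "a \<in> carrier A" for a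
  proof -
    have "J +>\<^bsub>C\<^esub> lift_act g f a = quotient_action C J \<gamma> g (\<phi> (\<alpha> (inv\<^bsub>G\<^esub> g) a))"
      using g a f liftsD(2)[OF f] by (simp add: lift_act_apply quotient_action_rcoset flip: liftsD(3)[OF f])
    also have "\<dots> = \<phi> (\<alpha> g (\<alpha> (inv\<^bsub>G\<^esub> g) a))" using g a by (simp add: \<phi>_equivariant)
    finally show ?thesis using G_algebra_inv(2)[OF A_action g a] by simp
  qed
  ultimately show ?thesis by (auto simp: lifts_def lift_act_def)
qed

lemma lift_act_dist_le:
  assumes g: "g \<in> carrier G" and f: "f \<in> lifts" "h \<in> lifts"
  shows "lift_dist (lift_act g f) (lift_act g h) \<le> lift_dist f h"
proof (rule lift_dist_least)
  fix a assume a: "a \<in> carrier A" "nrm A a \<le> 1"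
  let ?a = "\<alpha> (inv\<^bsub>G\<^esub> g) a"
  have a': "?a \<in> carrier A" using a g by simp
  have "nrm C (lift_act g f a \<ominus>\<^bsub>C\<^esub> lift_act g h a) = nrm C (f ?a \<ominus>\<^bsub>C\<^esub> h ?a)"
    using a a' g f liftsD(2)
    by (simp add: lift_act_apply G_algebra_isometry[OF C_action] flip: \<gamma>_diff)
  also have "\<dots> \<le> lift_dist f h"
    using a a' f g by (intro lift_dist_upper) (auto simp: G_algebra_isometry[OF A_action])
  finally show "nrm C (lift_act g f a \<ominus>\<^bsub>C\<^esub> lift_act g h a) \<le> lift_dist f h" .
qed

lemma lift_act_mult:
  assumes g: "g \<in> carrier G" "h \<in> carrier G" and f: "f \<in> lifts"
  shows "lift_act (g \<otimes>\<^bsub>G\<^esub> h) f = lift_act g (lift_act h f)"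
proof
  fix a
  show "lift_act (g \<otimes>\<^bsub>G\<^esub> h) f a = lift_act g (lift_act h f) a"
  proof (cases "a \<in> carrier A")
    case True
    then show ?thesis
      using g liftsD(2)[OF f]
      by (simp add: lift_act_apply unital_G_algebraD(7)[OF A_action] unital_G_algebraD(7)[OF C_action] G.inv_mult_group)
  qed (simp add: lift_act_def)
qed

lemma lift_act_inv: "\<lbrakk>g \<in> carrier G; f \<in> lifts\<rbrakk> \<Longrightarrow> lift_act (inv\<^bsub>G\<^esub> g) (lift_act g f) = f"
proof
  fix a assume g: "g \<in> carrier G" and f: "f \<in> lifts"
  show "lift_act (inv\<^bsub>G\<^esub> g) (lift_act g f) a = f a"
  proof (cases "a \<in> carrier A")
    case True
    then show ?thesis using g liftsD(2)[OF f]
      by (simp add: lift_act_apply G_algebra_inv[OF A_action] G_algebra_inv[OF C_action])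
  next
    case False
    then show ?thesis using f by (simp add: lift_act_def lifts_def extensional_def)
  qed
qed

lemma lift_avg_apply:
  "a \<in> carrier A \<Longrightarrow> lift_avg n s a = (1 / of_nat n) \<odot>\<^bsub>C\<^esub> (\<Oplus>\<^bsub>C\<^esub>i\<in>{..<n}. s i a)"
  by (simp add: lift_avg_def)

lemma lift_avg_closed:
  assumes n: "0 < n" and s: "\<And>i. s i \<in> lifts"
  shows "lift_avg n s \<in> lifts"
proof -
  interpret Q: star_normed_algebra C.Q by (rule C.star_normed_quotient)
  note sc = liftsD(2)[OF s] and lin = clinear_mapD[OF liftsD(1)[OF s]]
  have sumc: "(\<Oplus>\<^bsub>C\<^esub>i\<in>{..<n}. s i a) \<in> carrier C" if "a \<in> carrier A" for a
    using sc that by (intro C.finsum_closed) auto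
  have "lift_avg n s (a \<oplus> b) = lift_avg n s a \<oplus>\<^bsub>C\<^esub> lift_avg n s b"
    if ab: "a \<in> carrier A" "b \<in> carrier A" for a b
  proof -
    have "(\<Oplus>\<^bsub>C\<^esub>i\<in>{..<n}. s i (a \<oplus> b)) = (\<Oplus>\<^bsub>C\<^esub>i\<in>{..<n}. s i a \<oplus>\<^bsub>C\<^esub> s i b)"
      using ab sc lin by (intro C.finsum_cong') auto
    also have "\<dots> = (\<Oplus>\<^bsub>C\<^esub>i\<in>{..<n}. s i a) \<oplus>\<^bsub>C\<^esub> (\<Oplus>\<^bsub>C\<^esub>i\<in>{..<n}. s i b)"
      using ab sc by (intro C.finsum_addf) auto
    finally show ?thesis using ab sumc by (simp add: lift_avg_apply C.smult_add_right)
  qed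
  moreover have "lift_avg n s (c \<odot> a) = c \<odot>\<^bsub>C\<^esub> lift_avg n s a" if a: "a \<in> carrier A" for a c
  proof -
    have "(\<Oplus>\<^bsub>C\<^esub>i\<in>{..<n}. s i (c \<odot> a)) = (\<Oplus>\<^bsub>C\<^esub>i\<in>{..<n}. c \<odot>\<^bsub>C\<^esub> s i a)"
      using a sc lin by (intro C.finsum_cong') auto
    also have "\<dots> = c \<odot>\<^bsub>C\<^esub> (\<Oplus>\<^bsub>C\<^esub>i\<in>{..<n}. s i a)"
      using a sc by (intro C.finsum_smult[symmetric]) auto
    finally show ?thesis using a sumc by (simp add: lift_avg_apply C.smult_smult mult.commute)
  qed
  moreover have "J +>\<^bsub>C\<^esub> lift_avg n s a = \<phi> a" if a: "a \<in> carrier A" for a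
  proof -
    have qlin: "clinear_map C C.Q (\<lambda>x. J +>\<^bsub>C\<^esub> x)"
      by (simp add: clinear_map_def C.quotient_add C.quotient_smult)
    have "J +>\<^bsub>C\<^esub> (\<Oplus>\<^bsub>C\<^esub>i\<in>{..<n}. s i a) = (\<Oplus>\<^bsub>C.Q\<^esub>i\<in>{..<n}. J +>\<^bsub>C\<^esub> s i a)"
      using a sc by (intro clinear_map_finsum[OF C.star_normed_algebra_axioms Q.star_normed_algebra_axioms qlin]) auto
    also have "\<dots> = (\<Oplus>\<^bsub>C.Q\<^esub>i\<in>{..<n}. \<phi> a)" using liftsD(3)[OF s a] by simp
    also have "\<dots> = of_nat n \<odot>\<^bsub>C.Q\<^esub> \<phi> a" using \<phi>D(1)[OF a] by (rule Q.finsum_lessThan_const)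
    finally show ?thesis
      using a n sumc[OF a] \<phi>D(1)[OF a] by (simp add: lift_avg_apply Q.smult_smult flip: C.quotient_smult)
  qed
  ultimately show ?thesis using sumc by (auto simp: lifts_def clinear_map_def lift_avg_apply) (simp add: lift_avg_def)
qed

lemma lift_avg_dist:
  assumes n: "0 < n" and s: "\<And>i. s i \<in> lifts" and t: "\<And>i. t i \<in> lifts"
  shows "lift_dist (lift_avg n s) (lift_avg n t) \<le> (\<Sum>i<n. lift_dist (s i) (t i)) / n"
proof (rule lift_dist_least)
  fix a assume a: "a \<in> carrier A" "nrm A a \<le> 1"
  have c: "s i a \<in> carrier C" "t i a \<in> carrier C" for i using liftsD(2) s t a by auto
  have "lift_avg n s a \<ominus>\<^bsub>C\<^esub> lift_avg n t a = (1 / of_nat n) \<odot>\<^bsub>C\<^esub> (\<Oplus>\<^bsub>C\<^esub>i\<in>{..<n}. s i a \<ominus>\<^bsub>C\<^esub> t i a)"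
    using a c by (simp add: lift_avg_apply C.finsum_diff C.smult_diff C.finsum_closed)
  then have "nrm C (lift_avg n s a \<ominus>\<^bsub>C\<^esub> lift_avg n t a) = nrm C (\<Oplus>\<^bsub>C\<^esub>i\<in>{..<n}. s i a \<ominus>\<^bsub>C\<^esub> t i a) / n"
    using c by (simp add: C.nrm_smult norm_divide C.finsum_closed)
  also have "\<dots> \<le> (\<Sum>i<n. nrm C (s i a \<ominus>\<^bsub>C\<^esub> t i a)) / n"
    using c by (intro divide_right_mono C.nrm_finsum_le) auto
  also have "\<dots> \<le> (\<Sum>i<n. lift_dist (s i) (t i)) / n"
    using s t a by (intro divide_right_mono sum_mono lift_dist_upper) auto
  finally show "nrm C (lift_avg n s a \<ominus>\<^bsub>C\<^esub> lift_avg n t a) \<le> (\<Sum>i<n. lift_dist (s i) (t i)) / n" .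
qed

lemma lift_avg_const:
  assumes "0 < n" "f \<in> lifts"
  shows "lift_dist f (lift_avg n (\<lambda>i. f)) = 0"
proof -
  have "lift_avg n (\<lambda>i. f) a = f a" if "a \<in> carrier A" for a
    using that assms liftsD(2) by (simp add: lift_avg_apply C.finsum_lessThan_const C.smult_smult)
  then have "lift_dist f (lift_avg n (\<lambda>i. f)) \<le> 0"
    using assms liftsD(2) by (intro lift_dist_least) simp
  then show ?thesis using lift_dist_nonneg[of f "lift_avg n (\<lambda>i. f)"] lift_avg_closed assms by fastforce
qed

lemma lift_act_avg:
  assumes n: "0 < n" and g: "g \<in> carrier G" and s: "\<And>i. s i \<in> lifts"
  shows "lift_act g (lift_avg n s) = lift_avg n (\<lambda>i. lift_act g (s i))"
proof
  fix a
  show "lift_act g (lift_avg n s) a = lift_avg n (\<lambda>i. lift_act g (s i)) a"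
  proof (cases "a \<in> carrier A")
    case a: True
    let ?a = "\<alpha> (inv\<^bsub>G\<^esub> g) a"
    have a': "?a \<in> carrier A" using a g by simp
    have sc: "s i ?a \<in> carrier C" for i using liftsD(2)[OF s a'] .
    have sumc: "(\<Oplus>\<^bsub>C\<^esub>i\<in>{..<n}. s i ?a) \<in> carrier C" using sc by (intro C.finsum_closed) auto
    have "\<gamma> g (\<Oplus>\<^bsub>C\<^esub>i\<in>{..<n}. s i ?a) = (\<Oplus>\<^bsub>C\<^esub>i\<in>{..<n}. \<gamma> g (s i ?a))"
      using sc by (intro clinear_map_finsum[OF C.star_normed_algebra_axioms C.star_normed_algebra_axioms
          unital_star_hom_linear[OF \<gamma>_hom[OF g]]]) auto
    then show ?thesis
      using a a' g sumc by (simp add: lift_act_apply lift_avg_apply \<gamma>D(5))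
  qed (simp add: lift_act_def lift_avg_def)
qed

text \<open>The group element occurs twice, inside through its inverse and outside. The difference
  is split at \<open>\<gamma> h (f (\<alpha> (inv g) a))\<close>: the first part is small by
  continuity of the action on \<open>A\<close>, boundedness of \<open>f\<close> and isometry of
  \<open>\<gamma> h\<close>, the second by continuity of the action on \<open>C\<close>.\<close>

lemma lift_orbit_nbhd:
  assumes f: "f \<in> lifts" and a: "a \<in> carrier A" and g: "g \<in> carrier G" and e: "0 < e"
  obtains U where "openin T U" "g \<in> U" "\<And>h. h \<in> U \<Longrightarrow> nrm C (lift_act h f a \<ominus>\<^bsub>C\<^esub> lift_act g f a) < e"
proof -
  note top = unital_G_algebraD(2)[OF A_action]
  obtain K where K: "K \<ge> 0" "\<And>x. x \<in> carrier A \<Longrightarrow> nrm C (f x) \<le> K * nrm A x"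
    using linear_bounded[OF C.star_normed_algebra_axioms liftsD(1)[OF f]] by metis
  let ?b = "\<alpha> (inv\<^bsub>G\<^esub> g) a"
  have b: "?b \<in> carrier A" using a g by simp
  have cA: "continuous_map T (norm_topology A) (\<lambda>h. \<alpha> (inv\<^bsub>G\<^esub> h) a)"
    using continuous_map_compose[OF unital_G_algebraD(3)[OF A_action] unital_G_algebraD(8)[OF A_action a]]
    by (simp add: o_def)
  define e1 where "e1 = e / (2 * (K + 1))"
  have e1: "0 < e1" "K * e1 \<le> e / 2" using e K by (auto simp: e1_def field_simps)
  obtain U1 where U1: "openin T U1" "g \<in> U1" "\<And>h. h \<in> U1 \<Longrightarrow> nrm A (\<alpha> (inv\<^bsub>G\<^esub> h) a \<ominus> ?b) < e1"
    using continuous_map_nbhd[OF cA, of g e1] g top e1 by auto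
  obtain U2 where U2: "openin T U2" "g \<in> U2" "\<And>h. h \<in> U2 \<Longrightarrow> nrm C (\<gamma> h (f ?b) \<ominus>\<^bsub>C\<^esub> \<gamma> g (f ?b)) < e / 2"
    using C.continuous_map_nbhd[OF unital_G_algebraD(8)[OF C_action liftsD(2)[OF f b]], of g "e/2"] g top e
    by auto
  show ?thesis
  proof (rule that[of "U1 \<inter> U2"])
    show "openin T (U1 \<inter> U2)" using U1 U2 by blast
    show "g \<in> U1 \<inter> U2" using U1 U2 by blast
    fix h assume h: "h \<in> U1 \<inter> U2"
    have hG: "h \<in> carrier G" using h openin_subset[OF U1(1)] top by auto
    let ?a = "\<alpha> (inv\<^bsub>G\<^esub> h) a"
    have a': "?a \<in> carrier A" using a hG by simp
    have fab: "f ?a \<ominus>\<^bsub>C\<^esub> f ?b = f (?a \<ominus> ?b)"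
      using clinear_mapD(2)[OF liftsD(1)[OF f] a', of "\<ominus> ?b"] clinear_mapD(3)[OF liftsD(1)[OF f] b, of "-1"] b
        liftsD(2)[OF f b]
      by (simp add: a_minus_def smult_neg1 C.smult_neg1)
    have "nrm C (\<gamma> h (f ?a) \<ominus>\<^bsub>C\<^esub> \<gamma> h (f ?b)) = nrm C (f (?a \<ominus> ?b))"
      using liftsD(2)[OF f a'] liftsD(2)[OF f b] liftsD(2)[OF f minus_closed[OF a' b]] hG fab
      by (simp add: G_algebra_isometry[OF C_action] flip: \<gamma>_diff)
    also have "\<dots> \<le> K * nrm A (?a \<ominus> ?b)" using K(2) a' b by simp
    also have "\<dots> \<le> K * e1" using U1(3) h K(1) by (intro mult_left_mono) (auto intro: less_imp_le)
    finally have "nrm C (\<gamma> h (f ?a) \<ominus>\<^bsub>C\<^esub> \<gamma> h (f ?b)) \<le> e / 2" using e1 by simp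
    moreover have "nrm C (\<gamma> h (f ?a) \<ominus>\<^bsub>C\<^esub> \<gamma> g (f ?b))
      \<le> nrm C (\<gamma> h (f ?a) \<ominus>\<^bsub>C\<^esub> \<gamma> h (f ?b)) + nrm C (\<gamma> h (f ?b) \<ominus>\<^bsub>C\<^esub> \<gamma> g (f ?b))"
      using liftsD(2)[OF f a'] liftsD(2)[OF f b] hG g by (intro C.nrm_diff_triangle) auto
    ultimately show "nrm C (lift_act h f a \<ominus>\<^bsub>C\<^esub> lift_act g f a) < e"
      using U2(3)[of h] h a by (simp add: lift_act_apply)
  qed
qed

text \<open>Compactness of the group, applied to neighbourhoods that control the finitely many
  values of maps in \<open>F\<close> at basis vectors; \<open>linear_bound\<close> upgrades
  closeness on the basis to closeness in operator norm.\<close>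

lemma lift_finite_net:
  assumes F: "finite F" "F \<subseteq> lifts" and e: "0 < e"
  shows "\<exists>H. finite H \<and> H \<subseteq> carrier G \<and> (\<forall>g\<in>carrier G. \<exists>h\<in>H. \<forall>v\<in>F. lift_dist (lift_act g v) (lift_act h v) \<le> e)"
proof -
  note top = unital_G_algebraD(2)[OF A_action]
  define e1 where "e1 = e / (linear_bound + 1)"
  have e1: "0 < e1" "linear_bound * e1 \<le> e"
    using e linear_bound_nonneg by (auto simp: e1_def field_simps)
  have "\<exists>U. openin T U \<and> g \<in> U \<and>
      (\<forall>h\<in>U. \<forall>p\<in>F \<times> B. nrm C (lift_act h (fst p) (snd p) \<ominus>\<^bsub>C\<^esub> lift_act g (fst p) (snd p)) < e1)"
    if g: "g \<in> carrier G" for g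
  proof -
    have "\<exists>U. openin T U \<and> g \<in> U \<and> (\<forall>h\<in>U. nrm C (lift_act h (fst p) (snd p) \<ominus>\<^bsub>C\<^esub> lift_act g (fst p) (snd p)) < e1)"
      if p: "p \<in> F \<times> B" for p
    proof -
      have "fst p \<in> lifts" "snd p \<in> carrier A" using p F by auto
      then show ?thesis using lift_orbit_nbhd[OF _ _ g e1(1)] by metis
    qed
    then obtain U where U: "\<And>p. p \<in> F \<times> B \<Longrightarrow> openin T (U p) \<and> g \<in> U p \<and>
      (\<forall>h\<in>U p. nrm C (lift_act h (fst p) (snd p) \<ominus>\<^bsub>C\<^esub> lift_act g (fst p) (snd p)) < e1)" by metis
    have "openin T ((\<Inter>p\<in>F \<times> B. U p) \<inter> topspace T)"
      using F finite_B U by (intro openin_INT) auto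
    then show ?thesis using U g top by (intro exI[of _ "(\<Inter>p\<in>F \<times> B. U p) \<inter> topspace T"]) auto
  qed
  then obtain U where U: "\<And>g. g \<in> carrier G \<Longrightarrow> openin T (U g)" "\<And>g. g \<in> carrier G \<Longrightarrow> g \<in> U g"
    "\<And>g h p. \<lbrakk>g \<in> carrier G; h \<in> U g; p \<in> F \<times> B\<rbrakk>
       \<Longrightarrow> nrm C (lift_act h (fst p) (snd p) \<ominus>\<^bsub>C\<^esub> lift_act g (fst p) (snd p)) < e1"
    by metis
  have "compactin T (carrier G)" using compact top by (simp add: compact_space_def)
  moreover have "carrier G \<subseteq> \<Union>(U ` carrier G)" using U(2) by blast
  ultimately obtain \<F> where \<F>: "finite \<F>" "\<F> \<subseteq> U ` carrier G" "carrier G \<subseteq> \<Union>\<F>"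
    using U(1) unfolding compactin_def by (metis (no_types, lifting) imageE)
  obtain H where H: "finite H" "H \<subseteq> carrier G" "\<F> = U ` H"
    using finite_subset_image[OF \<F>(1,2)] by blast
  have "\<exists>h\<in>H. \<forall>v\<in>F. lift_dist (lift_act g v) (lift_act h v) \<le> e" if g: "g \<in> carrier G" for g
  proof -
    obtain h where h: "h \<in> H" "g \<in> U h" using \<F>(3) H(3) g by blast
    have hG: "h \<in> carrier G" using h H by blast
    have "lift_dist (lift_act g v) (lift_act h v) \<le> e" if v: "v \<in> F" for v
    proof (rule lift_dist_least)
      fix a assume a: "a \<in> carrier A" "nrm A a \<le> 1"
      have lin: "clinear_map A C (\<lambda>a. lift_act g v a \<ominus>\<^bsub>C\<^esub> lift_act h v a)"
        using v F g hG by (intro difference_linear liftsD(1) lift_act_closed) auto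
      have "nrm C (lift_act g v a \<ominus>\<^bsub>C\<^esub> lift_act h v a) \<le> linear_bound * e1 * nrm A a"
        using nrm_linear_le[OF C.star_normed_algebra_axioms lin, of e1 a] e1 U(3)[OF hG h(2)] v a by (force intro: less_imp_le)
      also have "\<dots> \<le> e * 1" using e1 a e nrm_nonneg[OF a(1)] by (intro mult_mono) auto
      finally show "nrm C (lift_act g v a \<ominus>\<^bsub>C\<^esub> lift_act h v a) \<le> e" by simp
    qed
    then show ?thesis using h by blast
  qed
  then show ?thesis using H by blast
qed

sublocale averaging: isometric_averaging G lifts lift_dist lift_act lift_avg
proof
  show "lifts \<noteq> {}" by (rule linear_lift_exists)
  fix f h k
  show "0 \<le> lift_dist f h" if "f \<in> lifts" "h \<in> lifts" using that by (rule lift_dist_nonneg)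
  show "lift_dist f h = lift_dist h f" if "f \<in> lifts" "h \<in> lifts"
    unfolding lift_dist_def using that liftsD(2) by (intro SUP_cong) (auto simp: C.nrm_diff_commute)
  show "lift_dist f k \<le> lift_dist f h + lift_dist h k" if "f \<in> lifts" "h \<in> lifts" "k \<in> lifts"
  proof (rule lift_dist_least)
    fix a assume "a \<in> carrier A" "nrm A a \<le> 1"
    then show "nrm C (f a \<ominus>\<^bsub>C\<^esub> k a) \<le> lift_dist f h + lift_dist h k"
      using that liftsD(2) by (intro order.trans[OF C.nrm_diff_triangle[of _ "h a"]] add_mono lift_dist_upper) auto
  qed
  show "lift_act g f \<in> lifts" if "g \<in> carrier G" "f \<in> lifts" for g using that by (rule lift_act_closed)
  show "lift_dist (lift_act g f) (lift_act g h) = lift_dist f h"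
    if g: "g \<in> carrier G" and fh: "f \<in> lifts" "h \<in> lifts" for g
  proof (rule antisym)
    show "lift_dist (lift_act g f) (lift_act g h) \<le> lift_dist f h" using g fh by (rule lift_act_dist_le)
    have "lift_dist (lift_act (inv\<^bsub>G\<^esub> g) (lift_act g f)) (lift_act (inv\<^bsub>G\<^esub> g) (lift_act g h))
      \<le> lift_dist (lift_act g f) (lift_act g h)"
      using g fh lift_act_closed by (intro lift_act_dist_le) auto
    then show "lift_dist f h \<le> lift_dist (lift_act g f) (lift_act g h)" using g fh by (simp add: lift_act_inv)
  qed
qed (use lifts_complete lift_act_mult lift_avg_closed lift_avg_dist lift_avg_const lift_act_avg lift_finite_net in auto)

text \<open>The fixed lift \<open>f\<close> is equivariant, but need not respect adjoints. Averaging
  it with its conjugate repairs this, and spoils neither equivariance nor the lifting property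
  because both actions and \<phi> preserve adjoints.\<close>

lemma equivariant_star_linear_lift:
  obtains f where "fd_to_normed.star_linear A C f"
    "\<And>a. a \<in> carrier A \<Longrightarrow> J +>\<^bsub>C\<^esub> f a = \<phi> a"
    "\<And>g a. \<lbrakk>g \<in> carrier G; a \<in> carrier A\<rbrakk> \<Longrightarrow> f (\<alpha> g a) = \<gamma> g (f a)"
proof -
  interpret AC: fd_to_normed A B C ..
  obtain f where f: "f \<in> lifts" "\<And>g. g \<in> carrier G \<Longrightarrow> lift_dist (lift_act g f) f = 0"
    using averaging.fixed_point by blast
  note fc = liftsD(2)[OF f(1)] and lin = clinear_mapD[OF liftsD(1)[OF f(1)]] and fJ = liftsD(3)[OF f(1)]
  \<comment> \<open>Distance 0 in \<open>lift_dist\<close> becomes equality on the carrier.\<close>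
  have fix_f: "lift_act g f a = f a" if g: "g \<in> carrier G" and a: "a \<in> carrier A" for g a
  proof -
    have c: "lift_act g f a \<in> carrier C" using liftsD(2) lift_act_closed g f(1) a by blast
    then have "nrm C (lift_act g f a \<ominus>\<^bsub>C\<^esub> f a) \<le> 0"
      using lift_dist_scaled[OF lift_act_closed[OF g f(1)] f(1) a] f(2)[OF g] by simp
    then show ?thesis
      using c fc[OF a] C.nrm_nonneg[of "lift_act g f a \<ominus>\<^bsub>C\<^esub> f a"] C.nrm_eq_0_iff[of "lift_act g f a \<ominus>\<^bsub>C\<^esub> f a"]
      by (simp add: C.minus_eq_zero_iff)
  qed
  have eq: "f (\<alpha> g a) = \<gamma> g (f a)" if g: "g \<in> carrier G" and a: "a \<in> carrier A" for g a
    using fix_f[OF g, of "\<alpha> g a"] g a by (simp add: lift_act_apply G_algebra_inv[OF A_action])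
  define F where "F a = (1/2) \<odot>\<^bsub>C\<^esub> (f a \<oplus>\<^bsub>C\<^esub> adj C (f (adj A a)))" for a
  have "x \<oplus>\<^bsub>C\<^esub> y \<oplus>\<^bsub>C\<^esub> (z \<oplus>\<^bsub>C\<^esub> w) = (x \<oplus>\<^bsub>C\<^esub> z) \<oplus>\<^bsub>C\<^esub> (y \<oplus>\<^bsub>C\<^esub> w)"
    if "x \<in> carrier C" "y \<in> carrier C" "z \<in> carrier C" "w \<in> carrier C" for x y z w
    using that by algebra
  then have "AC.star_linear F"
    by (auto simp: AC.star_linear_def clinear_map_def F_def fc lin adj_add adj_smult C.adj_add C.adj_smult
        C.smult_add_right C.smult_smult mult.commute C.a_comm)
  moreover have "J +>\<^bsub>C\<^esub> F a = \<phi> a" if a: "a \<in> carrier A" for a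
  proof -
    interpret Q: star_normed_algebra C.Q by (rule C.star_normed_quotient)
    have "J +>\<^bsub>C\<^esub> F a = (1/2) \<odot>\<^bsub>C.Q\<^esub> (\<phi> a \<oplus>\<^bsub>C.Q\<^esub> adj C.Q (\<phi> (adj A a)))"
      using a fc fJ[of a] fJ[of "adj A a"]
      by (simp add: F_def flip: C.quotient_smult C.quotient_add C.quotient_adj)
    also have "\<dots> = \<phi> a"
      using a \<phi>D(1)[OF a] \<phi>D(6)[OF a] by (simp add: Q.smult_add_right Q.smult_half_add)
    finally show ?thesis .
  qed
  moreover have "F (\<alpha> g a) = \<gamma> g (F a)" if g: "g \<in> carrier G" and a: "a \<in> carrier A" for g a
    using g a fc by (simp add: F_def \<gamma>D(3,5,6) eq flip: \<alpha>D(6))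
  ultimately show ?thesis using that by blast
qed

end

section \<open>Semiprojectivity\<close>

text \<open>\<open>unital_star_hom_contractive\<close> speaks of C*-algebras; for maps between
  quotients, contractivity on representatives is passed to the infimum instead. It serves the
  canonical map, with \<open>f\<close> the identity, and the action of a group element.\<close>

lemma quotient_map_contractive:
  assumes I: "cstar_ideal A I" and J: "cstar_ideal A J" and x: "x \<in> carrier A"
    and f: "\<And>y. y \<in> carrier A \<Longrightarrow> f y \<in> carrier A \<and> nrm A (f y) \<le> nrm A y"
    and eq: "\<And>y. \<lbrakk>y \<in> carrier A; I +>\<^bsub>A\<^esub> y = I +>\<^bsub>A\<^esub> x\<rbrakk> \<Longrightarrow> J +>\<^bsub>A\<^esub> f y = J +>\<^bsub>A\<^esub> f x"
  shows "nrm (cstar_quotient A J) (J +>\<^bsub>A\<^esub> f x) \<le> nrm (cstar_quotient A I) (I +>\<^bsub>A\<^esub> x)"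
proof (rule field_le_epsilon)
  interpret I: cstar_ideal A I by fact
  interpret J: cstar_ideal A J by fact
  fix e :: real assume "e > 0"
  then obtain y where y: "y \<in> carrier A" "I +>\<^bsub>A\<^esub> y = I +>\<^bsub>A\<^esub> x" "nrm A y < nrm I.Q (I +>\<^bsub>A\<^esub> x) + e"
    using I.quotient_nrm_approx[OF x, of "nrm I.Q (I +>\<^bsub>A\<^esub> x) + e"] by auto
  have "nrm J.Q (J +>\<^bsub>A\<^esub> f x) \<le> nrm A (f y)"
    using J.quotient_nrm_le[of "f y"] f[OF y(1)] eq[OF y(1,2)] by simp
  also have "\<dots> \<le> nrm A y" using f[OF y(1)] by simp
  finally show "nrm J.Q (J +>\<^bsub>A\<^esub> f x) \<le> nrm I.Q (I +>\<^bsub>A\<^esub> x) + e" using y(3) by simp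
qed

text \<open>Approximation from the union survives the ring operations because multiplication by a
  fixed element is Lipschitz and because two approximants can be moved to a common member of the
  increasing family.\<close>

lemma (in unital_cstar_algebra) closed_ideal_closure_Union:
  assumes I: "\<And>n. closed_ideal A (I n)" and mono: "\<And>n. I n \<subseteq> I (Suc n)"
    and J: "J = norm_topology A closure_of (\<Union>n. I n)"
  shows "closed_ideal A J"
proof -
  have id: "ideal (I n) A" for n using I by (simp add: closed_ideal_def)
  have sub: "(\<Union>n. I n) \<subseteq> carrier A" using ideal.Icarr[OF id] by blast
  have J_iff: "x \<in> J \<longleftrightarrow> x \<in> carrier A \<and> (\<forall>e>0. \<exists>n. \<exists>y\<in>I n. nrm A (x \<ominus> y) < e)" for x
    unfolding J closure_of_approx[OF sub] by blast
  have Ic: "y \<in> carrier A" if "y \<in> I n" for y n using ideal.Icarr[OF id that] .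
  have mono': "I m \<subseteq> I n" if "m \<le> n" for m n using mono that by (rule lift_Suc_mono_le)
  have zero: "\<zero> \<in> I n" for n
    using additive_subgroup.zero_closed[OF ideal.axioms(1)[OF id]] .
  have add: "x \<oplus> y \<in> J" if xy: "x \<in> J" "y \<in> J" for x y
    unfolding J_iff
  proof (intro conjI allI impI)
    have c: "x \<in> carrier A" "y \<in> carrier A" using xy J_iff by auto
    show "x \<oplus> y \<in> carrier A" using c by simp
    fix e :: real assume "e > 0"
    then obtain m n x' y' where *: "x' \<in> I m" "nrm A (x \<ominus> x') < e/2" "y' \<in> I n" "nrm A (y \<ominus> y') < e/2"
      using xy unfolding J_iff by (meson half_gt_zero)
    have c': "x' \<in> carrier A" "y' \<in> carrier A" using * Ic by auto
    have "x' \<in> I (max m n)" "y' \<in> I (max m n)" using * mono'[of m "max m n"] mono'[of n "max m n"] by auto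
    then have "x' \<oplus> y' \<in> I (max m n)"
      using additive_subgroup.a_closed[OF ideal.axioms(1)[OF id]] by blast
    moreover have "x \<oplus> y \<ominus> (x' \<oplus> y') = (x \<ominus> x') \<oplus> (y \<ominus> y')" using c c' by algebra
    then have "nrm A (x \<oplus> y \<ominus> (x' \<oplus> y')) \<le> nrm A (x \<ominus> x') + nrm A (y \<ominus> y')"
      using c c' nrm_triangle by simp
    with * have "nrm A (x \<oplus> y \<ominus> (x' \<oplus> y')) < e" by linarith
    ultimately show "\<exists>n. \<exists>z\<in>I n. nrm A (x \<oplus> y \<ominus> z) < e" by blast
  qed
  have mult: "a \<otimes> x \<in> J \<and> x \<otimes> a \<in> J" if x: "x \<in> J" and a: "a \<in> carrier A" for a x
  proof -
    have xc: "x \<in> carrier A" using x J_iff by auto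
    have "\<exists>n. \<exists>y\<in>I n. nrm A (a \<otimes> x \<ominus> a \<otimes> y) < e \<and> nrm A (x \<otimes> a \<ominus> y \<otimes> a) < e" if e: "e > 0" for e
    proof -
      have pos: "0 < nrm A a + 1" using nrm_nonneg[OF a] by simp
      then have "0 < e / (nrm A a + 1)" using e by simp
      then obtain n y where y: "y \<in> I n" "nrm A (x \<ominus> y) < e / (nrm A a + 1)"
        using x unfolding J_iff by blast
      have yc: "y \<in> carrier A" using y Ic by blast
      have b: "nrm A a * nrm A (x \<ominus> y) < e"
      proof -
        have "nrm A a * nrm A (x \<ominus> y) \<le> (nrm A a + 1) * nrm A (x \<ominus> y)"
          using nrm_nonneg xc yc by (intro mult_right_mono) auto
        also have "\<dots> < e" using y(2) pos by (simp add: field_simps)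
        finally show ?thesis .
      qed
      have "a \<otimes> x \<ominus> a \<otimes> y = a \<otimes> (x \<ominus> y)" "x \<otimes> a \<ominus> y \<otimes> a = (x \<ominus> y) \<otimes> a"
        using a xc yc by algebra+
      then have "nrm A (a \<otimes> x \<ominus> a \<otimes> y) < e" "nrm A (x \<otimes> a \<ominus> y \<otimes> a) < e"
        using nrm_mult[of a "x \<ominus> y"] nrm_mult[of "x \<ominus> y" a] a xc yc b by (auto simp: mult.commute)
      then show ?thesis using y(1) by blast
    qed
    then show ?thesis
      unfolding J_iff using a xc ideal.I_l_closed[OF id _ a] ideal.I_r_closed[OF id _ a] by (metis m_closed)
  qed
  have "ideal J A"
  proof (rule idealI[OF ring_axioms])
    show "subgroup J (add_monoid A)"
    proof
      show "J \<subseteq> carrier (add_monoid A)" using J_iff by auto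
      show "x \<otimes>\<^bsub>add_monoid A\<^esub> y \<in> J" if "x \<in> J" "y \<in> J" for x y using add that by simp
      have "\<zero> \<in> J" unfolding J_iff using zero by (metis minus_self nrm_zero zero_closed)
      then show "\<one>\<^bsub>add_monoid A\<^esub> \<in> J" by simp
      show "inv\<^bsub>add_monoid A\<^esub> x \<in> J" if x: "x \<in> J" for x
      proof -
        have xc: "x \<in> carrier A" using x J_iff by auto
        have "(\<ominus> \<one>) \<otimes> x \<in> J" using mult[OF x, of "\<ominus> \<one>"] by simp
        then show ?thesis using xc by (simp add: l_minus a_inv_def[symmetric])
      qed
    qed
  qed (use mult in auto)
  moreover have "closedin (norm_topology A) J" unfolding J by simp
  ultimately show ?thesis by (simp add: closed_ideal_def)
qed

text \<open>Group elements act isometrically, so an approximation from \<open>S\<close> is carried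
  to an approximation of the same quality.\<close>

lemma G_algebra_closure_invariant:
  assumes A: "unital_G_algebra G T A \<alpha>" and S: "S \<subseteq> carrier A" "\<And>g. g \<in> carrier G \<Longrightarrow> \<alpha> g ` S \<subseteq> S"
    and g: "g \<in> carrier G"
  shows "\<alpha> g ` (norm_topology A closure_of S) \<subseteq> norm_topology A closure_of S"
proof
  interpret unital_cstar_algebra A using unital_G_algebraD(4)[OF A] .
  note h = unital_star_homD[OF unital_G_algebraD(6)[OF A g]]
  fix y assume "y \<in> \<alpha> g ` (norm_topology A closure_of S)"
  then obtain x where "y = \<alpha> g x" "x \<in> norm_topology A closure_of S" by (rule imageE)
  then have x: "y = \<alpha> g x" "x \<in> carrier A" "\<forall>e>0. \<exists>s\<in>S. nrm A (x \<ominus>\<^bsub>A\<^esub> s) < e"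
    by (simp_all add: closure_of_approx[OF S(1)])
  have "\<exists>s\<in>S. nrm A (y \<ominus>\<^bsub>A\<^esub> s) < e" if e: "e > 0" for e
  proof -
    obtain s where s: "s \<in> S" "nrm A (x \<ominus>\<^bsub>A\<^esub> s) < e" using x(3) e by blast
    have sc: "s \<in> carrier A" using s S by blast
    have "\<alpha> g x \<ominus>\<^bsub>A\<^esub> \<alpha> g s = \<alpha> g (x \<ominus>\<^bsub>A\<^esub> s)"
      using h(3)[of x "\<ominus>\<^bsub>A\<^esub> s"] h(5)[of s "-1"] x(2) sc h(1)[of s] by (simp add: a_minus_def smult_neg1)
    then have "nrm A (y \<ominus>\<^bsub>A\<^esub> \<alpha> g s) < e"
      using s sc x(1,2) G_algebra_isometry[OF A g] by simp
    then show ?thesis using S(2)[OF g] s(1) by blast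
  qed
  then show "y \<in> norm_topology A closure_of S"
    unfolding closure_of_approx[OF S(1)] using x h(1) by blast
qed

context equivariant_lifting
begin

text \<open>
  The Newton iteration is natural, so it commutes with the group and stays above \<open>\<phi>\<close>; hence so does its limit.
\<close>

lemma lift_to_quotient:
  assumes I: "\<And>n. invariant_ideal G C \<gamma> (I n)" and mono: "\<And>n. I n \<subseteq> I (Suc n)"
    and J: "J = norm_topology C closure_of (\<Union>n. I n)"
  shows "\<exists>n \<psi>. unital_equivariant_hom G A \<alpha> (cstar_quotient C (I n)) (quotient_action C (I n) \<gamma>) \<psi> \<and>
    (\<forall>a\<in>carrier A. coset_map C J (\<lambda>x. x) (\<psi> a) = \<phi> a)"
proof -
  interpret AC: fd_to_normed A B C ..
  have cI: "cstar_ideal C (I n)" for n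
    using I by (simp add: cstar_ideal_def cstar_ideal_axioms_def C.unital_cstar_algebra_axioms invariant_ideal_def)
  have idI: "ideal (I n) C" for n using I by (simp add: invariant_ideal_def closed_ideal_def)
  obtain f where f: "AC.star_linear f" and fJ: "\<And>a. a \<in> carrier A \<Longrightarrow> J +>\<^bsub>C\<^esub> f a = \<phi> a"
    and feq: "\<And>g a. \<lbrakk>g \<in> carrier G; a \<in> carrier A\<rbrakk> \<Longrightarrow> f (\<alpha> g a) = \<gamma> g (f a)"
    using equivariant_star_linear_lift by blast
  note fD = AC.star_linearD[OF f]
  obtain M where M: "0 \<le> M" "\<And>x. x \<in> carrier A \<Longrightarrow> nrm C (f x) \<le> M * nrm A x"
    using linear_bounded[OF C.star_normed_algebra_axioms, of f] f by (auto simp: AC.star_linear_def)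
  have dJ: "AC.defect f a b \<in> J" if ab: "a \<in> carrier A" "b \<in> carrier A" for a b
  proof -
    have "J +>\<^bsub>C\<^esub> f (a \<otimes> b) = J +>\<^bsub>C\<^esub> (f a \<otimes>\<^bsub>C\<^esub> f b)"
      using ab fD(1) \<phi>D(2)[OF ab] by (simp add: fJ flip: C.quotient_mult)
    then show ?thesis using ab fD(1) by (simp add: AC.defect_def C.rcoset_eq_iff)
  qed
  have oneJ: "f \<one> \<ominus>\<^bsub>C\<^esub> \<one>\<^bsub>C\<^esub> \<in> J"
  proof -
    have "J +>\<^bsub>C\<^esub> f \<one> = J +>\<^bsub>C\<^esub> \<one>\<^bsub>C\<^esub>" using \<phi>D(4) by (simp add: fJ C.quotient_one)
    then show ?thesis using fD(1) by (simp add: C.rcoset_eq_iff)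
  qed
  \<comment> \<open>The sum of the coefficients of \<delta> in the two smallness conditions of
    \<open>newton_converges\<close>, so that k * \<delta> \<le> 1/8 yields both.\<close>
  define k where "k = 2 * AC.diag_bound + (AC.diag_bound * (M + 1))\<^sup>2 + 2 * AC.diag_bound * (M + 1)"
  have k: "0 \<le> k" using AC.diag_bound_nonneg M(1) by (simp add: k_def)
  define \<delta> where "\<delta> = 1 / (8 * (k + 1))"
  have \<delta>: "0 < \<delta>" "k * \<delta> \<le> 1/8" using k by (auto simp: \<delta>_def field_simps)
  \<comment> \<open>Extending a bound from pairs of basis vectors to all pairs applies
    \<open>nrm_linear_le\<close> in each variable and loses \<open>linear_bound\<close>
    twice.\<close>
  define \<epsilon> where "\<epsilon> = \<delta> / (linear_bound * linear_bound + 1)"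
  have \<epsilon>: "0 < \<epsilon>" "linear_bound * linear_bound * \<epsilon> \<le> \<delta>"
    using \<delta>(1) add_nonneg_pos[of "linear_bound * linear_bound" 1] linear_bound_nonneg
    by (auto simp: \<epsilon>_def divide_simps mult_left_mono algebra_simps)
  \<comment> \<open>An element of \<open>J\<close> is within \<open>e\<close> of some
    \<open>y\<close> in \<open>I m\<close>, and \<open>y\<close> vanishes modulo every later
    ideal.\<close>
  have small: "eventually (\<lambda>n. nrm (cstar_quotient C (I n)) (I n +>\<^bsub>C\<^esub> z) \<le> e) sequentially"
    if z: "z \<in> J" and e: "0 < e" for z e
  proof -
    have sub: "(\<Union>n. I n) \<subseteq> carrier C" using ideal.Icarr[OF idI] by blast
    obtain m y where y: "y \<in> I m" "nrm C (z \<ominus>\<^bsub>C\<^esub> y) < e"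
      using z e unfolding J C.closure_of_approx[OF sub] by blast
    have zc: "z \<in> carrier C" and yc: "y \<in> carrier C" using z C.Icarr y ideal.Icarr[OF idI] by auto
    have "nrm (cstar_quotient C (I n)) (I n +>\<^bsub>C\<^esub> z) \<le> e" if n: "m \<le> n" for n
    proof -
      interpret In: cstar_ideal C "I n" by (rule cI)
      have "y \<in> I n" using lift_Suc_mono_le[of I m n] mono n y(1) by blast
      then have "I n +>\<^bsub>C\<^esub> z = I n +>\<^bsub>C\<^esub> (z \<ominus>\<^bsub>C\<^esub> y)"
        using zc yc by (subst In.rcoset_eq_iff) (auto simp: a_minus_def C.minus_add C.r_neg simp flip: C.a_assoc)
      then show ?thesis using In.quotient_nrm_le[of "z \<ominus>\<^bsub>C\<^esub> y"] zc yc y(2) by simp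
    qed
    then show ?thesis by (auto simp: eventually_sequentially)
  qed
  \<comment> \<open>The defect has only finitely many values on pairs of basis vectors, so a common
    \<open>n\<close> exists.\<close>
  have "eventually (\<lambda>n. \<forall>b\<in>B. \<forall>d\<in>B. nrm (cstar_quotient C (I n)) (I n +>\<^bsub>C\<^esub> AC.defect f b d) \<le> \<epsilon>) sequentially"
    using finite_B \<epsilon>(1) dJ by (intro eventually_ball_finite ballI small) auto
  moreover have "eventually (\<lambda>n. nrm (cstar_quotient C (I n)) (I n +>\<^bsub>C\<^esub> (f \<one> \<ominus>\<^bsub>C\<^esub> \<one>\<^bsub>C\<^esub>)) \<le> 1/8) sequentially"
    using oneJ by (intro small) auto
  ultimately have "eventually (\<lambda>n. (\<forall>b\<in>B. \<forall>d\<in>B. nrm (cstar_quotient C (I n)) (I n +>\<^bsub>C\<^esub> AC.defect f b d) \<le> \<epsilon>)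
    \<and> nrm (cstar_quotient C (I n)) (I n +>\<^bsub>C\<^esub> (f \<one> \<ominus>\<^bsub>C\<^esub> \<one>\<^bsub>C\<^esub>)) \<le> 1/8) sequentially"
    by (rule eventually_conj)
  then obtain n where n: "\<And>b d. \<lbrakk>b \<in> B; d \<in> B\<rbrakk> \<Longrightarrow> nrm (cstar_quotient C (I n)) (I n +>\<^bsub>C\<^esub> AC.defect f b d) \<le> \<epsilon>"
    "nrm (cstar_quotient C (I n)) (I n +>\<^bsub>C\<^esub> (f \<one> \<ominus>\<^bsub>C\<^esub> \<one>\<^bsub>C\<^esub>)) \<le> 1/8"
    by (auto simp: eventually_sequentially)
  define K where "K = I n"
  interpret K: cstar_ideal C K unfolding K_def by (rule cI)
  interpret KQ: banach_star_algebra K.Q by (rule K.banach_quotient)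
  interpret JQ: banach_star_algebra C.Q by (rule C.banach_quotient)
  interpret AK: fd_to_banach A B K.Q ..
  interpret AJ: fd_to_normed A B C.Q ..
  have K_inv: "\<gamma> g ` K \<subseteq> K" if "g \<in> carrier G" for g
    using I that by (simp add: invariant_ideal_def K_def)
  have KJ: "K \<subseteq> J"
    unfolding J K_def using ideal.Icarr[OF idI] by (intro order.trans[OF _ closure_of_subset]) auto
  define u where "u a = K +>\<^bsub>C\<^esub> f a" for a
  have u: "AK.star_linear u"
    using fD by (simp add: AK.star_linear_def clinear_map_def u_def K.quotient_add K.quotient_smult K.quotient_adj)
  have u_defect: "AK.defect u a b = K +>\<^bsub>C\<^esub> AC.defect f a b" if "a \<in> carrier A" "b \<in> carrier A" for a b
    using that fD(1) by (simp add: AK.defect_def AC.defect_def u_def K.quotient_mult K.quotient_minus)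
  have uM: "nrm K.Q (u x) \<le> M * nrm A x" if "x \<in> carrier A" for x
    using K.quotient_nrm_le[of "f x"] M(2)[OF that] fD(1)[OF that] by (simp add: u_def)
  have u_one: "nrm K.Q (u \<one> \<ominus>\<^bsub>K.Q\<^esub> \<one>\<^bsub>K.Q\<^esub>) \<le> 1/8"
    using n(2) fD(1)[of \<one>] by (simp add: u_def K.quotient_one K.quotient_minus K_def[symmetric])
  have u_\<delta>: "nrm K.Q (AK.defect u a b) \<le> \<delta> * (nrm A a * nrm A b)" if ab: "a \<in> carrier A" "b \<in> carrier A" for a b
  proof -
    have bil: "\<And>y. y \<in> carrier A \<Longrightarrow> clinear_map A K.Q (AK.defect u y)"
      "\<And>y. y \<in> carrier A \<Longrightarrow> clinear_map A K.Q (\<lambda>x. AK.defect u x y)"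
      using AK.defect_bilinear[OF u] by (auto simp: AK.bilinear_def)
    have 1: "nrm K.Q (AK.defect u a d) \<le> linear_bound * \<epsilon> * nrm A a" if d: "d \<in> B" for d
    proof (rule nrm_linear_le[OF KQ.star_normed_algebra_axioms bil(2)])
      show "nrm K.Q (AK.defect u b d) \<le> \<epsilon>" if "b \<in> B" for b
        using n(1)[OF that d] that d by (simp add: u_defect K_def[symmetric])
    qed (use d ab \<epsilon>(1) in auto)
    have "nrm K.Q (AK.defect u a b) \<le> linear_bound * (linear_bound * \<epsilon> * nrm A a) * nrm A b"
      using ab \<epsilon>(1) linear_bound_nonneg nrm_nonneg
      by (intro nrm_linear_le[OF KQ.star_normed_algebra_axioms bil(1)] 1) auto
    also have "\<dots> = (linear_bound * linear_bound * \<epsilon>) * (nrm A a * nrm A b)" by (simp add: mult_ac)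
    also have "\<dots> \<le> \<delta> * (nrm A a * nrm A b)"
      using \<epsilon>(2) ab nrm_nonneg by (intro mult_right_mono) auto
    finally show ?thesis .
  qed
  have parts: "0 \<le> 2 * AC.diag_bound + (AC.diag_bound * (M + 1))\<^sup>2" "0 \<le> 2 * AC.diag_bound * (M + 1)"
    using AC.diag_bound_nonneg M(1) by auto
  have "(2 * AC.diag_bound + (AC.diag_bound * (M + 1))\<^sup>2) * \<delta> \<le> k * \<delta>" "2 * AC.diag_bound * (M + 1) * \<delta> \<le> k * \<delta>"
    using \<delta>(1) parts by (auto simp: k_def intro!: mult_right_mono)
  then have smalls: "(2 * AK.diag_bound + (AK.diag_bound * (M + 1))\<^sup>2) * \<delta> \<le> 1/4" "2 * AK.diag_bound * (M + 1) * \<delta> \<le> 1/8"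
    using \<delta>(2) by auto
  obtain \<psi> where \<psi>: "unital_star_hom A K.Q \<psi>"
    "\<And>x. x \<in> carrier A \<Longrightarrow> KQ.tends (\<lambda>n. (AK.newton ^^ n) u x) (\<psi> x)"
    using AK.newton_converges[OF u M(1) uM u_one less_imp_le[OF \<delta>(1)] u_\<delta> smalls] by blast
  define t where "t m = (AK.newton ^^ m) u" for m
  have t0: "t 0 = u" and tS: "t (Suc m) = AK.newton (t m)" for m by (simp_all add: t_def)
  have t: "AK.star_linear (t m)" for m
    by (induction m) (auto simp: t0 tS u AK.newton_linear)
  have tc: "t m a \<in> carrier K.Q" if "a \<in> carrier A" for m a using AK.star_linearD(1)[OF t that] .
  have tends: "KQ.tends (\<lambda>m. t m a) (\<psi> a)" if "a \<in> carrier A" for a using \<psi>(2)[OF that] by (simp add: t_def)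
  have \<psi>c: "\<psi> a \<in> carrier K.Q" if "a \<in> carrier A" for a using unital_star_homD(1)[OF \<psi>(1) that] .
  let ?\<theta> = "coset_map C J (\<lambda>x. x)"
  have \<theta>: "?\<theta> (K +>\<^bsub>C\<^esub> x) = J +>\<^bsub>C\<^esub> x" if "x \<in> carrier C" for x
    using KJ that by (intro C.coset_map_rcoset[OF K.ideal_axioms C.ideal_axioms]) auto
  let ?g = "quotient_action C K \<gamma>"
  have qa: "?g g (K +>\<^bsub>C\<^esub> x) = K +>\<^bsub>C\<^esub> \<gamma> g x" if g: "g \<in> carrier G" and x: "x \<in> carrier C" for g x
    unfolding quotient_action_def
  proof (rule C.coset_map_rcoset[OF K.ideal_axioms K.ideal_axioms x])
    fix y assume "y \<in> carrier C" "y \<ominus>\<^bsub>C\<^esub> x \<in> K"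
    then show "\<gamma> g y \<in> carrier C \<and> \<gamma> g y \<ominus>\<^bsub>C\<^esub> \<gamma> g x \<in> K"
      using g x K_inv[OF g] by (auto simp flip: \<gamma>_diff)
  qed
  have \<theta>_diff: "?\<theta> (x \<ominus>\<^bsub>K.Q\<^esub> y) = ?\<theta> x \<ominus>\<^bsub>C.Q\<^esub> ?\<theta> y" if "x \<in> carrier K.Q" "y \<in> carrier K.Q" for x y
    using that by (auto elim!: K.quotientE simp: K.quotient_minus C.quotient_minus \<theta>)
  have \<theta>_nrm: "nrm C.Q (?\<theta> x) \<le> nrm K.Q x" and \<theta>_c: "?\<theta> x \<in> carrier C.Q"
    if x: "x \<in> carrier K.Q" for x
  proof -
    obtain y where y: "y \<in> carrier C" "x = K +>\<^bsub>C\<^esub> y" using x by (rule K.quotientE)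
    show "nrm C.Q (?\<theta> x) \<le> nrm K.Q x"
      unfolding y(2) \<theta>[OF y(1)]
    proof (rule quotient_map_contractive[OF K.cstar_ideal_axioms C.cstar_ideal_axioms y(1), where f = "\<lambda>x. x"])
      show "J +>\<^bsub>C\<^esub> z = J +>\<^bsub>C\<^esub> y" if "z \<in> carrier C" "K +>\<^bsub>C\<^esub> z = K +>\<^bsub>C\<^esub> y" for z
        using that y KJ by (auto simp: K.rcoset_eq_iff C.rcoset_eq_iff)
    qed auto
    show "?\<theta> x \<in> carrier C.Q" using y by (simp add: \<theta>)
  qed
  have g_diff: "?g g (x \<ominus>\<^bsub>K.Q\<^esub> y) = ?g g x \<ominus>\<^bsub>K.Q\<^esub> ?g g y"
    if "g \<in> carrier G" "x \<in> carrier K.Q" "y \<in> carrier K.Q" for g x y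
    using that by (auto elim!: K.quotientE simp: K.quotient_minus qa \<gamma>_diff)
  have g_nrm: "nrm K.Q (?g g x) \<le> nrm K.Q x" and g_c: "?g g x \<in> carrier K.Q"
    if g: "g \<in> carrier G" and x: "x \<in> carrier K.Q" for g x
  proof -
    obtain y where y: "y \<in> carrier C" "x = K +>\<^bsub>C\<^esub> y" using x by (rule K.quotientE)
    show "nrm K.Q (?g g x) \<le> nrm K.Q x"
      unfolding y(2) qa[OF g y(1)]
    proof (rule quotient_map_contractive[OF K.cstar_ideal_axioms K.cstar_ideal_axioms y(1)])
      show "K +>\<^bsub>C\<^esub> \<gamma> g z = K +>\<^bsub>C\<^esub> \<gamma> g y" if "z \<in> carrier C" "K +>\<^bsub>C\<^esub> z = K +>\<^bsub>C\<^esub> y" for z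
        using qa[OF g that(1)] qa[OF g y(1)] that(2) by simp
    qed (use g in \<open>auto simp: G_algebra_isometry[OF C_action]\<close>)
    show "?g g x \<in> carrier K.Q" using y g by (simp add: qa)
  qed
  have t_equivariant: "t m (\<alpha> g a) = ?g g (t m a)" if g: "g \<in> carrier G" and a: "a \<in> carrier A" for m g a
    using a
  proof (induction m arbitrary: a)
    case 0
    then show ?case using g fD(1) by (simp add: t0 u_def feq qa)
  next
    case (Suc m)
    \<comment> \<open>One step commutes with \<alpha> on the source side by invariance of the
      diagonal, and with the action on the quotient by naturality; the induction hypothesis
      identifies the two maps in between.\<close>
    have "t (Suc m) (\<alpha> g a) = AK.newton (\<lambda>x. t m (\<alpha> g x)) a"
      unfolding tS using g Suc.prems
      by (intro AK.newton_automorphism[OF t, symmetric] unital_G_algebraD(5)[OF A_action]) auto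
    also have "\<dots> = ?g g (AK.newton (t m) a)"
    proof (rule newton_natural[OF AK.fd_to_normed_axioms AK.fd_to_normed_axioms t])
      show "clinear_map K.Q K.Q (?g g)"
        unfolding clinear_map_def using g
        by (auto elim!: K.quotientE simp: qa K.quotient_add K.quotient_smult \<gamma>D(3,5))
      show "?g g (x \<otimes>\<^bsub>K.Q\<^esub> y) = ?g g x \<otimes>\<^bsub>K.Q\<^esub> ?g g y" if "x \<in> carrier K.Q" "y \<in> carrier K.Q" for x y
        using that g by (auto elim!: K.quotientE simp: qa K.quotient_mult \<gamma>D(2))
      show "?g g (adj K.Q x) = adj K.Q (?g g x)" if "x \<in> carrier K.Q" for x
        using that g by (auto elim!: K.quotientE simp: qa K.quotient_adj \<gamma>D(6))
    qed (use Suc in auto)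
    finally show ?case by (simp add: tS)
  qed
  have \<psi>_equivariant: "\<psi> (\<alpha> g a) = ?g g (\<psi> a)" if g: "g \<in> carrier G" and a: "a \<in> carrier A" for g a
  proof -
    \<comment> \<open>The action on the quotient is contractive, so it passes to the limit.\<close>
    have "KQ.tends (\<lambda>m. ?g g (t m a)) (?g g (\<psi> a))"
    proof (rule KQ.tends_bound)
      show "(\<lambda>m. nrm K.Q (t m a \<ominus>\<^bsub>K.Q\<^esub> \<psi> a)) \<longlonglongrightarrow> 0" using tends[OF a] by (simp add: KQ.tends_def)
      show "nrm K.Q (?g g (t m a) \<ominus>\<^bsub>K.Q\<^esub> ?g g (\<psi> a)) \<le> nrm K.Q (t m a \<ominus>\<^bsub>K.Q\<^esub> \<psi> a)" for m
        using g tc[OF a] \<psi>c[OF a] g_nrm by (simp flip: g_diff)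
    qed (use g a tc \<psi>c g_c in auto)
    then have "KQ.tends (\<lambda>m. t m (\<alpha> g a)) (?g g (\<psi> a))" using g a by (simp add: t_equivariant)
    then show ?thesis using KQ.tends_unique tends g a by (metis \<alpha>_closed)
  qed
  have \<phi>_star: "AJ.star_linear \<phi>"
    using unital_star_hom_linear[OF \<phi>_hom] \<phi>D(6) by (simp add: AJ.star_linear_def)
  have t_lift: "?\<theta> (t m a) = \<phi> a" if a: "a \<in> carrier A" for m a
    using a
  proof (induction m arbitrary: a)
    case 0
    then show ?case using fD(1) by (simp add: t0 u_def \<theta> fJ)
  next
    case (Suc m)
    \<comment> \<open>Pushed down to \<open>C/J\<close>, the iterate is \<phi>, which a Newton step
      leaves unchanged.\<close>
    have "AJ.newton \<phi> a = ?\<theta> (AK.newton (t m) a)"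
    proof (rule newton_natural[OF AK.fd_to_normed_axioms AJ.fd_to_normed_axioms t])
      show "clinear_map K.Q C.Q ?\<theta>"
        unfolding clinear_map_def
        by (auto elim!: K.quotientE simp: \<theta> K.quotient_add K.quotient_smult C.quotient_add C.quotient_smult)
      show "?\<theta> (x \<otimes>\<^bsub>K.Q\<^esub> y) = ?\<theta> x \<otimes>\<^bsub>C.Q\<^esub> ?\<theta> y" if "x \<in> carrier K.Q" "y \<in> carrier K.Q" for x y
        using that by (auto elim!: K.quotientE simp: \<theta> K.quotient_mult C.quotient_mult)
      show "?\<theta> (adj K.Q x) = adj C.Q (?\<theta> x)" if "x \<in> carrier K.Q" for x
        using that by (auto elim!: K.quotientE simp: \<theta> K.quotient_adj C.quotient_adj)
    qed (use Suc in auto)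
    moreover have "AJ.newton \<phi> a = \<phi> a"
      using Suc.prems \<phi>D(2) by (intro AJ.newton_of_hom[OF \<phi>_star]) auto
    ultimately show ?case by (simp add: tS)
  qed
  have \<psi>_lift: "?\<theta> (\<psi> a) = \<phi> a" if a: "a \<in> carrier A" for a
  proof -
    have "JQ.tends (\<lambda>m. ?\<theta> (t m a)) (?\<theta> (\<psi> a))"
    proof (rule JQ.tends_bound)
      show "(\<lambda>m. nrm K.Q (t m a \<ominus>\<^bsub>K.Q\<^esub> \<psi> a)) \<longlonglongrightarrow> 0" using tends[OF a] by (simp add: KQ.tends_def)
      show "nrm C.Q (?\<theta> (t m a) \<ominus>\<^bsub>C.Q\<^esub> ?\<theta> (\<psi> a)) \<le> nrm K.Q (t m a \<ominus>\<^bsub>K.Q\<^esub> \<psi> a)" for m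
        using tc[OF a] \<psi>c[OF a] \<theta>_nrm by (simp flip: \<theta>_diff)
    qed (use a tc \<psi>c \<theta>_c in auto)
    then have "JQ.tends (\<lambda>m. \<phi> a) (?\<theta> (\<psi> a))" using a by (simp add: t_lift)
    then show ?thesis using JQ.tends_unique JQ.tends_const \<phi>D(1)[OF a] by blast
  qed
  show ?thesis
  proof (intro exI conjI ballI)
    show "unital_equivariant_hom G A \<alpha> (cstar_quotient C (I n)) (quotient_action C (I n) \<gamma>) \<psi>"
      using \<psi>(1) \<psi>_equivariant by (simp add: unital_equivariant_hom_def K_def)
  qed (use \<psi>_lift in auto)
qed

end

theorem theorem2p6:
  fixes G :: "'g monoid" and T :: "'g topology"
    and A :: "'a cstar_algebra" and \<alpha> :: "'g \<Rightarrow> 'a \<Rightarrow> 'a"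
  assumes "compact_group G T"
    and "unital_G_algebra G T A \<alpha>"
    and "finite_dimensional A"
  shows "equivariantly_semiprojective TYPE('c) G T A \<alpha>"
  unfolding equivariantly_semiprojective_def
proof (intro allI impI, elim conjE)
  fix C :: "'c cstar_algebra" and \<gamma> and I :: "nat \<Rightarrow> 'c set" and J \<phi>
  assume C: "unital_G_algebra G T C \<gamma>" and I: "\<forall>n. invariant_ideal G C \<gamma> (I n)" and mono: "\<forall>n. I n \<subseteq> I (Suc n)"
    and J: "J = norm_topology C closure_of (\<Union>n. I n)"
    and \<phi>: "unital_equivariant_hom G A \<alpha> (cstar_quotient C J) (quotient_action C J \<gamma>) \<phi>"
  interpret A: unital_cstar_algebra A using unital_G_algebraD(4)[OF assms(2)] .
  interpret C: unital_cstar_algebra C using unital_G_algebraD(4)[OF C] .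
  obtain S where "A.spans S"
    using assms(3) unfolding finite_dimensional_def A.spans_def A.lincomb_def by blast
  then obtain B where B: "A.spans B" "A.lin_independent B"
    using A.spanning_set_contains_basis by blast
  have cl: "closed_ideal C (I n)" for n using I by (simp add: invariant_ideal_def)
  have sub: "(\<Union>n. I n) \<subseteq> carrier C" using cl ideal.Icarr by (fastforce simp: closed_ideal_def)
  have inv: "\<gamma> g ` (\<Union>n. I n) \<subseteq> (\<Union>n. I n)" if "g \<in> carrier G" for g
    using I that unfolding invariant_ideal_def by blast
  \<comment> \<open>The locale asks for a closed invariant ideal \<open>J\<close>; both properties
    are derived from those of the ideals \<open>I n\<close>.\<close>
  have "closed_ideal C J" using C.closed_ideal_closure_Union[of I J] cl mono J by blast
  moreover have "compact_space T" using assms(1) by (simp add: compact_group_def)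
  moreover have "\<gamma> g ` J \<subseteq> J" if "g \<in> carrier G" for g
    unfolding J using C sub inv that by (rule G_algebra_closure_invariant)
  ultimately interpret equivariant_lifting A B C J G T \<alpha> \<gamma> \<phi>
    using B C \<phi> assms(2) unital_G_algebraD(1)[OF C]
    by (auto simp: equivariant_lifting_def equivariant_lifting_axioms_def fd_cstar_algebra_def
        fd_cstar_algebra_axioms_def cstar_ideal_def cstar_ideal_axioms_def A.unital_cstar_algebra_axioms
        C.unital_cstar_algebra_axioms)
  show "\<exists>n \<psi>. unital_equivariant_hom G A \<alpha> (cstar_quotient C (I n)) (quotient_action C (I n) \<gamma>) \<psi> \<and>
      (\<forall>a\<in>carrier A. coset_map C J (\<lambda>x. x) (\<psi> a) = \<phi> a)"
    using lift_to_quotient[of I] I mono J by blast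
qed

end
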